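(* Let $k/\mathbb{Q}$ be a finite extension with ring of integers $\mathcal{O}_k$. Let $I$ be an index set of cardinality $n\ge 1$. Let $H\in\mathcal{O}_k[Y,\mathbf{X}_I]$ be irreducible over $k(\mathbf{X}_I)$, monic in $Y$, and of total degree $D$. Define $\mathcal{L}_H=k(\mathbf{X}_I)[Y]/(H(Y,\mathbf{X}_I))$. Consider the following conditions. (I) $H$ is an $n$-genuine polynomial, that is to say, $k(\mathbf{X}_I)[Y]/(H(Y,\mathbf{X}_I))$ is an $n$-genuine extension of $k(\mathbf{X}_I)$. (II) Given any index $i_0\in I$, upon defining $I'=I\setminus\{i_0\}$, the following inclusion of fields is strict: $(\overline{k(\mathbf{X}_{I'})}\cap\mathcal{L}_H)(X_{i_0})\subsetneq\mathcal{L}_H$. (III) Given any index $i_0\in I$, upon defining $I'=I\setminus\{i_0\}$, there exists a point $\mathbf{x}_{I'}\in k^{n-1}$ such that $H(Y,X_{i_0},\mathbf{x}_{I'})$, as a polynomial in $Y,X_{i_0}$, does not have a linear factor in $Y$ over $\overline{\mathbb{Q}}$, and $\deg H(Y,X_{i_0},\mathbf{x}_{I'})=\deg_{Y,X_{i_0}}H(Y,\mathbf{X}_I)$. (IV) Given any index $i_0\in I$, upon defining $I'=I\setminus\{i_0\}$ and expanding $H(Y,\mathbf{X}_I)=\sum_{\ell,m}a_{\ell,m}(\mathbf{X}_{I'})Y^\ell X_{i_0}^m$ as a polynomial in $Y,X_{i_0}$, the form $B_{\mathrm{lin}}(a_{\ell,m}(\mathbf{X}_{I'}))$ is not identically zero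 as a polynomial in $\mathbf{X}_{I'}$. Then (I), (II), (III), (IV) are equivalent. Furthermore, for any fixed index $i_0\in I$, the conditions (II) for $i_0$, (III) for $i_0$, and (IV) for $i_0$ are equivalent.
   Context: $\mathbf{X}_J=(X_i)_{i\in J}$ for a set of indices $J$. A finite (nontrivial) extension $M$ of $k(\mathbf{X}_I)$ is an $n$-genuine extension if every $G(Y,\mathbf{X}_I)\in k[Y,\mathbf{X}_I]$ with $M=k(\mathbf{X}_I)[Y]/(G)$ has nonzero degree in each $X_i$, $i\in I$. A polynomial in $k[Y,\mathbf{X}_I]$ monic in $Y$ and irreducible over $k(\mathbf{X}_I)$ is $n$-genuine if the extension of $k(\mathbf{X}_I)$ it defines is $n$-genuine. $\overline{k(\mathbf{X}_{I'})}\cap\mathcal{L}_H$ is the set of elements of $\mathcal{L}_H$ algebraic over $k(\mathbf{X}_{I'})$. $\deg_{Y,X_{i_0}}H$ is the total degree of $H$ as a polynomial in $Y,X_{i_0}$ (with coefficients in $k[\mathbf{X}_{I'}]$). $H(Y,X_{i_0},\mathbf{x}_{I'})$ is the specialization $X_i\mapsto x_i$, $i\in I'$. "(II) for $i_0$" etc. means the condition for that single index. A polynomial $f(Y,Z)$ has a linear factor in $Y$ over $\overline{\mathbb{Q}}$ if $f=(Y-Q(Z))\tilde H(Y,Z)$ with $Q\in\overline{\mathbb{Q}}[Z]$, $\tilde H\in\overline{\mathbb{Q}}[Y,Z]$. $B_{\mathrm{lin}}$: for each $D_0$, a finite collection of forms with integer coefficients in variables $(A_{\ell,m})_{\ell+m\le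 D_0}$, depending only on $D_0$ (treated as a single form), such that for every $f(Y,Z)=\sum_{\ell+m\le D_0}a_{\ell,m}Y^\ell Z^m$ with coefficients in $k$ that is monic in $Y$, all forms vanish at $(a_{\ell,m})$ if and only if $f$ has a linear factor in $Y$ over $\overline{\mathbb{Q}}$ or $\deg f<D_0$. In (IV) it is used with $D_0=\deg_{Y,X_{i_0}}H$. "Not identically zero" means that at least one form of the collection, evaluated at the $a_{\ell,m}(\mathbf{X}_{I'})$, is a nonzero polynomial in $\mathbf{X}_{I'}$. *)

theory Defs
  imports
    "HOL-Library.Poly_Mapping"
    "HOL-Library.FuncSet"
    "HOL-Algebra.Algebra"
    "HOL-Algebra.Generated_Fields"
    "HOL-Algebra.Finite_Extensions"
    "HOL-Algebra.Algebraic_Closure_Type"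
    "HOL-Computational_Algebra.Computational_Algebra"
begin

section \<open>Number fields\<close>

definition number_field :: "'k::field_char_0 itself \<Rightarrow> bool" where
  "number_field _ \<longleftrightarrow>
     (\<exists>B. finite_dimensional_vector_space (\<lambda>(q::rat) (x::'k). of_rat q * x) B)"


section \<open>Polynomials in several variables\<close>

text \<open>
  A polynomial in the variables indexed by \<open>'x\<close> is a finitely supported map from exponent vectors
  to coefficients. Polynomials in \<open>Y\<close> and the \<open>X\<^sub>i\<close> are univariate polynomials in \<open>Y\<close> over these.
  The order on the index type in later definitions is only there because the library's \<open>idom\<close>
  instance, needed to form the fraction field \<open>k(X\<^sub>I)\<close>, is stated for linearly ordered exponents.
\<close>

type_synonym ('x, 'c) mpol = "('x \<Rightarrow>\<^sub>0 nat) \<Rightarrow>\<^sub>0 'c"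

text \<open>Evaluation, applying \<open>c\<close> to the coefficients and sending the variable with index \<open>j\<close> to \<open>v j\<close>.\<close>

definition eval_mpol :: "('c::zero \<Rightarrow> 'r::comm_ring_1) \<Rightarrow> ('x \<Rightarrow> 'r) \<Rightarrow> ('x, 'c) mpol \<Rightarrow> 'r" where
  "eval_mpol c v p =
     (\<Sum>e\<in>Poly_Mapping.keys p. c (Poly_Mapping.lookup p e) *
        (\<Prod>j\<in>Poly_Mapping.keys e. v j ^ Poly_Mapping.lookup e j))"

definition mvar :: "'x \<Rightarrow> ('x, 'c::comm_ring_1) mpol" where
  "mvar i = Poly_Mapping.single (Poly_Mapping.single i 1) 1"

definition integral_coeffs :: "('i, 'k::field) mpol poly \<Rightarrow> bool" where
  "integral_coeffs H \<longleftrightarrow>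
     (\<forall>l e. algebraic_int (Poly_Mapping.lookup (Polynomial.coeff H l) e))"

definition total_deg :: "('i::finite, 'k::zero) mpol poly \<Rightarrow> nat" where
  "total_deg H = Max (insert 0 {l + (\<Sum>i\<in>UNIV. Poly_Mapping.lookup e i) | l e.
     e \<in> Poly_Mapping.keys (Polynomial.coeff H l)})"

definition deg_in :: "'i \<Rightarrow> ('i, 'k::zero) mpol poly \<Rightarrow> nat" where
  "deg_in i H = Max (insert 0 {Poly_Mapping.lookup e i | l e.
     e \<in> Poly_Mapping.keys (Polynomial.coeff H l)})"

text \<open>
  \<open>as_bivariate i0 H\<close> is \<open>H\<close> as a polynomial in \<open>Y\<close> (outer) and \<open>X\<^bsub>i0\<^esub>\<close> (inner), with
  coefficients \<open>a\<^bsub>l,m\<^esub>\<close> that are polynomials in the remaining variables.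
\<close>

definition expand_in :: "'i \<Rightarrow> ('i, 'k::comm_ring_1) mpol \<Rightarrow> ('i, 'k) mpol poly" where
  "expand_in i0 p =
     (\<Sum>e\<in>Poly_Mapping.keys p.
        Polynomial.monom (Poly_Mapping.single (Poly_Mapping.update i0 0 e) (Poly_Mapping.lookup p e))
          (Poly_Mapping.lookup e i0))"

definition as_bivariate :: "'i \<Rightarrow> ('i, 'k::comm_ring_1) mpol poly \<Rightarrow> ('i, 'k) mpol poly poly" where
  "as_bivariate i0 H = map_poly (expand_in i0) H"

text \<open>The specialization of \<open>H\<close> at \<open>X\<^sub>i = x i\<close> for \<open>i \<noteq> i0\<close>; the value \<open>x i0\<close> is not used.\<close>

definition specialize ::
  "'i \<Rightarrow> ('i \<Rightarrow> 'k) \<Rightarrow> ('i, 'k::comm_ring_1) mpol poly \<Rightarrow> 'k poly poly" where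
  "specialize i0 x H = map_poly (map_poly (eval_mpol (\<lambda>c. c) x)) (as_bivariate i0 H)"

definition bideg :: "'a::zero poly poly \<Rightarrow> nat" where
  "bideg f = Max (insert 0 {l + m | l m. Polynomial.coeff (Polynomial.coeff f l) m \<noteq> 0})"


section \<open>Extensions of the rational function field\<close>

type_synonym ('i, 'k) ratfun = "('i, 'k) mpol fract"

definition ratfun_ring :: "('i::linorder, 'k::field) ratfun ring" where
  "ratfun_ring = ring_of_type_algebra"

definition ratfun_poly_ring :: "('i::linorder, 'k::field) ratfun poly ring" where
  "ratfun_poly_ring = ring_of_type_algebra"

text \<open>The quotient \<open>k(X\<^sub>I)[Y]/(G)\<close> and its structure map from \<open>k(X\<^sub>I)\<close>.\<close>

definition quot_ideal :: "('i::linorder, 'k::field) mpol poly \<Rightarrow> ('i, 'k) ratfun poly set" where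
  "quot_ideal G = PIdl\<^bsub>ratfun_poly_ring\<^esub> (map_poly to_fract G)"

definition quot_ring :: "('i::linorder, 'k::field) mpol poly \<Rightarrow> ('i, 'k) ratfun poly set ring" where
  "quot_ring G = ratfun_poly_ring Quot (quot_ideal G)"

definition quot_const ::
  "('i::linorder, 'k::field) mpol poly \<Rightarrow> ('i, 'k) ratfun \<Rightarrow> ('i, 'k) ratfun poly set" where
  "quot_const G c = quot_ideal G +>\<^bsub>ratfun_poly_ring\<^esub> [:c:]"

text \<open>
  An extension of \<open>k(X\<^sub>I)\<close> is a field \<open>M\<close> with a structure map \<open>\<iota>\<close>. The equality
  \<open>M = k(X\<^sub>I)[Y]/(G)\<close> is an isomorphism of extensions, that is, one fixing \<open>k(X\<^sub>I)\<close>.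
\<close>

definition ext_isomorphic ::
  "'m ring \<Rightarrow> (('i::linorder, 'k::field) ratfun \<Rightarrow> 'm) \<Rightarrow> ('i, 'k) mpol poly \<Rightarrow> bool" where
  "ext_isomorphic M \<iota> G \<longleftrightarrow>
     (\<exists>\<phi>\<in>ring_iso (quot_ring G) M. \<forall>c. \<phi> (quot_const G c) = \<iota> c)"

definition genuine_extension ::
  "'m ring \<Rightarrow> (('i::linorder, 'k::field) ratfun \<Rightarrow> 'm) \<Rightarrow> bool" where
  "genuine_extension M \<iota> \<longleftrightarrow>
     Ring.field M \<and> \<iota> \<in> ring_hom ratfun_ring M \<and>
     ring.finite_dimension M (range \<iota>) (carrier M) \<and>
     range \<iota> \<noteq> carrier M \<and>
     (\<forall>G. ext_isomorphic M \<iota> G \<longrightarrow> (\<forall>i. deg_in i G \<noteq> 0))"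

definition irreducible_ratfun :: "('i::linorder, 'k::field) mpol poly \<Rightarrow> bool" where
  "irreducible_ratfun H \<longleftrightarrow> Factorial_Ring.irreducible (map_poly to_fract H)"

definition genuine_polynomial :: "('i::linorder, 'k::field) mpol poly \<Rightarrow> bool" where
  "genuine_polynomial H \<longleftrightarrow>
     Polynomial.lead_coeff H = 1 \<and> irreducible_ratfun H \<and>
     genuine_extension (quot_ring H) (quot_const H)"

text \<open>\<open>k(X\<^bsub>I'\<^esub>)\<close> as a subfield of \<open>k(X\<^sub>I)\<close>, where \<open>I' = I - {i0}\<close>.\<close>

definition ratfun_without :: "'i::linorder \<Rightarrow> ('i, 'k::field) ratfun set" where
  "ratfun_without i0 = {to_fract p / to_fract q | p q.
     (\<forall>e\<in>Poly_Mapping.keys p. Poly_Mapping.lookup e i0 = 0) \<and>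
     (\<forall>e\<in>Poly_Mapping.keys q. Poly_Mapping.lookup e i0 = 0) \<and> q \<noteq> 0}"

definition algebraic_part ::
  "'i::linorder \<Rightarrow> ('i, 'k::field) mpol poly \<Rightarrow> ('i, 'k) ratfun poly set set" where
  "algebraic_part i0 H = {z \<in> carrier (quot_ring H).
     ring.algebraic (quot_ring H) (quot_const H ` ratfun_without i0) z}"


section \<open>Linear factors\<close>

text \<open>The algebraic closure of a number field \<open>'k\<close> is an algebraic closure of the rationals.\<close>

definition has_linear_factor :: "'k::field poly poly \<Rightarrow> bool" where
  "has_linear_factor f \<longleftrightarrow>
     (\<exists>(Q::'k alg_closure poly) (F::'k alg_closure poly poly).
        map_poly (map_poly to_ac) f = [: - Q, 1 :] * F)"

text \<open>Forms with integer coefficients in variables \<open>A\<^bsub>l,m\<^esub>\<close>, \<open>l + m \<le> D0\<close>.\<close>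

definition is_form :: "nat \<Rightarrow> (nat \<times> nat, int) mpol \<Rightarrow> bool" where
  "is_form D0 P \<longleftrightarrow>
     (\<exists>d. \<forall>e\<in>Poly_Mapping.keys P.
        (\<Sum>j\<in>Poly_Mapping.keys e. Poly_Mapping.lookup e j) = d) \<and>
     (\<forall>e\<in>Poly_Mapping.keys P. Poly_Mapping.keys e \<subseteq> {(l, m). l + m \<le> D0})"

definition eval_form :: "(nat \<times> nat, int) mpol \<Rightarrow> 'a::comm_ring_1 poly poly \<Rightarrow> 'a" where
  "eval_form P f = eval_mpol of_int (\<lambda>(l, m). Polynomial.coeff (Polynomial.coeff f l) m) P"

text \<open>
  The characterizing property of \<open>B\<^sub>l\<^sub>i\<^sub>n\<close>. It is required only over the given field \<open>'k\<close>, so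
  a family that works for all number fields at once is covered as well.
\<close>

definition is_B_lin :: "'k::field itself \<Rightarrow> (nat \<Rightarrow> (nat \<times> nat, int) mpol set) \<Rightarrow> bool" where
  "is_B_lin _ B \<longleftrightarrow>
     (\<forall>D0. finite (B D0) \<and> (\<forall>P\<in>B D0. is_form D0 P) \<and>
        (\<forall>f::'k poly poly. bideg f \<le> D0 \<and> Polynomial.lead_coeff f = 1 \<longrightarrow>
           ((\<forall>P\<in>B D0. eval_form P f = 0) \<longleftrightarrow> has_linear_factor f \<or> bideg f < D0)))"


section \<open>The four conditions\<close>

text \<open>The suffix \<open>_at\<close> marks the version of a condition for a single index.\<close>

definition cond_I :: "('i::{finite,linorder}, 'k::field) mpol poly \<Rightarrow> bool" where
  "cond_I H \<longleftrightarrow> genuine_polynomial H"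

definition cond_II_at :: "('i::{finite,linorder}, 'k::field) mpol poly \<Rightarrow> 'i \<Rightarrow> bool" where
  "cond_II_at H i0 \<longleftrightarrow>
     generate_field (quot_ring H)
       (algebraic_part i0 H \<union> {quot_const H (to_fract (mvar i0))}) \<subset> carrier (quot_ring H)"

definition cond_III_at :: "('i::{finite,linorder}, 'k::field) mpol poly \<Rightarrow> 'i \<Rightarrow> bool" where
  "cond_III_at H i0 \<longleftrightarrow>
     (\<exists>x \<in> (UNIV - {i0}) \<rightarrow>\<^sub>E UNIV.
        \<not> has_linear_factor (specialize i0 x H) \<and>
        bideg (specialize i0 x H) = bideg (as_bivariate i0 H))"

definition cond_IV_at ::
  "(nat \<Rightarrow> (nat \<times> nat, int) mpol set) \<Rightarrow> ('i::{finite,linorder}, 'k::field) mpol poly \<Rightarrow> 'i \<Rightarrow> bool"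
where
  "cond_IV_at B H i0 \<longleftrightarrow>
     (\<exists>P \<in> B (bideg (as_bivariate i0 H)). eval_form P (as_bivariate i0 H) \<noteq> 0)"

definition "cond_II H \<longleftrightarrow> (\<forall>i0. cond_II_at H i0)"

definition "cond_III H \<longleftrightarrow> (\<forall>i0. cond_III_at H i0)"

definition "cond_IV B H \<longleftrightarrow> (\<forall>i0. cond_IV_at B H i0)"

end

theory Submission
  imports Defs "Subresultants.More_Homomorphisms"
begin

text \<open>
  Fix an index \<open>i\<close>, write \<open>Z\<close> for the variable \<open>X\<^bsub>i\<^esub>\<close>, \<open>X'\<close> for the remaining variables, and read \<open>H\<close> as a
  polynomial \<open>f(Y, Z)\<close> with coefficients in \<open>k[X']\<close>, monic in \<open>Y\<close>. All conditions for the index \<open>i\<close> are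
  compared with one statement: over an algebraically closed field \<open>E\<close> containing \<open>k(X')\<close> there is a
  polynomial \<open>Q\<close> with \<open>f(Q(Z), Z) = 0\<close>. Here \<open>E\<close> is the algebraic closure of \<open>k(X)\<close>, and the statement is
  \<open>has_polynomial_root mpol_to_closure (as_bivariate i H)\<close>. It is the negation of \<open>cond_II_at H i\<close>, of
  \<open>cond_III_at H i\<close> and, for every choice of the forms, of \<open>cond_IV_at B H i\<close>.

  Points. A solution \<open>Q\<close> has bounded degree, so it is the interpolant of its values at finitely many
  natural numbers, and these values are roots of monic polynomials over \<open>k[X]\<close>. A homomorphism from
  \<open>k[X]\<close> to an algebraically closed field extends to finitely many integral elements
  (\<open>extend_to_finitely_many_integral_elements\<close>); hence a solution specializes at every point.
  Conversely there are only finitely many ways to interpolate roots of the fibres \<open>f(Y, j)\<close>. If none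
  of the interpolants is a solution, then each leaves a nonzero coefficient, and away from the zeros of a
  single nonzero polynomial none of them becomes a solution after specialization
  (\<open>no_polynomial_root_specialize\<close>). A point outside these zeros exists over \<open>k\<close>. The forms test
  precisely whether a specialization has lost degree or has acquired a linear factor.

  Fields. The extension \<open>L\<close> defined by \<open>H\<close> is realized as \<open>k(X)(y)\<close> for a root \<open>y\<close> of \<open>H\<close> in an algebraic
  closure of \<open>E(Z)\<close>, where \<open>k(X)\<close> is embedded by sending \<open>X\<^bsub>i\<^esub>\<close> to \<open>Z\<close> and \<open>X'\<close> to elements of \<open>E\<close>. Elements of
  \<open>L\<close> algebraic over \<open>k(X')\<close> lie in \<open>E\<close>. So if they generate \<open>L\<close> together with \<open>Z\<close>, then \<open>y\<close> lies in
  \<open>E(Z)\<close>; being integral over \<open>E[Z]\<close> it is a polynomial, and it solves \<open>f(y, Z) = 0\<close>.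

  For the converse let \<open>y = Q(Z)\<close> be a solution. In characteristic zero \<open>L\<close> is closed under \<open>d/dZ\<close>: if
  a polynomial \<open>P(Z)\<close> over \<open>E\<close> lies in \<open>L\<close>, so does its derivative (\<open>\<iota>_pderiv_mem\<close>). Repeated
  differentiation shows that the coefficients of \<open>Q\<close> lie in \<open>L\<close>, which makes each of them a rational
  expression over \<open>k(X')\<close> in \<open>Q(Z)\<close> and \<open>Z\<close>. Both sides are identities in \<open>Z\<close>, so \<open>Z\<close> may be replaced by
  a natural number \<open>t\<close> avoiding finitely many poles, and the coefficients become rational
  expressions in the constant \<open>Q(t)\<close> alone (\<open>constant_generator\<close>). Hence \<open>Q(t)\<close> generates \<open>L\<close> over \<open>k(X)\<close>.
  It is a root of \<open>f(Y, t)\<close>, which is monic of the same degree in \<open>Y\<close> and free of \<open>Z\<close>. Thus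
  \<open>cond_II_at H i\<close> fails, and \<open>L\<close> is defined by a polynomial of degree zero in \<open>X\<^bsub>i\<^esub>\<close>, so \<open>cond_I H\<close> fails
  too. Conversely a failure of \<open>cond_I H\<close> exhibits a generator of \<open>L\<close> that is algebraic over \<open>k(X')\<close> for
  some index, and \<open>cond_II_at\<close> fails for this index.
\<close>

section \<open>Ring homomorphisms on subrings of a field\<close>

definition coeffs_in :: "'a::zero set \<Rightarrow> 'a poly \<Rightarrow> bool" where
  "coeffs_in R p \<longleftrightarrow> (\<forall>i. Polynomial.coeff p i \<in> R)"

text \<open>
  Integral extensions are treated inside a fixed field: a subring is a set, and a homomorphism on it is
  a total function that is constrained on this set only.
\<close>

locale partial_hom =
  fixes R :: "'a::field set" and \<rho> :: "'a \<Rightarrow> 'b::field"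
  assumes one_mem: "1 \<in> R"
    and diff_mem: "x \<in> R \<Longrightarrow> y \<in> R \<Longrightarrow> x - y \<in> R"
    and mult_mem: "x \<in> R \<Longrightarrow> y \<in> R \<Longrightarrow> x * y \<in> R"
    and hom_one: "\<rho> 1 = 1"
    and hom_diff: "x \<in> R \<Longrightarrow> y \<in> R \<Longrightarrow> \<rho> (x - y) = \<rho> x - \<rho> y"
    and hom_mult: "x \<in> R \<Longrightarrow> y \<in> R \<Longrightarrow> \<rho> (x * y) = \<rho> x * \<rho> y"
begin

lemma zero_mem: "0 \<in> R" using diff_mem[OF one_mem one_mem] by simp
lemma hom_zero: "\<rho> 0 = 0" using hom_diff[OF one_mem one_mem] by simp
lemma uminus_mem: "x \<in> R \<Longrightarrow> - x \<in> R" using diff_mem[OF zero_mem, of x] by simp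
lemma hom_uminus: "x \<in> R \<Longrightarrow> \<rho> (- x) = - \<rho> x"
  using hom_diff[OF zero_mem, of x] by (simp add: hom_zero)
lemma add_mem: "x \<in> R \<Longrightarrow> y \<in> R \<Longrightarrow> x + y \<in> R"
  using diff_mem[of x "- y"] uminus_mem[of y] by simp
lemma hom_add: "x \<in> R \<Longrightarrow> y \<in> R \<Longrightarrow> \<rho> (x + y) = \<rho> x + \<rho> y"
  using hom_diff[of x "- y"] uminus_mem[of y] hom_uminus[of y] by simp
lemma sum_mem: "(\<And>i. i \<in> S \<Longrightarrow> f i \<in> R) \<Longrightarrow> (\<Sum>i\<in>S. f i) \<in> R"
  by (induction S rule: infinite_finite_induct) (auto intro: add_mem zero_mem)
lemma hom_sum: "(\<And>i. i \<in> S \<Longrightarrow> f i \<in> R) \<Longrightarrow> \<rho> (\<Sum>i\<in>S. f i) = (\<Sum>i\<in>S. \<rho> (f i))"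
  by (induction S rule: infinite_finite_induct) (auto simp: hom_zero hom_add sum_mem)
lemma prod_mem: "(\<And>i. i \<in> S \<Longrightarrow> f i \<in> R) \<Longrightarrow> (\<Prod>i\<in>S. f i) \<in> R"
  by (induction S rule: infinite_finite_induct) (auto intro: mult_mem one_mem)

lemmas mem_intros = zero_mem one_mem uminus_mem add_mem diff_mem mult_mem sum_mem prod_mem

lemma coeffs_in_pCons: "coeffs_in R (pCons a p) \<longleftrightarrow> a \<in> R \<and> coeffs_in R p"
proof
  assume "coeffs_in R (pCons a p)"
  then have "Polynomial.coeff (pCons a p) 0 \<in> R" "\<And>i. Polynomial.coeff (pCons a p) (Suc i) \<in> R"
    unfolding coeffs_in_def by blast+
  then show "a \<in> R \<and> coeffs_in R p" by (simp add: coeffs_in_def)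
qed (simp add: coeffs_in_def coeff_pCons split: nat.split)
lemma coeffs_in_0: "coeffs_in R 0" by (simp add: coeffs_in_def zero_mem)
lemma coeffs_in_1: "coeffs_in R 1" using coeffs_in_pCons[of 1 0] by (simp add: coeffs_in_0 one_mem)
lemma coeffs_in_diff: "coeffs_in R p \<Longrightarrow> coeffs_in R q \<Longrightarrow> coeffs_in R (p - q)"
  by (simp add: coeffs_in_def diff_mem)
lemma coeffs_in_add: "coeffs_in R p \<Longrightarrow> coeffs_in R q \<Longrightarrow> coeffs_in R (p + q)"
  by (simp add: coeffs_in_def add_mem)
lemma coeffs_in_smult: "a \<in> R \<Longrightarrow> coeffs_in R p \<Longrightarrow> coeffs_in R (Polynomial.smult a p)"
  by (simp add: coeffs_in_def mult_mem)
lemma coeffs_in_monom: "a \<in> R \<Longrightarrow> coeffs_in R (Polynomial.monom a n)"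
  by (simp add: coeffs_in_def zero_mem)
lemma coeffs_in_mult: "coeffs_in R p \<Longrightarrow> coeffs_in R q \<Longrightarrow> coeffs_in R (p * q)"
  by (simp add: coeffs_in_def coeff_mult sum_mem mult_mem)
lemma coeffs_in_sum: "(\<And>i. i \<in> S \<Longrightarrow> coeffs_in R (f i)) \<Longrightarrow> coeffs_in R (\<Sum>i\<in>S. f i)"
  by (induction S rule: infinite_finite_induct) (auto intro: coeffs_in_add coeffs_in_0)
lemma coeffs_in_prod: "(\<And>i. i \<in> S \<Longrightarrow> coeffs_in R (f i)) \<Longrightarrow> coeffs_in R (\<Prod>i\<in>S. f i)"
  by (induction S rule: infinite_finite_induct) (auto intro: coeffs_in_mult coeffs_in_1)
lemma coeffs_in_power: "coeffs_in R p \<Longrightarrow> coeffs_in R (p ^ n)"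
  by (induction n) (auto intro: coeffs_in_mult coeffs_in_1)

lemmas coeffs_in_intros = coeffs_in_0 coeffs_in_1 coeffs_in_diff coeffs_in_add coeffs_in_smult
  coeffs_in_monom coeffs_in_mult coeffs_in_sum coeffs_in_prod coeffs_in_power

lemma coeff_map_hom: "Polynomial.coeff (map_poly \<rho> p) n = \<rho> (Polynomial.coeff p n)"
  by (simp add: coeff_map_poly hom_zero)
lemma map_hom_pCons: "map_poly \<rho> (pCons a p) = pCons (\<rho> a) (map_poly \<rho> p)"
  by (rule poly_eqI) (simp add: coeff_map_hom coeff_pCons split: nat.splits)
lemma map_hom_diff: "coeffs_in R p \<Longrightarrow> coeffs_in R q \<Longrightarrow>
    map_poly \<rho> (p - q) = map_poly \<rho> p - map_poly \<rho> q"
  by (rule poly_eqI) (simp add: coeff_map_hom hom_diff coeffs_in_def)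
lemma map_hom_add: "coeffs_in R p \<Longrightarrow> coeffs_in R q \<Longrightarrow>
    map_poly \<rho> (p + q) = map_poly \<rho> p + map_poly \<rho> q"
  by (rule poly_eqI) (simp add: coeff_map_hom hom_add coeffs_in_def)
lemma map_hom_mult: "coeffs_in R p \<Longrightarrow> coeffs_in R q \<Longrightarrow>
    map_poly \<rho> (p * q) = map_poly \<rho> p * map_poly \<rho> q"
  by (rule poly_eqI)
    (simp add: coeff_map_hom coeff_mult hom_sum mult_mem hom_mult coeffs_in_def)
lemma map_hom_smult: "a \<in> R \<Longrightarrow> coeffs_in R p \<Longrightarrow>
    map_poly \<rho> (Polynomial.smult a p) = Polynomial.smult (\<rho> a) (map_poly \<rho> p)"
  by (rule poly_eqI) (simp add: coeff_map_hom hom_mult coeffs_in_def)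
lemma map_hom_monom: "map_poly \<rho> (Polynomial.monom a n) = Polynomial.monom (\<rho> a) n"
  by (rule poly_eqI) (simp add: coeff_map_hom hom_zero)
lemma map_hom_1: "map_poly \<rho> 1 = 1"
  using map_hom_pCons[of 1 0] by (simp add: hom_one)

lemma poly_mem: "coeffs_in R p \<Longrightarrow> x \<in> R \<Longrightarrow> poly p x \<in> R"
  by (induction p) (auto simp: coeffs_in_pCons intro: mem_intros)
lemma hom_poly: "coeffs_in R p \<Longrightarrow> x \<in> R \<Longrightarrow> \<rho> (poly p x) = poly (map_poly \<rho> p) (\<rho> x)"
proof (induction p)
  case (pCons a p)
  then show ?case
    by (simp add: coeffs_in_pCons map_hom_pCons hom_add hom_mult mult_mem poly_mem)
qed (simp add: hom_zero)

end

locale local_hom = partial_hom R \<rho> for R :: "'a::field set" and \<rho> :: "'a \<Rightarrow> 'b::field" +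
  assumes inverse_mem: "x \<in> R \<Longrightarrow> \<rho> x \<noteq> 0 \<Longrightarrow> inverse x \<in> R"
begin

lemma divide_mem: "x \<in> R \<Longrightarrow> y \<in> R \<Longrightarrow> \<rho> y \<noteq> 0 \<Longrightarrow> x / y \<in> R"
  by (simp add: divide_inverse mult_mem inverse_mem)
lemma hom_divide:
  assumes "x \<in> R" "y \<in> R" "\<rho> y \<noteq> 0"
  shows "\<rho> (x / y) = \<rho> x / \<rho> y"
proof -
  have "y \<noteq> 0" using assms(3) hom_zero by auto
  have "\<rho> (x / y) * \<rho> y = \<rho> x"
    using hom_mult[OF divide_mem[OF assms] assms(2)] \<open>y \<noteq> 0\<close> by simp
  then show ?thesis using assms(3) by (simp add: field_simps)
qed

end

text \<open>
  Passing to fractions with denominators outside the kernel makes the kernel the only maximal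
  ideal. The next two lemmas divide by such denominators.
\<close>

lemma (in partial_hom) localization:
  obtains R' \<rho>' where "local_hom R' \<rho>'" "R \<subseteq> R'" "\<And>r. r \<in> R \<Longrightarrow> \<rho>' r = \<rho> r"
proof -
  define R' where "R' = {s / u | s u. s \<in> R \<and> u \<in> R \<and> \<rho> u \<noteq> 0}"
  define \<rho>' where "\<rho>' x = (SOME v. \<exists>s u. s \<in> R \<and> u \<in> R \<and> \<rho> u \<noteq> 0 \<and> x = s / u \<and> v = \<rho> s / \<rho> u)"
    for x
  have nz: "u \<noteq> 0" if "\<rho> u \<noteq> 0" for u using that hom_zero by auto
  have val: "\<rho>' (s / u) = \<rho> s / \<rho> u" if su: "s \<in> R" "u \<in> R" "\<rho> u \<noteq> 0" for s u
  proof -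
    have uniq: "v = \<rho> s / \<rho> u"
      if v: "\<exists>s' u'. s' \<in> R \<and> u' \<in> R \<and> \<rho> u' \<noteq> 0 \<and> s / u = s' / u' \<and> v = \<rho> s' / \<rho> u'" for v
    proof -
      obtain s' u' where *: "s' \<in> R" "u' \<in> R" "\<rho> u' \<noteq> 0" "s / u = s' / u'" "v = \<rho> s' / \<rho> u'"
        using v by blast
      have "s * u' = s' * u" using * nz su by (simp add: field_simps)
      then have "\<rho> s * \<rho> u' = \<rho> s' * \<rho> u" using * su hom_mult by metis
      then show ?thesis using *(3,5) su(3) by (simp add: frac_eq_eq)
    qed
    show ?thesis unfolding \<rho>'_def
      by (rule uniq, rule someI[of _ "\<rho> s / \<rho> u"]) (use su in blast)
  qed
  have mem: "s / u \<in> R'" if "s \<in> R" "u \<in> R" "\<rho> u \<noteq> 0" for s u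
    using that unfolding R'_def by blast
  have incl: "r \<in> R' \<and> \<rho>' r = \<rho> r" if "r \<in> R" for r
    using mem[OF that one_mem] val[OF that one_mem] by (simp add: hom_one)
  have "local_hom R' \<rho>'"
  proof
    show "1 \<in> R'" "\<rho>' 1 = 1" using incl[OF one_mem] by (auto simp: hom_one)
  next
    fix x y assume "x \<in> R'" "y \<in> R'"
    then obtain s u t w where *: "s \<in> R" "u \<in> R" "\<rho> u \<noteq> 0" "x = s / u"
      "t \<in> R" "w \<in> R" "\<rho> w \<noteq> 0" "y = t / w"
      unfolding R'_def by blast
    have d: "x - y = (s * w - t * u) / (u * w)" "x * y = (s * t) / (u * w)"
      using * nz by (auto simp: field_simps)
    have m: "s * w - t * u \<in> R" "u * w \<in> R" "s * t \<in> R" "\<rho> (u * w) \<noteq> 0"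
      using * by (auto intro: mem_intros simp: hom_mult)
    show "x - y \<in> R'" "x * y \<in> R'"
      unfolding d using m by (auto intro: mem)
    show "\<rho>' (x - y) = \<rho>' x - \<rho>' y"
      unfolding d(1) val[OF m(1,2,4)] using * val
      by (simp add: hom_diff hom_mult mult_mem field_simps)
    show "\<rho>' (x * y) = \<rho>' x * \<rho>' y"
      unfolding d(2) val[OF m(3,2,4)] using * val
      by (simp add: hom_mult)
  next
    fix x assume "x \<in> R'" "\<rho>' x \<noteq> 0"
    then obtain s u where *: "s \<in> R" "u \<in> R" "\<rho> u \<noteq> 0" "x = s / u"
      unfolding R'_def by blast
    then have "\<rho> s \<noteq> 0" using \<open>\<rho>' x \<noteq> 0\<close> val by auto
    then show "inverse x \<in> R'" using mem[of u s] * by simp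
  qed
  then show thesis using that incl by blast
qed

text \<open>
  The kernel of \<open>\<rho>\<close> survives in the integral extension \<open>R[\<alpha>]\<close>, that is, \<open>1\<close> does not become a combination
  of powers of \<open>\<alpha>\<close> with coefficients in the kernel. This is an instance of Nakayama's lemma, proved by
  descent on two relations for \<open>\<alpha>\<close>: a monic \<open>m\<close>, and a \<open>g\<close> that reduces to a nonzero constant. If \<open>g\<close> is
  not shorter than \<open>m\<close>, division by \<open>m\<close> shortens it without changing its reduction; otherwise
  subtracting a multiple of \<open>g\<close> from \<open>m\<close> cancels the constant term of \<open>m\<close>, and a factor \<open>\<alpha>\<close> can be removed.
\<close>
lemma (in local_hom) no_unit_relation_over_maximal_ideal:
  assumes "coeffs_in R m" "Polynomial.lead_coeff m = 1" "poly m \<alpha> = 0"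
    and "coeffs_in R g" "poly g \<alpha> = 0"
    and "\<rho> (Polynomial.coeff g 0) \<noteq> 0" "\<And>i. i > 0 \<Longrightarrow> \<rho> (Polynomial.coeff g i) = 0"
  shows False
  using assms
proof (induction "Polynomial.degree m + Polynomial.degree g" arbitrary: m g rule: less_induct)
  case less
  define d n where "d = Polynomial.degree m" and "n = Polynomial.degree g"
  have "d > 0"
  proof (rule ccontr)
    assume "\<not> d > 0"
    then obtain c where "m = [:c:]" using degree_eq_zeroE d_def by auto
    then show False using less.prems(2,3) by simp
  qed
  have m0: "m \<noteq> 0" using less.prems(2) by auto
  show False
  proof (cases "n \<ge> d")
    case True
    define c where "c = Polynomial.lead_coeff g"
    have c: "c \<in> R" "\<rho> c = 0"
      using less.prems(4,7) \<open>d > 0\<close> True by (auto simp: c_def coeffs_in_def n_def)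
    define g' where "g' = g - Polynomial.smult c (Polynomial.monom 1 (n - d) * m)"
    have g'R: "coeffs_in R g'"
      unfolding g'_def using less.prems c by (intro coeffs_in_intros one_mem)
    have g'_root: "poly g' \<alpha> = 0" using less.prems by (simp add: g'_def)
    have cf: "\<rho> (Polynomial.coeff g' i) = \<rho> (Polynomial.coeff g i)" for i
    proof -
      have "coeffs_in R (Polynomial.monom 1 (n - d) * m)"
        using less.prems by (intro coeffs_in_intros one_mem)
      then show ?thesis
        using c less.prems(4) unfolding g'_def
        by (simp add: coeffs_in_def hom_diff hom_mult mult_mem)
    qed
    have "Polynomial.degree g' < n"
    proof -
      have deg: "Polynomial.degree (Polynomial.smult c (Polynomial.monom 1 (n - d) * m)) \<le> n"
        using True m0 by (simp add: degree_mult_eq degree_monom_eq d_def)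
      have "Polynomial.coeff g' n = 0"
        using less.prems(2) True
        by (simp add: g'_def c_def n_def d_def coeff_monom_mult)
      moreover have "Polynomial.degree g' \<le> n"
        unfolding g'_def using deg by (intro degree_diff_le) (auto simp: n_def)
      moreover have "n > 0" using True \<open>d > 0\<close> by simp
      ultimately show ?thesis
        by (metis leading_coeff_0_iff le_neq_implies_less degree_0)
    qed
    then show False
      using less.hyps[of m g'] less.prems g'R g'_root cf by (auto simp: n_def)
  next
    case False
    have cg: "Polynomial.coeff g 0 \<in> R" "Polynomial.coeff m 0 \<in> R"
      using less.prems by (auto simp: coeffs_in_def)
    define c where "c = Polynomial.coeff m 0 / Polynomial.coeff g 0"
    have g0: "Polynomial.coeff g 0 \<noteq> 0" using less.prems(6) hom_zero by auto
    have cR: "c \<in> R" unfolding c_def using cg less.prems(6) by (intro divide_mem)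
    have \<alpha>0: "\<alpha> \<noteq> 0" using less.prems(5) g0 by (auto simp: poly_0_coeff_0)
    obtain b m' where m': "m - Polynomial.smult c g = pCons b m'" by (metis pCons_cases)
    have "b = Polynomial.coeff (m - Polynomial.smult c g) 0" by (simp add: m')
    also have "\<dots> = 0" using g0 by (simp add: c_def)
    finally have b: "b = 0" .
    have "coeffs_in R (m - Polynomial.smult c g)"
      using less.prems cR by (intro coeffs_in_intros)
    then have m'R: "coeffs_in R m'" unfolding m' coeffs_in_pCons by simp
    have "poly (m - Polynomial.smult c g) \<alpha> = 0" using less.prems by simp
    then have root: "poly m' \<alpha> = 0" unfolding m' b using \<alpha>0 by simp
    have deg: "Polynomial.degree (m - Polynomial.smult c g) = d"
    proof (rule antisym)
      show "Polynomial.degree (m - Polynomial.smult c g) \<le> d"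
        using False by (intro degree_diff_le) (auto simp: d_def n_def)
      have "Polynomial.coeff (m - Polynomial.smult c g) d \<noteq> 0"
        using False less.prems(2) by (simp add: d_def n_def coeff_eq_0)
      then show "d \<le> Polynomial.degree (m - Polynomial.smult c g)" by (rule le_degree)
    qed
    have "m' \<noteq> 0" using deg \<open>d > 0\<close> unfolding m' b by auto
    then have deg': "Polynomial.degree m' = d - 1" using deg unfolding m' b by simp
    have "Polynomial.coeff (m - Polynomial.smult c g) d = 1"
      using False less.prems(2) by (simp add: d_def n_def coeff_eq_0)
    then have "Polynomial.lead_coeff m' = 1"
      unfolding m' b deg' using \<open>d > 0\<close> by (simp add: coeff_pCons split: nat.splits)
    then show False
      using less.hyps[of m' g] less.prems m'R root deg' \<open>d > 0\<close> by (auto simp: d_def)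
  qed
qed

text \<open>
  The polynomials over \<open>R\<close> that vanish at \<open>\<alpha>\<close> reduce under \<open>\<rho>\<close> to an ideal over the residue field. By
  the previous lemma its generator \<open>h\<close> is not constant, so it has a root \<open>\<beta>\<close>, and \<open>\<alpha>\<close> may be sent to \<open>\<beta>\<close>.
\<close>

lemma (in local_hom) extend_to_integral_element:
  fixes m :: "'a poly"
  assumes closed: "\<And>p :: 'b poly. Polynomial.degree p > 0 \<Longrightarrow> \<exists>x. poly p x = 0"
    and m: "coeffs_in R m" "Polynomial.lead_coeff m = 1" "poly m \<alpha> = 0"
  obtains R' \<rho>' where "partial_hom R' \<rho>'" "R \<subseteq> R'" "\<And>r. r \<in> R \<Longrightarrow> \<rho>' r = \<rho> r" "\<alpha> \<in> R'"
proof -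
  define rel where "rel g \<longleftrightarrow> coeffs_in R g \<and> poly g \<alpha> = 0" for g
  have "map_poly \<rho> m \<noteq> 0"
    using m(2) coeff_map_hom[of m "Polynomial.degree m"] by (auto simp: hom_one)
  then have "\<exists>g. rel g \<and> map_poly \<rho> g \<noteq> 0" using m by (auto simp: rel_def)
  then obtain g0 where g0: "rel g0" "map_poly \<rho> g0 \<noteq> 0"
    and min: "\<And>g. rel g \<Longrightarrow> map_poly \<rho> g \<noteq> 0 \<Longrightarrow>
       Polynomial.degree (map_poly \<rho> g0) \<le> Polynomial.degree (map_poly \<rho> g)"
    using ex_has_least_nat[of "\<lambda>g. rel g \<and> map_poly \<rho> g \<noteq> 0" _
        "\<lambda>g. Polynomial.degree (map_poly \<rho> g)"] by blast
  define h where "h = map_poly \<rho> g0"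
  define e where "e = Polynomial.degree h"
  have "e > 0"
  proof (rule ccontr)
    assume "\<not> e > 0"
    then have z: "Polynomial.coeff h i = 0" if "i > 0" for i
      using that by (auto simp: e_def coeff_eq_0)
    have "Polynomial.coeff h 0 \<noteq> 0"
      using g0(2) \<open>\<not> e > 0\<close> unfolding e_def h_def by (metis leading_coeff_0_iff neq0_conv)
    then show False
      using no_unit_relation_over_maximal_ideal[OF m, of g0] g0(1) z
      by (auto simp: rel_def h_def coeff_map_hom)
  qed
  then obtain \<beta> where \<beta>: "poly h \<beta> = 0" using closed unfolding e_def by blast
  \<comment> \<open>Division by \<open>h\<close> takes place over the residue field, but has to be carried out on lifts to \<open>R\<close>.\<close>
  have rel_root: "poly (map_poly \<rho> g) \<beta> = 0" if "rel g" for g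
    using that
  proof (induction "Polynomial.degree (map_poly \<rho> g)" arbitrary: g rule: less_induct)
    case less
    define n where "n = Polynomial.degree (map_poly \<rho> g)"
    show ?case
    proof (cases "map_poly \<rho> g = 0")
      case False
      have "n \<ge> e" using min[OF less.prems False] by (simp add: n_def e_def h_def)
      have gR: "coeffs_in R g" "coeffs_in R g0" using less.prems g0(1) by (auto simp: rel_def)
      have e0: "\<rho> (Polynomial.coeff g0 e) \<noteq> 0"
        using g0(2) unfolding e_def h_def by (metis coeff_map_hom leading_coeff_0_iff)
      define c where "c = Polynomial.coeff g n / Polynomial.coeff g0 e"
      have c: "c \<in> R" "\<rho> c * \<rho> (Polynomial.coeff g0 e) = \<rho> (Polynomial.coeff g n)"
        using gR e0 divide_mem[of "Polynomial.coeff g n"] hom_divide[of "Polynomial.coeff g n"]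
        by (auto simp: c_def coeffs_in_def)
      define k where "k = Polynomial.smult c (Polynomial.monom 1 (n - e) * g0)"
      have kR: "coeffs_in R k" unfolding k_def using gR c by (intro coeffs_in_intros one_mem)
      have rel': "rel (g - k)"
        using less.prems g0(1) kR by (auto simp: rel_def k_def intro: coeffs_in_diff)
      have mk: "map_poly \<rho> k = Polynomial.smult (\<rho> c) (Polynomial.monom 1 (n - e) * h)"
        unfolding k_def h_def using gR c
        by (simp add: map_hom_smult map_hom_mult map_hom_monom coeffs_in_mult coeffs_in_monom one_mem hom_one)
      have mgk: "map_poly \<rho> (g - k) = map_poly \<rho> g - map_poly \<rho> k"
        using gR kR by (intro map_hom_diff)
      have "Polynomial.degree (map_poly \<rho> (g - k)) < n"
      proof -
        have "Polynomial.degree (map_poly \<rho> k) \<le> n"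
          unfolding mk using \<open>n \<ge> e\<close> g0(2)
          by (intro order.trans[OF degree_smult_le])
             (simp add: degree_mult_eq degree_monom_eq e_def h_def)
        then have "Polynomial.degree (map_poly \<rho> (g - k)) \<le> n"
          unfolding mgk by (intro degree_diff_le) (auto simp: n_def)
        moreover have "Polynomial.coeff (map_poly \<rho> (g - k)) n = 0"
          unfolding mgk mk using \<open>n \<ge> e\<close> c(2)
          by (simp add: coeff_monom_mult h_def coeff_map_hom)
        moreover have "n > 0" using \<open>n \<ge> e\<close> \<open>e > 0\<close> by simp
        ultimately show ?thesis
          by (metis leading_coeff_0_iff le_neq_implies_less degree_0)
      qed
      then have "poly (map_poly \<rho> (g - k)) \<beta> = 0"
        using less.hyps rel' by (simp add: n_def)
      then show ?thesis unfolding mgk mk using \<beta> by simp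
    qed simp
  qed
  define R' where "R' = {poly g \<alpha> | g. coeffs_in R g}"
  define \<rho>' where "\<rho>' x = poly (map_poly \<rho> (SOME g. coeffs_in R g \<and> poly g \<alpha> = x)) \<beta>" for x
  have val: "\<rho>' (poly g \<alpha>) = poly (map_poly \<rho> g) \<beta>" if "coeffs_in R g" for g
  proof -
    define g' where "g' = (SOME g'. coeffs_in R g' \<and> poly g' \<alpha> = poly g \<alpha>)"
    have g': "coeffs_in R g' \<and> poly g' \<alpha> = poly g \<alpha>"
      unfolding g'_def by (rule someI[of _ g]) (use that in simp)
    then have "rel (g' - g)" using that by (auto simp: rel_def intro: coeffs_in_diff)
    then have "poly (map_poly \<rho> (g' - g)) \<beta> = 0" by (rule rel_root)
    then show ?thesis using g' that by (simp add: \<rho>'_def g'_def[symmetric] map_hom_diff)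
  qed
  have incl: "r \<in> R' \<and> \<rho>' r = \<rho> r" if "r \<in> R" for r
    using val[of "[:r:]"] that unfolding R'_def
    by (auto simp: coeffs_in_pCons coeffs_in_0 map_hom_pCons intro!: exI[of _ "[:r:]"])
  have "partial_hom R' \<rho>'"
  proof
    show "1 \<in> R'" "\<rho>' 1 = 1" using incl[OF one_mem] by (auto simp: hom_one)
  next
    fix x y assume "x \<in> R'" "y \<in> R'"
    then obtain p q where pq: "coeffs_in R p" "x = poly p \<alpha>" "coeffs_in R q" "y = poly q \<alpha>"
      unfolding R'_def by blast
    have d: "x - y = poly (p - q) \<alpha>" "x * y = poly (p * q) \<alpha>" using pq by auto
    show "x - y \<in> R'" "x * y \<in> R'"
      unfolding d R'_def using pq coeffs_in_diff coeffs_in_mult by blast+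
    show "\<rho>' (x - y) = \<rho>' x - \<rho>' y"
      unfolding d(1) using pq by (simp add: val coeffs_in_diff map_hom_diff del: poly_diff) simp
    show "\<rho>' (x * y) = \<rho>' x * \<rho>' y"
      unfolding d(2) using pq by (simp add: val coeffs_in_mult map_hom_mult del: poly_mult) simp
  qed
  moreover have "\<alpha> \<in> R'"
    unfolding R'_def
    by (rule CollectI, rule exI[of _ "[:0, 1:]"]) (simp add: coeffs_in_pCons coeffs_in_0 coeffs_in_1 zero_mem one_mem)
  ultimately show thesis using that incl by blast
qed

text \<open>
  Adjoining one integral element may destroy locality, so each step localizes again first.
\<close>

lemma (in partial_hom) extend_to_finitely_many_integral_elements:
  assumes closed: "\<And>p :: 'b poly. Polynomial.degree p > 0 \<Longrightarrow> \<exists>x. poly p x = 0"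
    and "finite S"
    and "\<And>\<alpha>. \<alpha> \<in> S \<Longrightarrow> \<exists>m. coeffs_in R m \<and> Polynomial.lead_coeff m = 1 \<and> poly m \<alpha> = 0"
  shows "\<exists>R' \<rho>'. partial_hom R' \<rho>' \<and> R \<subseteq> R' \<and> S \<subseteq> R' \<and> (\<forall>r\<in>R. \<rho>' r = \<rho> r)"
  using assms(2,3)
proof (induction S)
  case empty
  show ?case using partial_hom_axioms by auto
next
  case (insert \<alpha> S)
  obtain R1 \<rho>1 where 1: "partial_hom R1 \<rho>1" "R \<subseteq> R1" "S \<subseteq> R1" "\<forall>r\<in>R. \<rho>1 r = \<rho> r"
    using insert by blast
  interpret one: partial_hom R1 \<rho>1 by (rule 1)
  obtain R2 \<rho>2 where 2: "local_hom R2 \<rho>2" "R1 \<subseteq> R2" "\<And>r. r \<in> R1 \<Longrightarrow> \<rho>2 r = \<rho>1 r"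
    using one.localization by blast
  interpret two: local_hom R2 \<rho>2 by (rule 2)
  obtain m where m: "coeffs_in R m" "Polynomial.lead_coeff m = 1" "poly m \<alpha> = 0"
    using insert.prems by blast
  have "coeffs_in R2 m" using m(1) 1(2) 2(2) by (auto simp: coeffs_in_def)
  then obtain R3 \<rho>3 where 3: "partial_hom R3 \<rho>3" "R2 \<subseteq> R3" "\<And>r. r \<in> R2 \<Longrightarrow> \<rho>3 r = \<rho>2 r" "\<alpha> \<in> R3"
    using two.extend_to_integral_element[OF closed _ m(2,3)] by blast
  have "R \<subseteq> R3" "insert \<alpha> S \<subseteq> R3" using 1 2 3 by auto
  moreover have "\<rho>3 r = \<rho> r" if "r \<in> R" for r
    using that 1(2,4) 2(2,3) 3(2,3) by (metis subsetD)
  ultimately show ?case using 3(1) by blast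
qed

section \<open>Evaluation and expansion of multivariate polynomials\<close>

lemma sum_monomials:
  "(\<Sum>e\<in>Poly_Mapping.keys p. Poly_Mapping.single e (Poly_Mapping.lookup p e)) = p"
proof (rule poly_mapping_eqI)
  fix a
  have "(\<Sum>e\<in>Poly_Mapping.keys p. Poly_Mapping.lookup (Poly_Mapping.single e (Poly_Mapping.lookup p e)) a)
      = (\<Sum>e\<in>Poly_Mapping.keys p. if e = a then Poly_Mapping.lookup p e else 0)"
    by (intro sum.cong) (auto simp: lookup_single)
  then show "Poly_Mapping.lookup (\<Sum>e\<in>Poly_Mapping.keys p. Poly_Mapping.single e (Poly_Mapping.lookup p e)) a
      = Poly_Mapping.lookup p a"
    by (simp add: lookup_sum in_keys_iff)
qed

text \<open>
  Evaluation and expansion are both sums over the monomials; this is the common reason why they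
  are ring homomorphisms.
\<close>
locale monomialwise =
  fixes \<phi> :: "'e::comm_monoid_add \<Rightarrow> 'c::comm_ring_1 \<Rightarrow> 'r::comm_ring_1"
    and \<Phi> :: "('e \<Rightarrow>\<^sub>0 'c) \<Rightarrow> 'r"
  assumes \<Phi>_def: "\<And>p. \<Phi> p = (\<Sum>e\<in>Poly_Mapping.keys p. \<phi> e (Poly_Mapping.lookup p e))"
    and zero: "\<And>e. \<phi> e 0 = 0"
    and add: "\<And>e a b. \<phi> e (a + b) = \<phi> e a + \<phi> e b"
    and mult: "\<And>e f a b. \<phi> (e + f) (a * b) = \<phi> e a * \<phi> f b"
    and one: "\<phi> 0 1 = 1"
begin

lemma \<Phi>_superset:
  assumes "finite S" "Poly_Mapping.keys p \<subseteq> S"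
  shows "\<Phi> p = (\<Sum>e\<in>S. \<phi> e (Poly_Mapping.lookup p e))"
  unfolding \<Phi>_def using assms
  by (intro sum.mono_neutral_left) (auto simp: in_keys_iff zero)

lemma \<Phi>_single: "\<Phi> (Poly_Mapping.single e a) = \<phi> e a"
  by (subst \<Phi>_superset[of "{e}"]) auto

lemma \<Phi>_add: "\<Phi> (p + q) = \<Phi> p + \<Phi> q"
proof -
  define S where "S = Poly_Mapping.keys p \<union> Poly_Mapping.keys q"
  have S: "finite S" "Poly_Mapping.keys p \<subseteq> S" "Poly_Mapping.keys q \<subseteq> S"
    "Poly_Mapping.keys (p + q) \<subseteq> S"
    using keys_add[of p q] by (auto simp: S_def)
  show ?thesis
    using S by (simp add: \<Phi>_superset lookup_add add sum.distrib)
qed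

lemma \<Phi>_zero: "\<Phi> 0 = 0" by (simp add: \<Phi>_def)

lemma \<Phi>_sum: "\<Phi> (\<Sum>i\<in>S. f i) = (\<Sum>i\<in>S. \<Phi> (f i))"
  by (induction S rule: infinite_finite_induct) (auto simp: \<Phi>_add \<Phi>_zero)

lemma \<Phi>_mult: "\<Phi> (p * q) = \<Phi> p * \<Phi> q"
proof -
  have "p * q = (\<Sum>e\<in>Poly_Mapping.keys p. \<Sum>f\<in>Poly_Mapping.keys q.
      Poly_Mapping.single (e + f) (Poly_Mapping.lookup p e * Poly_Mapping.lookup q f))"
    using sum_product[of "\<lambda>e. Poly_Mapping.single e (Poly_Mapping.lookup p e)" "Poly_Mapping.keys p"
        "\<lambda>e. Poly_Mapping.single e (Poly_Mapping.lookup q e)" "Poly_Mapping.keys q"]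
    by (simp add: sum_monomials mult_single)
  then show ?thesis
    by (simp add: \<Phi>_sum \<Phi>_single mult \<Phi>_def[of p] \<Phi>_def[of q] sum_product)
qed

lemma hom: "comm_ring_hom \<Phi>"
proof
  show "\<Phi> 1 = 1" using \<Phi>_single[of 0 1] by (simp add: one)
qed (auto simp: \<Phi>_add \<Phi>_mult \<Phi>_zero)

end

lemma monomialwise_eval:
  fixes c :: "'c::comm_ring_1 \<Rightarrow> 'r::comm_ring_1"
  assumes "comm_ring_hom c"
  shows "monomialwise (\<lambda>e a. c a * (\<Prod>j\<in>Poly_Mapping.keys e. v j ^ Poly_Mapping.lookup e j))
           (eval_mpol c v)"
proof -
  interpret c: comm_ring_hom c by (rule assms)
  have sup: "(\<Prod>j\<in>Poly_Mapping.keys e. v j ^ Poly_Mapping.lookup e j)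
      = (\<Prod>j\<in>S. v j ^ Poly_Mapping.lookup e j)"
    if "finite S" "Poly_Mapping.keys e \<subseteq> S" for S and e :: "'a \<Rightarrow>\<^sub>0 nat"
    using that by (intro prod.mono_neutral_left) (auto simp: in_keys_iff)
  have add: "(\<Prod>j\<in>Poly_Mapping.keys (e + f). v j ^ Poly_Mapping.lookup (e + f) j)
      = (\<Prod>j\<in>Poly_Mapping.keys e. v j ^ Poly_Mapping.lookup e j) *
        (\<Prod>j\<in>Poly_Mapping.keys f. v j ^ Poly_Mapping.lookup f j)" for e f :: "'a \<Rightarrow>\<^sub>0 nat"
  proof -
    define S where "S = Poly_Mapping.keys e \<union> Poly_Mapping.keys f"
    have S: "finite S" "Poly_Mapping.keys (e + f) \<subseteq> S" "Poly_Mapping.keys e \<subseteq> S"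
      "Poly_Mapping.keys f \<subseteq> S" using keys_add[of e f] by (auto simp: S_def)
    show ?thesis
      unfolding sup[OF S(1,2)] sup[OF S(1,3)] sup[OF S(1,4)]
      by (simp only: lookup_add power_add prod.distrib)
  qed
  show ?thesis
    by unfold_locales (auto simp: eval_mpol_def c.hom_zero c.hom_add c.hom_mult add algebra_simps)
qed

lemmas eval_mpol_hom = monomialwise.hom[OF monomialwise_eval]

lemma eval_mpol_single: "comm_ring_hom c \<Longrightarrow> eval_mpol c v (Poly_Mapping.single e a)
    = c a * (\<Prod>j\<in>Poly_Mapping.keys e. v j ^ Poly_Mapping.lookup e j)"
  by (rule monomialwise.\<Phi>_single[OF monomialwise_eval])

lemma eval_mpol_mvar: "comm_ring_hom c \<Longrightarrow> eval_mpol c v (mvar i) = v i"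
  by (simp add: mvar_def eval_mpol_single comm_ring_hom.axioms ring_hom.axioms semiring_hom.axioms
      monoid_mult_hom.axioms one_hom.hom_one)

lemma update_0_add: "Poly_Mapping.update i 0 (e + f) =
    Poly_Mapping.update i 0 e + Poly_Mapping.update i (0::nat) f"
  by (rule poly_mapping_eqI) (simp add: lookup_update lookup_add)

lemma monomialwise_expand_in:
  "monomialwise (\<lambda>e a. Polynomial.monom (Poly_Mapping.single (Poly_Mapping.update i 0 e) a)
     (Poly_Mapping.lookup e i)) (expand_in i :: ('i, 'k::comm_ring_1) mpol \<Rightarrow> _)"
proof -
  have u: "Poly_Mapping.update i (0::nat) 0 = 0"
    by (rule poly_mapping_eqI) (simp add: lookup_update)
  show ?thesis
    by unfold_locales
      (auto simp: expand_in_def single_add add_monom[symmetric] mult_monom mult_single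
         update_0_add lookup_add u)
qed

lemmas expand_in_hom = monomialwise.hom[OF monomialwise_expand_in]
lemmas expand_in_single = monomialwise.\<Phi>_single[OF monomialwise_expand_in]

lemma expand_in_mvar: "expand_in i (mvar i) = [:0, 1:]"
proof -
  have "Poly_Mapping.update i 0 (Poly_Mapping.single i (Suc 0)) = 0"
    by (rule poly_mapping_eqI) (simp add: lookup_update lookup_single)
  then show ?thesis by (simp add: mvar_def expand_in_single monom_altdef)
qed

lemma mvar_power: "mvar i ^ n = Poly_Mapping.single (Poly_Mapping.single i n) 1"
  by (induction n) (auto simp: mvar_def mult_single single_add[symmetric])

text \<open>
  Statements about all polynomials thereby reduce to polynomials free of \<open>X\<^bsub>i\<^esub>\<close> and to \<open>X\<^bsub>i\<^esub>\<close> itself.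
\<close>

lemma poly_expand_in: "poly (expand_in i p) (mvar i) = p"
proof -
  have e: "Poly_Mapping.update i 0 e + Poly_Mapping.single i (Poly_Mapping.lookup e i) = e"
    for e :: "'a \<Rightarrow>\<^sub>0 nat"
    by (rule poly_mapping_eqI) (auto simp: lookup_update lookup_add lookup_single)
  show ?thesis
    by (simp add: expand_in_def poly_sum poly_monom mvar_power mult_single e sum_monomials)
qed

lemma expand_in_inj: "expand_in i p = expand_in i q \<longleftrightarrow> p = q"
  by (metis poly_expand_in)

text \<open>
  Nothing is said about the coefficients, so \<open>vars_in (- {i})\<close> describes the polynomials free of \<open>X\<^bsub>i\<^esub>\<close>.
\<close>

definition vars_in :: "'x set \<Rightarrow> ('x, 'c::zero) mpol \<Rightarrow> bool" where
  "vars_in V p \<longleftrightarrow> (\<forall>e\<in>Poly_Mapping.keys p. Poly_Mapping.keys e \<subseteq> V)"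

lemma vars_in_0: "vars_in V 0" by (simp add: vars_in_def)
lemma vars_in_const: "vars_in V (Poly_Mapping.single 0 c)" by (simp add: vars_in_def)
lemma vars_in_1: "vars_in V 1" by (simp add: vars_in_def)
lemma vars_in_add: "vars_in V p \<Longrightarrow> vars_in V q \<Longrightarrow> vars_in V (p + q)"
  using keys_add[of p q] by (auto simp: vars_in_def)
lemma vars_in_mult:
  fixes p q :: "('x, 'c::comm_ring_1) mpol"
  assumes "vars_in V p" "vars_in V q" shows "vars_in V (p * q)"
proof -
  have "Poly_Mapping.keys e \<subseteq> V" if e: "e \<in> Poly_Mapping.keys (p * q)" for e
  proof -
    obtain a b where ab: "a \<in> Poly_Mapping.keys p" "b \<in> Poly_Mapping.keys q" "e = a + b"
      using keys_mult[of p q] e by blast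
    then show ?thesis using assms keys_add[of a b] by (fastforce simp: vars_in_def)
  qed
  then show ?thesis by (simp add: vars_in_def)
qed
lemma vars_in_sum: "(\<And>i. i \<in> S \<Longrightarrow> vars_in V (f i)) \<Longrightarrow> vars_in V (\<Sum>i\<in>S. f i)"
  by (induction S rule: infinite_finite_induct) (auto intro: vars_in_add vars_in_0)
lemma vars_in_poly:
  fixes p :: "('x, 'c::comm_ring_1) mpol poly"
  assumes "\<And>n. vars_in V (Polynomial.coeff p n)" "vars_in V a"
  shows "vars_in V (poly p a)"
  using assms(1)
proof (induction p)
  case (pCons b p)
  have "vars_in V b" "\<And>n. vars_in V (Polynomial.coeff p n)"
    using pCons.prems[of 0] pCons.prems[of "Suc _"] by auto
  then show ?case using pCons.IH assms(2) by (auto intro: vars_in_add vars_in_mult)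
qed (simp add: vars_in_0)

lemma vars_in_iff: "vars_in (- {i}) p \<longleftrightarrow>
    (\<forall>e\<in>Poly_Mapping.keys p. Poly_Mapping.lookup e i = 0)"
  by (auto simp: vars_in_def in_keys_iff)

lemma vars_in_coeff_expand_in:
  assumes "vars_in V p"
  shows "vars_in (V - {i}) (Polynomial.coeff (expand_in i p) n)"
proof -
  have "vars_in (V - {i}) (Polynomial.coeff (Polynomial.monom (Poly_Mapping.single
      (Poly_Mapping.update i 0 e) (Poly_Mapping.lookup p e)) (Poly_Mapping.lookup e i)) n)"
    if "e \<in> Poly_Mapping.keys p" for e
    using that assms
    by (fastforce simp: vars_in_def in_keys_iff lookup_update subset_iff split: if_splits)
  then show ?thesis
    unfolding expand_in_def coeff_sum by (intro vars_in_sum)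
qed

lemma vars_in_UNIV: "vars_in UNIV p" by (simp add: vars_in_def)

lemma vars_in_coeff_expand_in': "vars_in (- {i}) (Polynomial.coeff (expand_in i p) n)"
  using vars_in_coeff_expand_in[OF vars_in_UNIV, of i p n] by (simp add: Compl_eq_Diff_UNIV)

lemma expand_in_const:
  assumes "vars_in (- {i}) p"
  shows "expand_in i p = [:p:]"
proof -
  have "expand_in i p = (\<Sum>e\<in>Poly_Mapping.keys p. [:Poly_Mapping.single e (Poly_Mapping.lookup p e):])"
    unfolding expand_in_def
  proof (rule sum.cong[OF refl])
    fix e assume e: "e \<in> Poly_Mapping.keys p"
    have 0: "Poly_Mapping.lookup e i = 0" using assms e by (simp add: vars_in_iff)
    then have "Poly_Mapping.update i 0 e = e"
      by (intro poly_mapping_eqI) (auto simp: lookup_update)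
    then show "Polynomial.monom (Poly_Mapping.single (Poly_Mapping.update i 0 e) (Poly_Mapping.lookup p e))
        (Poly_Mapping.lookup e i) = [:Poly_Mapping.single e (Poly_Mapping.lookup p e):]"
      using 0 by (simp add: monom_altdef)
  qed
  also have "\<dots> = [:\<Sum>e\<in>Poly_Mapping.keys p. Poly_Mapping.single e (Poly_Mapping.lookup p e):]"
    by (rule coeff_lift_hom.hom_sum[symmetric])
  finally show ?thesis by (simp add: sum_monomials)
qed

lemma eval_mpol_cong:
  assumes "vars_in V p" "\<And>j. j \<in> V \<Longrightarrow> v j = w j"
  shows "eval_mpol c v p = eval_mpol c w p"
  unfolding eval_mpol_def using assms
  by (intro sum.cong prod.cong arg_cong2[where f = "(*)"]) (auto simp: vars_in_def subset_iff)

lemma eval_mpol_expand_in: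
  assumes "comm_ring_hom c"
  shows "eval_mpol c v p = poly (map_poly (eval_mpol c v) (expand_in i p)) (v i)"
proof -
  interpret e: comm_ring_hom "eval_mpol c v" by (rule eval_mpol_hom[OF assms])
  show ?thesis
    using e.poly_map_poly[of "expand_in i p" "mvar i"] by (simp add: eval_mpol_mvar assms poly_expand_in)
qed

lemma id_hom: "comm_ring_hom (\<lambda>c. c)" by unfold_locales auto

text \<open>
  By induction on the number of variables: specialize all variables but one so that some
  coefficient survives, and then avoid the finitely many roots in the last variable.
\<close>

lemma nonvanishing_point:
  fixes p :: "('x, 'k::field_char_0) mpol"
  assumes "finite V" "vars_in V p" "p \<noteq> 0"
  shows "\<exists>x. eval_mpol (\<lambda>c. c) x p \<noteq> 0"
  using assms
proof (induction V arbitrary: p)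
  case empty
  have "p = Poly_Mapping.single 0 (Poly_Mapping.lookup p 0)"
  proof (rule poly_mapping_eqI)
    fix e show "Poly_Mapping.lookup p e = Poly_Mapping.lookup (Poly_Mapping.single 0 (Poly_Mapping.lookup p 0)) e"
      using empty.prems by (cases "e = 0") (auto simp: vars_in_def in_keys_iff lookup_single)
  qed
  then obtain c where c: "p = Poly_Mapping.single 0 c" by blast
  with empty.prems have "c \<noteq> 0" by auto
  then show ?case by (simp add: c eval_mpol_single[OF id_hom])
next
  case (insert i V)
  have "expand_in i p \<noteq> 0"
    using insert.prems(2) poly_expand_in[of i p] by auto
  then obtain n where n: "Polynomial.coeff (expand_in i p) n \<noteq> 0" by (auto simp: poly_eq_iff)
  have V: "vars_in V (Polynomial.coeff (expand_in i p) m)" for m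
    using vars_in_coeff_expand_in[OF insert.prems(1), of i m] insert.hyps(2)
    by (auto simp: vars_in_def)
  obtain x where x: "eval_mpol (\<lambda>c. c) x (Polynomial.coeff (expand_in i p) n) \<noteq> 0"
    using insert.IH[OF V n] by blast
  interpret e: comm_ring_hom "eval_mpol (\<lambda>c. c) x" by (rule eval_mpol_hom[OF id_hom])
  define f where "f = map_poly (eval_mpol (\<lambda>c. c) x) (expand_in i p)"
  have "Polynomial.coeff f n \<noteq> 0" using x by (simp add: f_def)
  then have "f \<noteq> 0" by auto
  then have "finite {t. poly f t = 0}" by (rule poly_roots_finite)
  then obtain t where t: "poly f t \<noteq> 0"
    using infinite_UNIV_char_0[where ?'a = 'k] by (metis (mono_tags, lifting) UNIV_eq_I mem_Collect_eq)
  have "f = map_poly (eval_mpol (\<lambda>c. c) (x(i := t))) (expand_in i p)"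
    unfolding f_def
  proof (rule poly_eqI)
    interpret e': comm_ring_hom "eval_mpol (\<lambda>c. c) (x(i := t))" by (rule eval_mpol_hom[OF id_hom])
    fix m show "Polynomial.coeff (map_poly (eval_mpol (\<lambda>c. c) x) (expand_in i p)) m =
        Polynomial.coeff (map_poly (eval_mpol (\<lambda>c. c) (x(i := t))) (expand_in i p)) m"
      using insert.hyps(2) by (auto intro!: eval_mpol_cong[OF V])
  qed
  then have "eval_mpol (\<lambda>c. c) (x(i := t)) p = poly f t"
    using eval_mpol_expand_in[OF id_hom, of "x(i := t)" p i] by simp
  then show ?case using t by metis
qed

section \<open>Interpolation\<close>

definition lagrange_basis :: "nat \<Rightarrow> nat \<Rightarrow> 'a::field poly" where
  "lagrange_basis N j = (\<Prod>i\<in>{..N} - {j}.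
     Polynomial.smult (inverse (of_nat j - of_nat i)) [:- of_nat i, 1:])"

definition interpolant :: "nat \<Rightarrow> (nat \<Rightarrow> 'a::field) \<Rightarrow> 'a poly" where
  "interpolant N s = (\<Sum>j\<le>N. Polynomial.smult (s j) (lagrange_basis N j))"

lemma poly_lagrange_basis:
  assumes "j \<le> N" "l \<le> N"
  shows "poly (lagrange_basis N j) (of_nat l :: 'a::field_char_0) = (if l = j then 1 else 0)"
proof (cases "l = j")
  case True
  have "inverse (of_nat j - of_nat i) * (of_nat j - of_nat i :: 'a) = 1" if "i \<noteq> j" for i
    using that by (intro left_inverse) simp
  moreover have "poly (Polynomial.smult c [:- b, 1:]) x = c * (x - b)" for b c x :: 'a
    by (simp add: algebra_simps)
  ultimately have "poly (Polynomial.smult (inverse (of_nat j - of_nat i)) [:- of_nat i, 1:]) (of_nat j :: 'a) = 1"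
    if "i \<noteq> j" for i using that by metis
  then show ?thesis
    unfolding lagrange_basis_def poly_prod True by (auto intro!: prod.neutral)
next
  case False
  then have "l \<in> {..N} - {j}" using assms by auto
  then have "(\<Prod>i\<in>{..N} - {j}. poly (Polynomial.smult (inverse (of_nat j - of_nat i)) [:- of_nat i, 1:])
      (of_nat l :: 'a)) = 0"
    by (intro prod_zero) (auto intro!: bexI[of _ l])
  then show ?thesis using False by (simp add: lagrange_basis_def poly_prod)
qed

lemma poly_interpolant:
  assumes "l \<le> N"
  shows "poly (interpolant N s) (of_nat l :: 'a::field_char_0) = s l"
  using assms by (simp add: interpolant_def poly_sum poly_lagrange_basis if_distrib cong: if_cong)

lemma degree_interpolant: "Polynomial.degree (interpolant N s) \<le> N"
proof -
  have "Polynomial.degree (lagrange_basis N j :: 'a poly) \<le> N" if "j \<le> N" for j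
  proof -
    have "Polynomial.degree (lagrange_basis N j :: 'a poly) \<le>
        (\<Sum>i\<in>{..N} - {j}. Polynomial.degree (Polynomial.smult (inverse (of_nat j - of_nat i :: 'a)) [:- of_nat i, 1:]))"
      unfolding lagrange_basis_def by (rule degree_prod_sum_le[unfolded o_def]) auto
    also have "\<dots> \<le> (\<Sum>i\<in>{..N} - {j}. 1)"
      by (intro sum_mono order.trans[OF degree_smult_le]) auto
    also have "\<dots> = N" using that by simp
    finally show ?thesis .
  qed
  then show ?thesis
    unfolding interpolant_def
    by (intro degree_sum_le) (auto intro: order.trans[OF degree_smult_le])
qed

lemma poly_eq_if_agree:
  fixes p q :: "'a::field_char_0 poly"
  assumes "Polynomial.degree p \<le> N" "Polynomial.degree q \<le> N"
    and "\<And>l. l \<le> N \<Longrightarrow> poly p (of_nat l) = poly q (of_nat l)"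
  shows "p = q"
proof (rule ccontr)
  assume "p \<noteq> q"
  then have nz: "p - q \<noteq> 0" by simp
  have "of_nat ` {..N} \<subseteq> {x. poly (p - q) x = 0}" using assms(3) by auto
  then have "card (of_nat ` {..N} :: 'a set) \<le> card {x. poly (p - q) x = 0}"
    using poly_roots_finite[OF nz] by (rule card_mono[rotated])
  also have "\<dots> \<le> Polynomial.degree (p - q)" using card_poly_roots_bound[OF nz] .
  also have "\<dots> \<le> N" using assms by (intro degree_diff_le)
  finally show False by (simp add: card_image inj_on_def)
qed

text \<open>
  If \<open>Q\<close> had larger degree than all coefficients of the monic polynomial \<open>g\<close>, then the leading power of
  \<open>Q\<close> would dominate every other term of \<open>poly g Q\<close>.
\<close>

lemma degree_root_le:
  fixes g :: "'a::field poly poly"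
  assumes monic: "Polynomial.lead_coeff g = 1" and root: "poly g Q = 0"
    and N: "\<And>i. Polynomial.degree (Polynomial.coeff g i) \<le> N"
  shows "Polynomial.degree Q \<le> N"
proof (rule ccontr)
  assume "\<not> Polynomial.degree Q \<le> N"
  then have e: "Polynomial.degree Q > N" by simp
  define d e where "d = Polynomial.degree g" and "e = Polynomial.degree Q"
  have "d \<noteq> 0"
  proof
    assume "d = 0"
    then obtain c where "g = [:c:]" using degree_eq_zeroE d_def by auto
    then show False using monic root by simp
  qed
  have "poly g Q = (\<Sum>i\<le>d. Polynomial.coeff g i * Q ^ i)" by (simp add: poly_altdef d_def)
  also have "\<dots> = Q ^ d + (\<Sum>i<d. Polynomial.coeff g i * Q ^ i)"
    using monic by (simp add: d_def lessThan_Suc_atMost[symmetric] flip: lessThan_Suc_atMost)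
  finally have eq: "Q ^ d = - (\<Sum>i<d. Polynomial.coeff g i * Q ^ i)"
    using root by (simp add: eq_neg_iff_add_eq_0)
  have "Polynomial.degree (Polynomial.coeff g i * Q ^ i) \<le> N + e * (d - 1)" if "i < d" for i
  proof -
    have "Polynomial.degree (Polynomial.coeff g i * Q ^ i) \<le> N + e * i"
      using N[of i] by (intro order.trans[OF degree_mult_le] add_mono)
        (auto simp: e_def mult.commute intro: order.trans[OF degree_power_le])
    also have "\<dots> \<le> N + e * (d - 1)" using that by (intro add_left_mono mult_left_mono) auto
    finally show ?thesis .
  qed
  then have "Polynomial.degree (Q ^ d) \<le> N + e * (d - 1)"
    unfolding eq by (auto intro!: degree_sum_le)
  moreover have "Polynomial.degree (Q ^ d) = e * d"
  proof -
    have "Q \<noteq> 0" using e by auto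
    then show ?thesis by (simp add: e_def degree_power_eq mult.commute)
  qed
  moreover have "N + e * (d - 1) < e * d"
    using e \<open>d \<noteq> 0\<close> by (cases d) (auto simp: e_def)
  ultimately show False by simp
qed

section \<open>Polynomial roots under specialization\<close>

lemma (in partial_hom) coeffs_in_interpolant:
  assumes "\<And>j i. j \<noteq> i \<Longrightarrow> inverse (of_nat j - of_nat i) \<in> R" "\<And>j. j \<le> N \<Longrightarrow> s j \<in> R"
  shows "coeffs_in R (interpolant N s)"
proof -
  have n: "of_nat i \<in> R" for i by (induction i) (auto intro: mem_intros)
  show ?thesis
    unfolding interpolant_def lagrange_basis_def
    by (intro coeffs_in_sum coeffs_in_smult coeffs_in_prod)
       (auto simp: coeffs_in_pCons coeffs_in_0 coeffs_in_1 assms n one_mem uminus_mem)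
qed

lemma (in partial_hom) linear_factors:
  assumes "set_mset M \<subseteq> R"
  shows "coeffs_in R (\<Prod>x\<in>#M. [:- x, 1:]) \<and>
    map_poly \<rho> (\<Prod>x\<in>#M. [:- x, 1:]) = (\<Prod>x\<in>#M. [:- \<rho> x, 1:])"
  using assms
proof (induction M)
  case empty
  show ?case by (simp add: coeffs_in_1 map_hom_1)
next
  case (add x M)
  have "coeffs_in R [:- x, 1:]" using add.prems
    by (simp add: coeffs_in_pCons coeffs_in_0 coeffs_in_1 uminus_mem one_mem)
  moreover have "map_poly \<rho> [:- x, 1:] = [:- \<rho> x, 1:]"
    using add.prems by (simp add: map_hom_pCons hom_uminus map_hom_1)
  ultimately show ?case using add by (simp only: prod_mset.insert image_mset_add_mset)
    (simp add: coeffs_in_mult map_hom_mult del: mult_pCons_left mult_pCons_right)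
qed

text \<open>
  Here \<open>\<sigma>\<close> is a specialization of the base ring \<open>'a\<close>, and \<open>\<rho>\<close> prolongs it along the embedding \<open>\<tau>\<close>.
\<close>
locale extended_hom = partial_hom R \<rho> for R :: "'e::field set" and \<rho> :: "'e \<Rightarrow> 'f::field" +
  fixes \<tau> :: "'a::idom \<Rightarrow> 'e" and \<sigma> :: "'a \<Rightarrow> 'f"
  assumes \<tau>: "comm_ring_hom \<tau>" and \<sigma>: "comm_ring_hom \<sigma>"
    and \<tau>_mem: "\<tau> a \<in> R" and \<rho>_\<tau>: "\<rho> (\<tau> a) = \<sigma> a"
begin

sublocale \<tau>: comm_ring_hom \<tau> by (rule \<tau>)
sublocale \<sigma>: comm_ring_hom \<sigma> by (rule \<sigma>)

lemma coeffs_in_map: "coeffs_in R (map_poly \<tau> p)"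
  by (simp add: coeffs_in_def \<tau>_mem)
lemma map_map: "map_poly \<rho> (map_poly \<tau> p) = map_poly \<sigma> p"
  by (rule poly_eqI) (simp add: coeff_map_hom \<rho>_\<tau>)

lemma substitute:
  assumes "coeffs_in R Q"
  shows "coeffs_in R (poly (map_poly (map_poly \<tau>) F) Q) \<and>
    map_poly \<rho> (poly (map_poly (map_poly \<tau>) F) Q) = poly (map_poly (map_poly \<sigma>) F) (map_poly \<rho> Q)"
proof (induction F)
  case 0
  show ?case by (simp add: coeffs_in_0)
next
  case (pCons p F)
  have "map_poly (map_poly \<tau>) (pCons p F) = pCons (map_poly \<tau> p) (map_poly (map_poly \<tau>) F)"
    "map_poly (map_poly \<sigma>) (pCons p F) = pCons (map_poly \<sigma> p) (map_poly (map_poly \<sigma>) F)"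
    using pCons.hyps by (auto simp: map_poly_pCons)
  then show ?case
    using pCons.IH assms
    by (simp add: coeffs_in_add coeffs_in_mult coeffs_in_map map_hom_add map_hom_mult map_map)
qed

end

text \<open>
  The starting point of the extension is the image of \<open>\<tau>\<close>, on which \<open>\<sigma>\<close> is defined because \<open>\<tau>\<close> is
  injective.
\<close>

lemma extended_hom_exists:
  fixes \<tau> :: "'a::idom \<Rightarrow> 'e::field" and \<sigma> :: "'a \<Rightarrow> 'f::alg_closed_field"
  assumes \<tau>: "comm_ring_hom \<tau>" "inj \<tau>" and \<sigma>: "comm_ring_hom \<sigma>"
    and S: "finite S" "\<And>\<alpha>. \<alpha> \<in> S \<Longrightarrow> \<exists>m. Polynomial.lead_coeff m = 1 \<and> poly (map_poly \<tau> m) \<alpha> = 0"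
  shows "\<exists>R \<rho>. extended_hom R \<rho> \<tau> \<sigma> \<and> S \<subseteq> R"
proof -
  interpret \<tau>: comm_ring_hom \<tau> by (rule \<tau>)
  interpret \<sigma>: comm_ring_hom \<sigma> by (rule \<sigma>)
  define \<rho>0 where "\<rho>0 x = \<sigma> (inv_into UNIV \<tau> x)" for x
  have \<rho>0: "\<rho>0 (\<tau> a) = \<sigma> a" for a by (simp add: \<rho>0_def \<tau>(2))
  interpret base: partial_hom "range \<tau>" \<rho>0
  proof
    show "1 \<in> range \<tau>" "\<rho>0 1 = 1" using \<rho>0[of 1] by (auto intro: range_eqI[of _ _ 1])
  next
    fix x y assume "x \<in> range \<tau>" "y \<in> range \<tau>"
    then obtain a b where ab: "x = \<tau> a" "y = \<tau> b" by blast
    have d: "x - y = \<tau> (a - b)" "x * y = \<tau> (a * b)" by (simp_all add: ab \<tau>.hom_minus \<tau>.hom_mult)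
    show "x - y \<in> range \<tau>" "x * y \<in> range \<tau>" unfolding d by auto
    show "\<rho>0 (x - y) = \<rho>0 x - \<rho>0 y" "\<rho>0 (x * y) = \<rho>0 x * \<rho>0 y"
      unfolding d by (simp_all only: \<rho>0 ab \<sigma>.hom_minus \<sigma>.hom_mult)
  qed
  have "\<exists>m. coeffs_in (range \<tau>) m \<and> Polynomial.lead_coeff m = 1 \<and> poly m \<alpha> = 0" if \<alpha>: "\<alpha> \<in> S" for \<alpha>
  proof -
    obtain m where m: "Polynomial.lead_coeff m = 1" "poly (map_poly \<tau> m) \<alpha> = 0" using S(2)[OF \<alpha>] by blast
    have "Polynomial.degree (map_poly \<tau> m) = Polynomial.degree m"
      using m(1) by (intro antisym degree_map_poly_le) (auto intro!: le_degree)
    then have "Polynomial.lead_coeff (map_poly \<tau> m) = 1" using m(1) by simp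
    then show ?thesis using m(2) by (intro exI[of _ "map_poly \<tau> m"]) (auto simp: coeffs_in_def)
  qed
  then obtain R \<rho> where R: "partial_hom R \<rho>" "range \<tau> \<subseteq> R" "S \<subseteq> R" "\<forall>r\<in>range \<tau>. \<rho> r = \<rho>0 r"
    using base.extend_to_finitely_many_integral_elements[OF alg_closed_imp_poly_has_root S(1)]
    by metis
  interpret partial_hom R \<rho> by (rule R(1))
  have "extended_hom R \<rho> \<tau> \<sigma>"
    using R \<tau>(1) \<sigma> \<rho>0 by unfold_locales (auto dest: comm_ring_hom.axioms)
  then show ?thesis using R(3) by blast
qed

lemma substitute_at_nat:
  assumes "comm_ring_hom h"
  shows "poly (poly (map_poly (map_poly h) F) Q) (of_nat j) =
    poly (map_poly h (map_poly (\<lambda>p. poly p (of_nat j)) F)) (poly Q (of_nat j))"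
proof (induction F)
  case (pCons p F)
  interpret h: comm_ring_hom h by (rule assms)
  interpret mh: map_poly_comm_ring_hom h by unfold_locales
  have 1: "map_poly (map_poly h) (pCons p F) = pCons (map_poly h p) (map_poly (map_poly h) F)"
    "map_poly (\<lambda>p. poly p (of_nat j)) (pCons p F)
      = pCons (poly p (of_nat j)) (map_poly (\<lambda>p. poly p (of_nat j)) F)"
    using pCons.hyps by (auto simp: map_poly_pCons)
  have 2: "poly (map_poly h p) (of_nat j) = h (poly p (of_nat j))"
    using h.poly_map_poly[of p "of_nat j"] by (simp add: h.hom_of_nat)
  show ?case using pCons.IH by (simp add: 1 2 h.map_poly_pCons_hom)
qed simp

lemma monic_map_poly:
  assumes "Polynomial.lead_coeff p = 1" "h 1 = 1" "h 0 = 0" "(1::'b::{comm_semiring_1}) \<noteq> 0"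
  shows "Polynomial.lead_coeff (map_poly h p) = (1::'b)"
    and "Polynomial.degree (map_poly h p) = Polynomial.degree p"
proof -
  show "Polynomial.degree (map_poly h p) = Polynomial.degree p"
    using assms by (intro antisym degree_map_poly_le le_degree) (simp add: coeff_map_poly)
  then show "Polynomial.lead_coeff (map_poly h p) = 1"
    using assms by (simp add: coeff_map_poly)
qed

text \<open>
  \<open>F\<close> is a polynomial in an outer variable \<open>Y\<close> and an inner variable \<open>Z\<close>. A solution \<open>Y = Q(Z)\<close> amounts
  to a linear factor in \<open>Y\<close> over the target of \<open>h\<close>.
\<close>

definition has_polynomial_root :: "('a::comm_ring_1 \<Rightarrow> 'f::field) \<Rightarrow> 'a poly poly \<Rightarrow> bool" where
  "has_polynomial_root h F \<longleftrightarrow> (\<exists>Q. poly (map_poly (map_poly h) F) Q = 0)"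

text \<open>
  Algebraicity is stated in the form that is used: a nonzero \<open>c\<close> divides the image of some nonzero \<open>a\<close>
  with a quotient that is a polynomial in \<open>c\<close>. So \<open>c\<close> cannot specialize to zero unless \<open>a\<close> does. The last
  assumption puts the rational numbers into the base ring, as interpolation at natural numbers requires.
\<close>

locale algebraic_embedding =
  fixes \<tau> :: "'a::idom \<Rightarrow> 'e::{alg_closed_field,field_char_0}"
  assumes \<tau>: "comm_ring_hom \<tau>" and inj: "inj \<tau>"
    and algebraic: "c \<noteq> 0 \<Longrightarrow> \<exists>a h. a \<noteq> 0 \<and> \<tau> a = c * poly (map_poly \<tau> h) c"
    and rational: "n > 0 \<Longrightarrow> (of_nat n :: 'a) dvd 1"
begin

sublocale \<tau>: comm_ring_hom \<tau> by (rule \<tau>)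

context
  fixes F :: "'a poly poly" and N :: nat
  assumes monic: "Polynomial.lead_coeff F = 1"
  defines "N \<equiv> Max ((\<lambda>i. Polynomial.degree (Polynomial.coeff F i)) ` {..Polynomial.degree F})"
begin

definition "fibre j = map_poly (\<lambda>p. poly p (of_nat j)) F"

lemma fibre_monic: "Polynomial.lead_coeff (fibre j) = 1"
  unfolding fibre_def by (rule monic_map_poly) (auto simp: monic)

lemma degree_coeff_le: "Polynomial.degree (Polynomial.coeff F i) \<le> N"
proof (cases "i \<le> Polynomial.degree F")
  case True
  then show ?thesis unfolding N_def by (intro Max_ge) auto
qed (simp add: coeff_eq_0)

lemma degree_solution_le:
  assumes h: "comm_ring_hom (h :: 'a \<Rightarrow> 'f::field)" and "poly (map_poly (map_poly h) F) Q = 0"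
  shows "Polynomial.degree Q \<le> N"
proof -
  interpret h: comm_ring_hom h by (rule h)
  interpret mh: map_poly_comm_ring_hom h by unfold_locales
  show ?thesis
  proof (rule degree_root_le[OF _ assms(2)])
    show "Polynomial.lead_coeff (map_poly (map_poly h) F) = 1"
      by (rule monic_map_poly) (auto simp: monic)
    show "Polynomial.degree (Polynomial.coeff (map_poly (map_poly h) F) i) \<le> N" for i
      using degree_coeff_le[of i] degree_map_poly_le[of h "Polynomial.coeff F i"]
      by (simp add: coeff_map_poly)
  qed
qed

lemma solution_at_nat:
  assumes "comm_ring_hom h" "poly (map_poly (map_poly h) F) Q = 0"
  shows "poly (map_poly h (fibre j)) (poly Q (of_nat j)) = 0"
  using substitute_at_nat[OF assms(1), of F Q j] assms(2) by (simp add: fibre_def)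

lemma inverse_nat_mem:
  assumes "extended_hom R \<rho> \<tau> \<sigma>" "j \<noteq> i"
  shows "inverse (of_nat j - of_nat i) \<in> R"
proof -
  interpret extended_hom R \<rho> \<tau> \<sigma> by (rule assms(1))
  have pos: "inverse (of_nat n) \<in> R" if n: "n > 0" for n
  proof -
    obtain u where "1 = of_nat n * (u :: 'a)" using rational[OF n] by (auto elim: dvdE)
    then have "\<tau> 1 = \<tau> (of_nat n * u)" by simp
    then have "inverse (of_nat n) = \<tau> u"
      using n by (simp add: \<tau>.hom_mult \<tau>.hom_of_nat field_simps)
    then show ?thesis by (simp add: \<tau>_mem)
  qed
  show ?thesis
  proof (cases "j > i")
    case True
    then show ?thesis using pos[of "j - i"] by (simp add: of_nat_diff)
  next
    case False
    have "inverse (of_nat j - of_nat i :: 'e) = - inverse (of_nat (i - j))"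
      using False by (subst inverse_minus_eq[symmetric]) (simp add: of_nat_diff)
    then show ?thesis using pos[of "i - j"] uminus_mem assms(2) False by simp
  qed
qed

text \<open>
  The solution is interpolated from roots of the fibres, which are integral, so the specialization
  extends to its coefficients.
\<close>
lemma polynomial_root_specialize:
  assumes \<sigma>: "comm_ring_hom (\<sigma> :: 'a \<Rightarrow> 'f::{alg_closed_field,field_char_0})"
    and "has_polynomial_root \<tau> F"
  shows "has_polynomial_root \<sigma> F"
proof -
  obtain Q where Q: "poly (map_poly (map_poly \<tau>) F) Q = 0"
    using assms(2) by (auto simp: has_polynomial_root_def)
  define S where "S = (\<lambda>j. poly Q (of_nat j)) ` {..N}"
  have "\<exists>m. Polynomial.lead_coeff m = 1 \<and> poly (map_poly \<tau> m) \<alpha> = 0" if "\<alpha> \<in> S" for \<alpha>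
    using that solution_at_nat[OF \<tau> Q] fibre_monic by (auto simp: S_def)
  then obtain R \<rho> where R: "extended_hom R \<rho> \<tau> \<sigma>" "S \<subseteq> R"
    using extended_hom_exists[OF \<tau> inj \<sigma>, of S] by (auto simp: S_def)
  interpret extended_hom R \<rho> \<tau> \<sigma> by (rule R)
  have "Q = interpolant N (\<lambda>j. poly Q (of_nat j))"
    by (rule poly_eq_if_agree[OF degree_solution_le[OF \<tau> Q] degree_interpolant])
       (simp add: poly_interpolant)
  moreover have "coeffs_in R (interpolant N (\<lambda>j. poly Q (of_nat j)))"
    using R(2) by (intro coeffs_in_interpolant inverse_nat_mem[OF R(1)]) (auto simp: S_def)
  ultimately have "coeffs_in R Q" by simp
  from substitute[OF this, of F] show ?thesis
    by (auto simp: Q has_polynomial_root_def intro!: exI[of _ "map_poly \<rho> Q"])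
qed

text \<open>
  Every solution after specialization lifts to one of finitely many interpolants of roots of the
  fibres. If none of these is a solution, each leaves a nonzero coefficient, and it suffices that
  the specialization does not vanish at a multiple of these coefficients.
\<close>
lemma no_polynomial_root_specialize:
  assumes "\<not> has_polynomial_root \<tau> F"
  shows "\<exists>a. a \<noteq> 0 \<and> (\<forall>\<sigma> :: 'a \<Rightarrow> 'f::{alg_closed_field,field_char_0}.
    comm_ring_hom \<sigma> \<longrightarrow> \<sigma> a \<noteq> 0 \<longrightarrow> \<not> has_polynomial_root \<sigma> F)"
proof -
  define Y where "Y j = {y. poly (map_poly \<tau> (fibre j)) y = 0}" for j
  have lead: "Polynomial.lead_coeff (map_poly \<tau> (fibre j)) = 1" for j
    by (rule monic_map_poly) (auto simp: fibre_monic)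
  have nonzero: "map_poly \<tau> (fibre j) \<noteq> 0" for j
    using lead[of j] leading_coeff_0_iff by (metis zero_neq_one)
  then have fin: "finite (Y j)" for j
    unfolding Y_def by (intro poly_roots_finite)
  define G where "G s = poly (map_poly (map_poly \<tau>) F) (interpolant N s)" for s
  have "G s \<noteq> 0" for s using assms by (auto simp: G_def has_polynomial_root_def)
  then have "\<exists>n. Polynomial.coeff (G s) n \<noteq> 0" for s by (auto simp: poly_eq_iff)
  then obtain n where n: "\<And>s. Polynomial.coeff (G s) (n s) \<noteq> 0" by metis
  have "\<exists>a h. a \<noteq> 0 \<and> \<tau> a = Polynomial.coeff (G s) (n s) * poly (map_poly \<tau> h) (Polynomial.coeff (G s) (n s))" for s
    using algebraic[OF n] .
  then obtain a h where a: "\<And>s. a s \<noteq> 0"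
    "\<And>s. \<tau> (a s) = Polynomial.coeff (G s) (n s) * poly (map_poly \<tau> (h s)) (Polynomial.coeff (G s) (n s))"
    by metis
  define Z where "Z = Pi\<^sub>E {..N} Y"
  have finZ: "finite Z" unfolding Z_def by (intro finite_PiE) (auto simp: fin)
  show ?thesis
  proof (intro exI[of _ "\<Prod>s\<in>Z. a s"] conjI allI impI notI)
    show "(\<Prod>s\<in>Z. a s) = 0 \<Longrightarrow> False" using finZ a by (auto simp: prod_zero_iff)
  next
    fix \<sigma> :: "'a \<Rightarrow> 'f"
    assume \<sigma>: "comm_ring_hom \<sigma>" and nz: "\<sigma> (\<Prod>s\<in>Z. a s) \<noteq> 0" and "has_polynomial_root \<sigma> F"
    then obtain q where q: "poly (map_poly (map_poly \<sigma>) F) q = 0" by (auto simp: has_polynomial_root_def)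
    define S where "S = (\<Union>j\<le>N. Y j)"
    have "\<exists>m. Polynomial.lead_coeff m = 1 \<and> poly (map_poly \<tau> m) \<alpha> = 0" if "\<alpha> \<in> S" for \<alpha>
      using that fibre_monic by (auto simp: S_def Y_def)
    then obtain R \<rho> where R: "extended_hom R \<rho> \<tau> \<sigma>" "S \<subseteq> R"
      using extended_hom_exists[OF \<tau> inj \<sigma>, of S] fin by (auto simp: S_def)
    interpret extended_hom R \<rho> \<tau> \<sigma> by (rule R)
    have lift: "\<exists>y\<in>Y j. \<rho> y = poly q (of_nat j)" if "j \<le> N" for j
    proof -
      obtain M where M: "map_poly \<tau> (fibre j) = (\<Prod>x\<in>#M. [:- x, 1:])"
        using alg_closed_imp_factorization[OF nonzero] lead[of j] by (metis smult_1_left)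
      have MY: "x \<in> Y j" if x: "x \<in># M" for x
      proof -
        have "poly (\<Prod>x\<in>#M. [:- x, 1:]) x = 0"
          using x by (auto simp: poly_prod_mset prod_mset_zero_iff)
        then show ?thesis by (simp add: Y_def M)
      qed
      then have "set_mset M \<subseteq> R" using R(2) that by (auto simp: S_def)
      then have "map_poly \<sigma> (fibre j) = (\<Prod>x\<in>#M. [:- \<rho> x, 1:])"
        using linear_factors[of M] M map_map[of "fibre j"] by simp
      then have "poly (\<Prod>x\<in>#M. [:- \<rho> x, 1:]) (poly q (of_nat j)) = 0"
        using solution_at_nat[OF \<sigma> q, of j] by simp
      then have "\<exists>x\<in>#M. \<rho> x = poly q (of_nat j)"
        by (auto simp: poly_prod_mset prod_mset_zero_iff)
      then show ?thesis using MY by blast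
    qed
    \<comment> \<open>The candidates are indexed by the extensional functions in \<open>Z\<close>, hence the restriction.\<close>
    define s where "s = restrict (\<lambda>j. SOME y. y \<in> Y j \<and> \<rho> y = poly q (of_nat j)) {..N}"
    have s: "s j \<in> Y j" "\<rho> (s j) = poly q (of_nat j)" if "j \<le> N" for j
    proof -
      have "\<exists>y. y \<in> Y j \<and> \<rho> y = poly q (of_nat j)" using lift[OF that] by blast
      from someI_ex[OF this] show "s j \<in> Y j" "\<rho> (s j) = poly q (of_nat j)"
        using that by (auto simp: s_def)
    qed
    have sZ: "s \<in> Z" unfolding Z_def using s by (auto simp: s_def)
    have sR: "coeffs_in R (interpolant N s)"
      using R(2) s by (intro coeffs_in_interpolant inverse_nat_mem[OF R(1)]) (auto simp: S_def)
    have "map_poly \<rho> (interpolant N s) = q"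
    proof (rule poly_eq_if_agree)
      show "Polynomial.degree (map_poly \<rho> (interpolant N s)) \<le> N"
        using degree_map_poly_le degree_interpolant by (rule order.trans)
      show "Polynomial.degree q \<le> N" by (rule degree_solution_le[OF \<sigma> q])
      fix l assume l: "l \<le> N"
      have \<rho>n: "\<rho> (of_nat l) = of_nat l" "of_nat l \<in> R"
        using \<rho>_\<tau>[of "of_nat l"] \<tau>_mem[of "of_nat l"] by (simp_all add: \<tau>.hom_of_nat \<sigma>.hom_of_nat)
      show "poly (map_poly \<rho> (interpolant N s)) (of_nat l) = poly q (of_nat l)"
        using hom_poly[OF sR \<rho>n(2)] s(2)[OF l] by (simp add: poly_interpolant[OF l] \<rho>n(1))
    qed
    then have G: "coeffs_in R (G s)" "map_poly \<rho> (G s) = 0"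
      using substitute[OF sR, of F] q by (auto simp: G_def)
    define c where "c = Polynomial.coeff (G s) (n s)"
    have cR: "c \<in> R" "\<rho> c = 0"
      using G coeff_map_hom[of "G s" "n s"] by (auto simp: c_def coeffs_in_def)
    have "\<sigma> (a s) = \<rho> (c * poly (map_poly \<tau> (h s)) c)"
      using \<rho>_\<tau>[of "a s"] a(2)[of s] by (simp add: c_def)
    also have "\<dots> = 0" using cR by (simp add: hom_mult poly_mem coeffs_in_map)
    finally have "\<sigma> (\<Prod>s\<in>Z. a s) = 0"
      using finZ sZ by (simp add: \<sigma>.hom_prod prod_zero_iff) blast
    with nz show False by simp
  qed
qed

end
end

section \<open>Rational functions and their algebraic closure\<close>

text \<open>
  Fields of fractions inherit characteristic zero; this makes the algebraic closure of \<open>k(X)\<close> a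
  field of characteristic zero as well.
\<close>

instance fract :: ("{idom,ring_char_0}") field_char_0
proof
  have "of_nat m = (of_nat n :: 'a fract) \<longleftrightarrow> m = n" for m n
  proof -
    have "of_nat m = (of_nat n :: 'a fract) \<longleftrightarrow> to_fract (of_nat m :: 'a) = to_fract (of_nat n)"
      by (simp add: to_fract_hom.hom_of_nat)
    then show ?thesis by simp
  qed
  then show "inj (of_nat :: nat \<Rightarrow> 'a fract)" by (auto intro: injI)
qed

lemma clear_denominators:
  fixes p :: "'a::idom fract poly"
  shows "\<exists>b q. b \<noteq> 0 \<and> map_poly to_fract q = Polynomial.smult (to_fract b) p"
proof (induction p)
  case 0
  show ?case by (intro exI[of _ 1] exI[of _ 0]) simp
next
  case (pCons c p)
  obtain b q where bq: "b \<noteq> 0" "map_poly to_fract q = Polynomial.smult (to_fract b) p"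
    using pCons.IH by blast
  obtain n d where nd: "c = to_fract n / to_fract d" "d \<noteq> 0"
    by (cases c) (auto simp: Fract_conv_to_fract)
  have "map_poly to_fract (pCons (n * b) (Polynomial.smult d q)) =
      Polynomial.smult (to_fract (b * d)) (pCons c p)"
    using nd bq by (simp add: to_fract_hom.map_poly_pCons_hom fract_poly_smult algebra_simps)
  then show ?case using bq nd by (intro exI[of _ "b * d"] exI) auto
qed

definition mpol_to_closure :: "('i::linorder, 'k::field) mpol \<Rightarrow> ('i, 'k) ratfun alg_closure" where
  "mpol_to_closure p = to_ac (to_fract p)"

lemma to_ac_hom: "comm_ring_hom to_ac"
  by unfold_locales auto

lemma comp_hom: "comm_ring_hom f \<Longrightarrow> comm_ring_hom g \<Longrightarrow> comm_ring_hom (\<lambda>x. g (f x))"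
proof -
  assume "comm_ring_hom f" "comm_ring_hom g"
  then interpret f: comm_ring_hom f + g: comm_ring_hom g by simp_all
  show ?thesis by unfold_locales (auto simp: f.hom_add g.hom_add f.hom_mult g.hom_mult)
qed

lemma mpol_to_closure_hom: "comm_ring_hom mpol_to_closure"
  by unfold_locales (auto simp: mpol_to_closure_def)

lemma mpol_to_closure_eq_iff: "mpol_to_closure p = mpol_to_closure q \<longleftrightarrow> p = q"
  by (simp add: mpol_to_closure_def)

text \<open>
  Every element of the closure satisfies a polynomial relation over \<open>k[X]\<close>; after division by a
  power of the element the relation has a nonzero constant term \<open>a\<close>, which the element divides.
\<close>

lemma algebraic_embedding_mpol:
  "algebraic_embedding (mpol_to_closure :: ('i::linorder, 'k::field_char_0) mpol \<Rightarrow> _)"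
proof -
  interpret \<tau>: comm_ring_hom "mpol_to_closure :: ('i, 'k) mpol \<Rightarrow> _" by (rule mpol_to_closure_hom)
  show ?thesis
  proof
    show "inj (mpol_to_closure :: ('i, 'k) mpol \<Rightarrow> _)"
      by (rule injI) (simp add: mpol_to_closure_eq_iff)
  next
    fix c :: "('i, 'k) ratfun alg_closure" assume c: "c \<noteq> 0"
    obtain p where p: "p \<noteq> 0" "poly (map_poly to_ac p) c = 0" using alg_closure_algebraic by blast
    obtain b q where bq: "b \<noteq> 0" "map_poly to_fract q = Polynomial.smult (to_fract b) p"
      using clear_denominators[of p] by blast
    have "map_poly mpol_to_closure q = map_poly to_ac (map_poly to_fract q)"
      by (rule poly_eqI) (simp add: coeff_map_poly mpol_to_closure_def)
    also have "\<dots> = Polynomial.smult (to_ac (to_fract b)) (map_poly to_ac p)"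
      unfolding bq(2) by (rule poly_eqI) (simp add: coeff_map_poly)
    finally have "poly (map_poly mpol_to_closure q) c = 0" using p by simp
    moreover have "q \<noteq> 0" using bq p by auto
    ultimately show "\<exists>a h. a \<noteq> 0 \<and> mpol_to_closure a = c * poly (map_poly mpol_to_closure h) c"
    proof (induction q)
      case (pCons a q)
      show ?case
      proof (cases "a = 0")
        case True
        then have "poly (map_poly mpol_to_closure q) c = 0" "q \<noteq> 0"
          using pCons.prems c by (auto simp: \<tau>.map_poly_pCons_hom)
        then show ?thesis using pCons.IH by blast
      next
        case False
        interpret m: map_poly_comm_ring_hom "mpol_to_closure :: ('i, 'k) mpol \<Rightarrow> _" by unfold_locales
        have "mpol_to_closure a = c * poly (map_poly mpol_to_closure (- q)) c"
          using pCons.prems by (simp add: \<tau>.map_poly_pCons_hom m.hom_uminus eq_neg_iff_add_eq_0)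
        then show ?thesis using False by blast
      qed
    qed simp
  next
    fix n :: nat assume "n > 0"
    then have "of_nat n * Poly_Mapping.single 0 (inverse (of_nat n)) = (1 :: ('i, 'k) mpol)"
      by (simp flip: single_of_nat add: mult_single)
    then show "(of_nat n :: ('i, 'k) mpol) dvd 1" by (metis dvd_triv_left)
  qed
qed

section \<open>Points that preserve the absence of linear factors\<close>

lemma finite_bideg: "finite {l + m | l m. Polynomial.coeff (Polynomial.coeff f l) m \<noteq> 0}"
proof -
  have "{l + m | l m. Polynomial.coeff (Polynomial.coeff f l) m \<noteq> 0} \<subseteq>
     (\<lambda>(l, m). l + m) ` (SIGMA l:{..Polynomial.degree f}. {..Polynomial.degree (Polynomial.coeff f l)})"
  proof
    fix n assume "n \<in> {l + m | l m. Polynomial.coeff (Polynomial.coeff f l) m \<noteq> 0}"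
    then obtain l m where lm: "n = l + m" "Polynomial.coeff (Polynomial.coeff f l) m \<noteq> 0" by blast
    then have "Polynomial.coeff f l \<noteq> 0" by auto
    then have "l \<le> Polynomial.degree f" "m \<le> Polynomial.degree (Polynomial.coeff f l)"
      using lm by (auto intro: le_degree)
    then show "n \<in> (\<lambda>(l, m). l + m) ` (SIGMA l:{..Polynomial.degree f}. {..Polynomial.degree (Polynomial.coeff f l)})"
      using lm by force
  qed
  then show ?thesis by (rule finite_subset) auto
qed

lemma bideg_ge: "Polynomial.coeff (Polynomial.coeff f l) m \<noteq> 0 \<Longrightarrow> l + m \<le> bideg f"
  unfolding bideg_def using finite_bideg[of f] by (intro Max_ge) auto

lemma bideg_le: "(\<And>l m. Polynomial.coeff (Polynomial.coeff f l) m \<noteq> 0 \<Longrightarrow> l + m \<le> d) \<Longrightarrow> bideg f \<le> d"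
  unfolding bideg_def using finite_bideg[of f] by (intro Max.boundedI) auto

lemma bideg_attained:
  assumes "f \<noteq> 0"
  shows "\<exists>l m. Polynomial.coeff (Polynomial.coeff f l) m \<noteq> 0 \<and> bideg f = l + m"
proof (cases "bideg f = 0")
  case True
  obtain l m where "Polynomial.coeff (Polynomial.coeff f l) m \<noteq> 0"
    using assms by (metis leading_coeff_0_iff)
  then show ?thesis using bideg_ge[of f l m] True by (intro exI[of _ l] exI[of _ m]) simp
next
  case False
  have "bideg f \<in> insert 0 {l + m | l m. Polynomial.coeff (Polynomial.coeff f l) m \<noteq> 0}"
    unfolding bideg_def using finite_bideg[of f] by (intro Max_in) auto
  then show ?thesis using False by blast
qed

lemma has_linear_factor_iff:
  "has_linear_factor f \<longleftrightarrow> has_polynomial_root to_ac f"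
  by (auto simp: has_linear_factor_def has_polynomial_root_def poly_eq_0_iff_dvd dvd_def)

lemma has_polynomial_root_map:
  assumes "comm_ring_hom g" "comm_ring_hom h"
  shows "has_polynomial_root h (map_poly (map_poly g) F) \<longleftrightarrow> has_polynomial_root (\<lambda>a. h (g a)) F"
proof -
  interpret g: comm_ring_hom g by (rule assms)
  interpret h: comm_ring_hom h by (rule assms)
  have "map_poly (map_poly h) (map_poly (map_poly g) F) = map_poly (map_poly (\<lambda>a. h (g a))) F"
    by (simp add: map_poly_map_poly o_def poly_eq_iff coeff_map_poly)
  then show ?thesis by (simp add: has_polynomial_root_def)
qed

lemma as_bivariate_monic: "Polynomial.lead_coeff H = 1 \<Longrightarrow> Polynomial.lead_coeff (as_bivariate i H) = 1"
proof -
  interpret e: comm_ring_hom "expand_in i :: ('a, 'b) mpol \<Rightarrow> _" by (rule expand_in_hom)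
  assume "Polynomial.lead_coeff H = 1"
  then show ?thesis unfolding as_bivariate_def by (intro monic_map_poly) auto
qed

lemma coeff_as_bivariate:
  "Polynomial.coeff (Polynomial.coeff (as_bivariate i H) l) m = Polynomial.coeff (expand_in i (Polynomial.coeff H l)) m"
proof -
  interpret e: comm_ring_hom "expand_in i :: ('a, 'b) mpol \<Rightarrow> _" by (rule expand_in_hom)
  show ?thesis by (simp add: as_bivariate_def)
qed

lemma coeff_specialize:
  fixes H :: "('i, 'k::comm_ring_1) mpol poly"
  shows "Polynomial.coeff (Polynomial.coeff (specialize i x H) l) m =
     eval_mpol (\<lambda>c. c) x (Polynomial.coeff (Polynomial.coeff (as_bivariate i H) l) m)"
proof -
  interpret e: comm_ring_hom "eval_mpol (\<lambda>c::'k. c) x" by (rule eval_mpol_hom[OF id_hom])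
  show ?thesis by (simp add: specialize_def coeff_map_poly)
qed

lemma specialize_upd: "specialize i (x(i := t)) H = specialize i x H"
  by (intro poly_eqI) (auto simp: coeff_specialize coeff_as_bivariate
      intro!: eval_mpol_cong[OF vars_in_coeff_expand_in'] split: if_splits)

lemma specialize_monic:
  fixes H :: "('i, 'k::comm_ring_1) mpol poly"
  assumes "Polynomial.lead_coeff H = 1"
  shows "Polynomial.lead_coeff (specialize i x H) = 1"
proof -
  interpret e: comm_ring_hom "eval_mpol (\<lambda>c::'k. c) x" by (rule eval_mpol_hom[OF id_hom])
  interpret m: map_poly_comm_ring_hom "eval_mpol (\<lambda>c::'k. c) x" by unfold_locales
  show ?thesis
    unfolding specialize_def using as_bivariate_monic[OF assms] by (intro monic_map_poly) auto
qed

lemma bideg_specialize_le: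
  fixes H :: "('i, 'k::comm_ring_1) mpol poly"
  shows "bideg (specialize i x H) \<le> bideg (as_bivariate i H)"
proof -
  interpret e: comm_ring_hom "eval_mpol (\<lambda>c::'k. c) x" by (rule eval_mpol_hom[OF id_hom])
  show ?thesis by (rule bideg_le, rule bideg_ge) (auto simp: coeff_specialize)
qed

lemma has_linear_factor_specialize_iff:
  "has_linear_factor (specialize i x H) \<longleftrightarrow>
     has_polynomial_root (\<lambda>a. to_ac (eval_mpol (\<lambda>c. c) x a)) (as_bivariate i H)"
  unfolding has_linear_factor_iff specialize_def
  by (rule has_polynomial_root_map[OF eval_mpol_hom[OF id_hom] to_ac_hom])

text \<open>
  Points are required to be undefined at \<open>i\<close>, and the specialization does not depend on that value.
\<close>

lemma cond_III_at_iff':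
  "cond_III_at H i \<longleftrightarrow> (\<exists>x. \<not> has_linear_factor (specialize i x H) \<and>
     bideg (specialize i x H) = bideg (as_bivariate i H))"
proof
  assume "\<exists>x. \<not> has_linear_factor (specialize i x H) \<and>
     bideg (specialize i x H) = bideg (as_bivariate i H)"
  then obtain x where "\<not> has_linear_factor (specialize i (x(i := undefined)) H)"
     "bideg (specialize i (x(i := undefined)) H) = bideg (as_bivariate i H)"
    by (auto simp: specialize_upd)
  moreover have "x(i := undefined) \<in> (UNIV - {i}) \<rightarrow>\<^sub>E UNIV" by (auto simp: PiE_iff extensional_def)
  ultimately show "cond_III_at H i" unfolding cond_III_at_def by blast
qed (auto simp: cond_III_at_def)

text \<open>
  In the direction from right to left the point must satisfy two open conditions: no root appears,
  which holds where \<open>a\<close> is nonzero, and a coefficient of top degree \<open>l + m\<close> survives.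
\<close>

proposition cond_III_at_iff_no_polynomial_root:
  fixes H :: "('i::{finite,linorder}, 'k::field_char_0) mpol poly"
  assumes monic: "Polynomial.lead_coeff H = 1"
  shows "cond_III_at H i \<longleftrightarrow> \<not> has_polynomial_root mpol_to_closure (as_bivariate i H)"
proof -
  interpret algebraic_embedding "mpol_to_closure :: ('i, 'k) mpol \<Rightarrow> _"
    by (rule algebraic_embedding_mpol)
  define f where "f = as_bivariate i H"
  have f: "Polynomial.lead_coeff f = 1" unfolding f_def by (rule as_bivariate_monic[OF monic])
  have \<sigma>: "comm_ring_hom (\<lambda>a. to_ac (eval_mpol (\<lambda>c::'k. c) x a))" for x :: "'i \<Rightarrow> 'k"
    by (rule comp_hom[OF eval_mpol_hom[OF id_hom] to_ac_hom])
  show ?thesis unfolding cond_III_at_iff' has_linear_factor_specialize_iff f_def[symmetric]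
  proof
    assume "\<exists>x. \<not> has_polynomial_root (\<lambda>a. to_ac (eval_mpol (\<lambda>c. c) x a)) f \<and>
      bideg (specialize i x H) = bideg f"
    then show "\<not> has_polynomial_root mpol_to_closure f"
      using polynomial_root_specialize[OF f \<sigma>] by blast
  next
    assume "\<not> has_polynomial_root mpol_to_closure f"
    from no_polynomial_root_specialize[OF f this] obtain a where a: "a \<noteq> 0"
      "\<And>\<sigma> :: _ \<Rightarrow> 'k alg_closure. comm_ring_hom \<sigma> \<Longrightarrow> \<sigma> a \<noteq> 0 \<Longrightarrow> \<not> has_polynomial_root \<sigma> f" by blast
    have "f \<noteq> 0" using f by auto
    then obtain l m where lm: "Polynomial.coeff (Polynomial.coeff f l) m \<noteq> 0" "bideg f = l + m"
      using bideg_attained by blast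
    obtain x where x: "eval_mpol (\<lambda>c. c) x (a * Polynomial.coeff (Polynomial.coeff f l) m) \<noteq> 0"
      using nonvanishing_point[of UNIV "a * Polynomial.coeff (Polynomial.coeff f l) m"] a(1) lm(1)
      by (auto simp: vars_in_UNIV)
    interpret e: comm_ring_hom "eval_mpol (\<lambda>c::'k. c) x" by (rule eval_mpol_hom[OF id_hom])
    have nz: "eval_mpol (\<lambda>c. c) x a \<noteq> 0" "eval_mpol (\<lambda>c. c) x (Polynomial.coeff (Polynomial.coeff f l) m) \<noteq> 0"
      using x by (auto simp: e.hom_mult)
    have "bideg (specialize i x H) = bideg f"
      using bideg_specialize_le[of i x H] bideg_ge[of "specialize i x H" l m] nz(2) lm(2)
      by (simp add: coeff_specialize f_def)
    then show "\<exists>x. \<not> has_polynomial_root (\<lambda>a. to_ac (eval_mpol (\<lambda>c. c) x a)) f \<and>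
      bideg (specialize i x H) = bideg f"
      using a(2)[OF \<sigma>[of x]] nz(1) by (intro exI[of _ x]) simp
  qed
qed

section \<open>Nonvanishing of the forms\<close>

lemma hom_eval_form:
  assumes "comm_ring_hom h"
  shows "h (eval_form P f) = eval_form P (map_poly (map_poly h) f)"
proof -
  interpret h: comm_ring_hom h by (rule assms)
  show ?thesis
    by (simp add: eval_form_def eval_mpol_def h.hom_sum h.hom_mult h.hom_prod h.hom_power
        h.hom_of_int case_prod_unfold coeff_map_poly)
qed

text \<open>
  Evaluation of a form commutes with specialization, and specialization cannot raise the degree. So
  a form is nonzero on \<open>as_bivariate i H\<close> exactly if it is nonzero on the specialization at some point,
  and on specializations the forms are described by \<open>is_B_lin\<close>.
\<close>

proposition cond_III_at_iff_cond_IV_at: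
  fixes H :: "('i::{finite,linorder}, 'k::field_char_0) mpol poly"
  assumes monic: "Polynomial.lead_coeff H = 1" and B: "is_B_lin TYPE('k) B"
  shows "cond_III_at H i \<longleftrightarrow> cond_IV_at B H i"
proof -
  define D0 where "D0 = bideg (as_bivariate i H)"
  have spec: "eval_form P (specialize i x H) = eval_mpol (\<lambda>c. c) x (eval_form P (as_bivariate i H))" for P x
    unfolding specialize_def by (rule hom_eval_form[symmetric, OF eval_mpol_hom[OF id_hom]])
  have vanish: "(\<forall>P\<in>B D0. eval_form P (specialize i x H) = 0) \<longleftrightarrow>
      has_linear_factor (specialize i x H) \<or> bideg (specialize i x H) < D0" for x
    using B bideg_specialize_le[of i x H] specialize_monic[OF monic, of i x]
    by (auto simp: is_B_lin_def D0_def)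
  show ?thesis
  proof
    assume "cond_III_at H i"
    then obtain x where "\<not> has_linear_factor (specialize i x H)" "bideg (specialize i x H) = D0"
      by (auto simp: cond_III_at_iff' D0_def)
    then obtain P where P: "P \<in> B D0" "eval_form P (specialize i x H) \<noteq> 0"
      using vanish[of x] by auto
    interpret e: comm_ring_hom "eval_mpol (\<lambda>c::'k. c) x" by (rule eval_mpol_hom[OF id_hom])
    have "eval_form P (as_bivariate i H) \<noteq> 0" using P(2) spec[of P x] by auto
    then show "cond_IV_at B H i" using P(1) by (auto simp: cond_IV_at_def D0_def)
  next
    assume "cond_IV_at B H i"
    then obtain P where P: "P \<in> B D0" "eval_form P (as_bivariate i H) \<noteq> 0"
      by (auto simp: cond_IV_at_def D0_def)
    then obtain x where "eval_mpol (\<lambda>c. c) x (eval_form P (as_bivariate i H)) \<noteq> 0"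
      using nonvanishing_point[of UNIV "eval_form P (as_bivariate i H)"] by (auto simp: vars_in_UNIV)
    then have "\<not> (has_linear_factor (specialize i x H) \<or> bideg (specialize i x H) < D0)"
      using vanish[of x] P(1) spec[of P x] by auto
    then show "cond_III_at H i"
      using bideg_specialize_le[of i x H] by (auto simp: cond_III_at_iff' D0_def)
  qed
qed

section \<open>Simple extensions of fields\<close>

text \<open>
  The extension of an injective homomorphism into a field to the field of fractions. It is described by
  choice, because fractions over a general domain have no normal form.
\<close>

definition fract_extend :: "('a::idom \<Rightarrow> 'b::field) \<Rightarrow> 'a fract \<Rightarrow> 'b" where
  "fract_extend h x = (SOME v. \<exists>a b. b \<noteq> 0 \<and> x = Fract a b \<and> v = h a / h b)"

lemma fract_extend:
  assumes "inj_comm_ring_hom h" "b \<noteq> 0"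
  shows "fract_extend h (Fract a b) = h a / h b"
proof -
  interpret h: inj_comm_ring_hom h by (rule assms(1))
  have uniq: "v = h a / h b" if v: "\<exists>c d. d \<noteq> 0 \<and> Fract a b = Fract c d \<and> v = h c / h d" for v
  proof -
    obtain c d where cd: "d \<noteq> 0" "Fract a b = Fract c d" "v = h c / h d" using v by blast
    have "a * d = c * b" using cd(1,2) assms(2) by (simp add: eq_fract)
    then have "h a * h d = h c * h b" by (metis h.hom_mult)
    then show ?thesis using cd(1,3) assms(2) by (simp add: frac_eq_eq)
  qed
  show ?thesis unfolding fract_extend_def
    by (rule uniq, rule someI[of _ "h a / h b"]) (use assms(2) in blast)
qed

lemma fract_extend_to_fract:
  assumes "inj_comm_ring_hom h" shows "fract_extend h (to_fract a) = h a"
proof -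
  interpret h: inj_comm_ring_hom h by (rule assms(1))
  show ?thesis using fract_extend[OF assms, of 1 a] by (simp add: to_fract_def)
qed

lemma fract_extend_hom:
  assumes "inj_comm_ring_hom h"
  shows "comm_ring_hom (fract_extend h)"
proof -
  interpret h: inj_comm_ring_hom h by (rule assms(1))
  have z: "h b \<noteq> 0" if "b \<noteq> 0" for b using that by simp
  show ?thesis
  proof
    show "fract_extend h 0 = 0" "fract_extend h 1 = 1"
      using fract_extend_to_fract[OF assms, of 0] fract_extend_to_fract[OF assms, of 1] by simp_all
  next
    fix x y :: "'a fract"
    obtain a b c d where x: "x = Fract a b" "b \<noteq> 0" and y: "y = Fract c d" "d \<noteq> 0"
      by (metis Fract_cases)
    show "fract_extend h (x + y) = fract_extend h x + fract_extend h y"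
      using x(2) y(2) z unfolding x(1) y(1)
      by (simp add: fract_extend[OF assms] h.hom_add h.hom_mult add_frac_eq)
    show "fract_extend h (x * y) = fract_extend h x * fract_extend h y"
      using x(2) y(2) z unfolding x(1) y(1)
      by (simp add: fract_extend[OF assms] h.hom_mult)
  qed
qed

text \<open>A nonzero element of least degree divides all others, because remainders stay in the ideal.\<close>
lemma field_poly_ideal_principal:
  fixes I :: "'a::field poly set"
  assumes "p0 \<in> I" "p0 \<noteq> 0"
    and diff: "\<And>p q. p \<in> I \<Longrightarrow> q \<in> I \<Longrightarrow> p - q \<in> I"
    and mult: "\<And>p q. p \<in> I \<Longrightarrow> q * p \<in> I"
  obtains g where "g \<in> I" "g \<noteq> 0" "\<And>p. p \<in> I \<Longrightarrow> g dvd p"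
proof -
  obtain g where g: "g \<in> I \<and> g \<noteq> 0"
    and min: "\<And>p. p \<in> I \<and> p \<noteq> 0 \<Longrightarrow> Polynomial.degree g \<le> Polynomial.degree p"
    using ex_has_least_nat[of "\<lambda>p. p \<in> I \<and> p \<noteq> 0" p0 Polynomial.degree] assms(1,2) by blast
  have "g dvd p" if "p \<in> I" for p
  proof -
    have "p mod g = p - (p div g) * g" by (simp add: minus_div_mult_eq_mod)
    then have "p mod g \<in> I" using that g diff mult by metis
    then have "p mod g = 0" using min[of "p mod g"] degree_mod_less[of g p] g by (metis leD)
    then show ?thesis by (simp add: dvd_eq_mod_eq_0)
  qed
  then show thesis using that g by blast
qed

text \<open>The chain rule for \<open>d/dZ F(Q(Z), Z)\<close>, where \<open>Z\<close> is the inner variable of \<open>F\<close>.\<close>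

lemma pderiv_substitute:
  "pderiv (poly F Q) = poly (map_poly pderiv F) Q + poly (pderiv F) Q * pderiv (Q :: 'a::idom poly)"
proof (induction F)
  case (pCons p F)
  have "map_poly pderiv (pCons p F) = pCons (pderiv p) (map_poly pderiv F)"
    using pCons.hyps by (auto simp: map_poly_pCons)
  then show ?case
    using pCons.IH by (simp add: pderiv_add pderiv_mult pderiv_pCons algebra_simps)
qed simp

locale field_embedding =
  fixes \<eta> :: "'f::field \<Rightarrow> 'n::field"
  assumes \<eta>: "comm_ring_hom \<eta>"
begin

sublocale comm_ring_hom \<eta> by (rule \<eta>)
sublocale inj_comm_ring_hom \<eta>
proof
  fix x assume "\<eta> x = 0"
  then show "x = 0" using hom_mult[of x "inverse x"] by (cases "x = 0") auto
qed
sublocale mp: map_poly_inj_comm_ring_hom \<eta> ..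

lemma hom_inverse: "\<eta> (inverse x) = inverse (\<eta> x)"
proof (cases "x = 0")
  case False
  have "\<eta> x * \<eta> (inverse x) = 1" using False by (simp flip: hom_mult)
  then show ?thesis by (metis inverse_unique)
qed simp

definition ev :: "'n \<Rightarrow> 'f poly \<Rightarrow> 'n" where "ev y p = poly (map_poly \<eta> p) y"

lemma ev_simps [simp]: "ev y 0 = 0" "ev y 1 = 1" "ev y (p + q) = ev y p + ev y q"
  "ev y (p - q) = ev y p - ev y q" "ev y (p * q) = ev y p * ev y q" "ev y (- p) = - ev y p"
  "ev y (Polynomial.smult c p) = \<eta> c * ev y p" "ev y (pCons c p) = \<eta> c + y * ev y p"
  by (simp_all add: ev_def mp.hom_add mp.hom_minus mp.hom_mult mp.hom_uminus map_poly_hom_smult map_poly_pCons_hom)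

lemma ev_sum: "ev y (sum f S) = (\<Sum>i\<in>S. ev y (f i))"
  by (induction S rule: infinite_finite_induct) auto

text \<open>The subring generated by \<open>y\<close> over the image of \<open>\<eta>\<close>.\<close>
definition adj :: "'n \<Rightarrow> 'n set" where "adj y = range (ev y)"

lemma adj_base: "\<eta> c \<in> adj y"
  unfolding adj_def by (rule range_eqI[of _ _ "[:c:]"]) simp
lemma adj_self: "y \<in> adj y"
  unfolding adj_def by (rule range_eqI[of _ _ "[:0, 1:]"]) simp
lemma adj_0: "0 \<in> adj y" using adj_base[of 0] by simp
lemma adj_1: "1 \<in> adj y" using adj_base[of 1] by simp
lemma adj_add: "a \<in> adj y \<Longrightarrow> b \<in> adj y \<Longrightarrow> a + b \<in> adj y"
  unfolding adj_def by (auto simp flip: ev_simps(3))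
lemma adj_diff: "a \<in> adj y \<Longrightarrow> b \<in> adj y \<Longrightarrow> a - b \<in> adj y"
  unfolding adj_def by (auto simp flip: ev_simps(4))
lemma adj_mult: "a \<in> adj y \<Longrightarrow> b \<in> adj y \<Longrightarrow> a * b \<in> adj y"
  unfolding adj_def by (auto simp flip: ev_simps(5))
lemma adj_uminus: "a \<in> adj y \<Longrightarrow> - a \<in> adj y"
  using adj_diff[OF adj_0, of a] by simp
lemma adj_power: "a \<in> adj y \<Longrightarrow> a ^ n \<in> adj y"
  by (induction n) (auto intro: adj_1 adj_mult)
lemma adj_least:
  assumes "\<And>c. \<eta> c \<in> W" "y \<in> W" "\<And>a b. a \<in> W \<Longrightarrow> b \<in> W \<Longrightarrow> a + b \<in> W"
    "\<And>a b. a \<in> W \<Longrightarrow> b \<in> W \<Longrightarrow> a * b \<in> W"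
  shows "adj y \<subseteq> W"
proof -
  have "ev y p \<in> W" for p
    by (induction p) (use assms(1)[of 0] assms in auto)
  then show ?thesis by (auto simp: adj_def)
qed

end

locale irreducible_root = field_embedding \<eta> for \<eta> :: "'f::field \<Rightarrow> 'n::field" +
  fixes h :: "'f poly" and y :: 'n
  assumes irred: "Factorial_Ring.irreducible h" and root: "ev y h = 0"
begin

lemma ev_eq_0_iff: "ev y p = 0 \<longleftrightarrow> h dvd p"
proof
  assume p: "ev y p = 0"
  have "h \<noteq> 0" using irred by auto
  obtain g where "g \<in> {p. ev y p = 0}" "g \<noteq> 0" "\<And>p. p \<in> {p. ev y p = 0} \<Longrightarrow> g dvd p"
    by (rule field_poly_ideal_principal[of h "{p. ev y p = 0}"]) (use root \<open>h \<noteq> 0\<close> in auto)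
  then have g: "ev y g = 0" "g \<noteq> 0" "\<And>p. ev y p = 0 \<Longrightarrow> g dvd p" by auto
  have "\<not> g dvd 1"
  proof
    assume "g dvd 1"
    then obtain w where "1 = g * w" by (rule dvdE)
    then have "ev y 1 = ev y (g * w)" by (rule arg_cong)
    then show False using g(1) by simp
  qed
  then have "h dvd g" using g(3)[OF root] irred by (auto simp: Factorial_Ring.irreducible_altdef)
  then show "h dvd p" using g(3)[OF p] by (rule dvd_trans)
next
  assume "h dvd p"
  then show "ev y p = 0" using root by (auto elim!: dvdE)
qed

text \<open>
  If \<open>ev y p\<close> is nonzero, then \<open>h\<close> does not divide \<open>p\<close>, so the two generate the unit ideal, and a Bezout
  relation evaluated at \<open>y\<close> gives the inverse.
\<close>

lemma adj_inverse:
  assumes "a \<in> adj y" shows "inverse a \<in> adj y"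
proof (cases "a = 0")
  case True then show ?thesis by (simp add: adj_0)
next
  case False
  obtain p where p: "a = ev y p" using assms by (auto simp: adj_def)
  define I where "I = {u * p + v * h | u v. True}"
  have "h \<noteq> 0" using irred by auto
  have "h \<in> I" unfolding I_def by (rule CollectI, rule exI[of _ 0], rule exI[of _ 1]) simp
  have pI: "p \<in> I" unfolding I_def by (rule CollectI, rule exI[of _ 1], rule exI[of _ 0]) simp
  have diff: "q - r \<in> I" if qr: "q \<in> I" "r \<in> I" for q r
  proof -
    obtain u v u' v' where "q = u * p + v * h" "r = u' * p + v' * h" using qr by (auto simp: I_def)
    then have "q - r = (u - u') * p + (v - v') * h" by (simp add: algebra_simps)
    then show ?thesis by (auto simp: I_def)
  qed
  have mult: "r * q \<in> I" if q: "q \<in> I" for q r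
  proof -
    obtain u v where "q = u * p + v * h" using q by (auto simp: I_def)
    then have "r * q = (r * u) * p + (r * v) * h" by (simp add: algebra_simps)
    then show ?thesis by (auto simp: I_def)
  qed
  obtain g where g: "g \<in> I" "g \<noteq> 0" "\<And>p. p \<in> I \<Longrightarrow> g dvd p"
    using field_poly_ideal_principal[OF \<open>h \<in> I\<close> \<open>h \<noteq> 0\<close> diff mult] by blast
  have "\<not> h dvd g"
  proof
    assume "h dvd g"
    then have "h dvd p" using g(3)[OF pI] by (rule dvd_trans)
    then show False using ev_eq_0_iff[of p] p False by simp
  qed
  then have "g dvd 1" using g(3)[OF \<open>h \<in> I\<close>] irred by (auto simp: Factorial_Ring.irreducible_altdef)
  then obtain w where "1 = g * w" by (rule dvdE)
  moreover obtain u v where "g = u * p + v * h" using g(1) by (auto simp: I_def)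
  ultimately have "1 = (u * p + v * h) * w" by simp
  then have "ev y 1 = ev y ((u * p + v * h) * w)" by simp
  then have "1 = a * ev y (u * w)" by (simp add: p root algebra_simps)
  then have "inverse a = ev y (u * w)" using False by (metis inverse_unique)
  then show ?thesis by (simp only: adj_def rangeI)
qed

lemma adj_divide: "a \<in> adj y \<Longrightarrow> b \<in> adj y \<Longrightarrow> a / b \<in> adj y"
  by (simp add: divide_inverse adj_mult adj_inverse)

sublocale vs: vector_space "\<lambda>c x. \<eta> c * x"
  by unfold_locales (auto simp: hom_add hom_mult algebra_simps)

text \<open>
  A comparison of dimensions: the powers of \<open>y\<close> below the degree of \<open>h\<close> are independent, and if \<open>c\<close>
  had a relation of smaller degree then too few powers of \<open>c\<close> would span.
\<close>
lemma degree_generator_ge: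
  assumes "adj c = adj y" "ev c p = 0" "p \<noteq> 0"
  shows "Polynomial.degree h \<le> Polynomial.degree p"
proof -
  define d e where "d = Polynomial.degree h" and "e = Polynomial.degree p"
  define T where "T = (\<lambda>j. c ^ j) ` {..<e}"
  have "a \<in> vs.span T" if a: "a \<in> adj c" for a
  proof -
    obtain q where q: "a = ev c q" using a by (auto simp: adj_def)
    have "q = (q div p) * p + q mod p" by simp
    then have "ev c q = ev c ((q div p) * p) + ev c (q mod p)" by (metis ev_simps(3))
    then have a: "a = ev c (q mod p)" using assms(2) q by simp
    show ?thesis
    proof (cases "q mod p = 0")
      case True then show ?thesis using a by (simp add: vs.span_zero)
    next
      case False
      then have deg: "Polynomial.degree (q mod p) < e"
        using degree_mod_less[OF assms(3), of q] by (simp add: e_def)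
      have "a = (\<Sum>j\<le>Polynomial.degree (q mod p). \<eta> (Polynomial.coeff (q mod p) j) * c ^ j)"
        unfolding a ev_def poly_altdef by simp
      also have "\<dots> \<in> vs.span T"
        using deg by (intro vs.span_sum vs.span_scale vs.span_base) (auto simp: T_def)
      finally show ?thesis .
    qed
  qed
  then have span: "adj y \<subseteq> vs.span T" using assms(1) by blast
  define S where "S = (\<lambda>j. y ^ j) ` {..<d}"
  have zero: "f j = 0" if f: "(\<Sum>j<d. \<eta> (f j) * y ^ j) = 0" and "j < d" for f j
  proof -
    define r where "r = (\<Sum>j<d. Polynomial.monom (f j) j)"
    have "ev y r = 0" using f by (simp add: r_def ev_sum) (simp add: ev_def poly_monom)
    then have "h dvd r" by (simp add: ev_eq_0_iff)
    moreover have "r \<noteq> 0 \<Longrightarrow> Polynomial.degree r < d"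
    proof -
      assume "r \<noteq> 0"
      then have "d > 0" by (cases d) (auto simp: r_def)
      then show ?thesis unfolding r_def
        by (intro degree_sum_less) (auto intro: le_less_trans[OF degree_monom_le])
    qed
    ultimately have "r = 0" using dvd_imp_degree_le[of h r] by (fastforce simp: d_def)
    then have "Polynomial.coeff r j = 0" by simp
    then show ?thesis using \<open>j < d\<close> by (simp add: r_def coeff_sum)
  qed
  have inj: "inj_on (\<lambda>j. y ^ j) {..<d}"
  proof (rule inj_onI, rule ccontr)
    fix i j assume ij: "i \<in> {..<d}" "j \<in> {..<d}" "y ^ i = y ^ j" "i \<noteq> j"
    define f where "f l = (if l = i then 1 else if l = j then - 1 else 0 :: 'f)" for l
    have "(\<Sum>l<d. \<eta> (f l) * y ^ l) = (\<Sum>l\<in>{i, j}. \<eta> (f l) * y ^ l)"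
      using ij by (intro sum.mono_neutral_right) (auto simp: f_def)
    also have "\<dots> = 0" using ij by (simp add: f_def hom_uminus)
    finally show False using zero[of f i] ij by (simp add: f_def)
  qed
  have "vs.independent S"
  proof (rule vs.independent_if_scalars_zero)
    show "finite S" by (simp add: S_def)
    fix f x assume f: "(\<Sum>x\<in>S. \<eta> (f x) * x) = 0" and x: "x \<in> S"
    have "(\<Sum>j<d. \<eta> (f (y ^ j)) * y ^ j) = 0"
      using f unfolding S_def by (simp add: sum.reindex[OF inj] o_def)
    then show "f x = 0" using zero[of "\<lambda>j. f (y ^ j)"] x by (auto simp: S_def)
  qed
  moreover have "S \<subseteq> vs.span T"
    using span adj_power[OF adj_self] by (auto simp: S_def)
  ultimately have "card S \<le> card T"
    using vs.independent_span_bound[of T S] by (auto simp: T_def)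
  moreover have "card S = d" unfolding S_def using card_image[OF inj] by simp
  moreover have "card T \<le> e" unfolding T_def by (metis card_image_le card_lessThan finite_lessThan)
  ultimately show ?thesis by (simp add: d_def e_def)
qed

text \<open>
  A polynomial \<open>g\<close> that kills another generator \<open>c\<close> of the same extension and has the degree of \<open>h\<close>
  is a minimal polynomial of \<open>c\<close>, since the comparison of dimensions excludes smaller degrees.
\<close>

lemma generator_kernel:
  assumes "adj c = adj y" "ev c g = 0" "g \<noteq> 0" "Polynomial.degree g = Polynomial.degree h"
  shows "ev c p = 0 \<longleftrightarrow> g dvd p"
proof
  assume p: "ev c p = 0"
  have "p mod g = p - (p div g) * g" by (simp add: minus_div_mult_eq_mod)
  then have "ev c (p mod g) = ev c (p - (p div g) * g)" by simp
  then have "ev c (p mod g) = 0" using p assms(2) by simp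
  then have "p mod g = 0"
    using degree_generator_ge[OF assms(1), of "p mod g"] degree_mod_less[OF assms(3), of p] assms(4)
    by fastforce
  then show "g dvd p" by (simp add: dvd_eq_mod_eq_0)
qed (use assms(2) in \<open>auto elim!: dvdE\<close>)

end

section \<open>Polynomial roots and their coefficients\<close>

text \<open>
  Only the expanded variable becomes the indeterminate of the target; the other variables become
  elements of the closure. The closure also contains an element for the variable with index \<open>i\<close>, which is
  kept apart from the indeterminate; so the indeterminate is transcendental over a field that
  contains all elements algebraic over the rational functions in the other variables.
\<close>

definition expand_closure ::
  "'i \<Rightarrow> ('i::linorder, 'k::field) mpol \<Rightarrow> ('i, 'k) ratfun alg_closure poly" where
  "expand_closure i p = map_poly mpol_to_closure (expand_in i p)"

definition poly_to_field :: "'e::field poly \<Rightarrow> 'e poly fract alg_closure" where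
  "poly_to_field P = to_ac (to_fract P)"

definition ratfun_to_field ::
  "'i \<Rightarrow> ('i::linorder, 'k::field) ratfun \<Rightarrow> ('i, 'k) ratfun alg_closure poly fract alg_closure" where
  "ratfun_to_field i = fract_extend (\<lambda>p. poly_to_field (expand_closure i p))"

lemma poly_to_field_hom: "inj_comm_ring_hom poly_to_field"
  by unfold_locales (auto simp: poly_to_field_def)

lemma comm_ring_hom_inj:
  assumes "comm_ring_hom h" "\<And>x. h x = 0 \<Longrightarrow> x = 0"
  shows "inj_comm_ring_hom h"
proof -
  interpret comm_ring_hom h by (rule assms)
  show ?thesis by unfold_locales (rule assms(2))
qed

lemma expand_closure_hom: "inj_comm_ring_hom (expand_closure i :: ('i::linorder, 'k::field) mpol \<Rightarrow> _)"
proof (rule comm_ring_hom_inj)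
  interpret e: comm_ring_hom "expand_in i :: ('i, 'k) mpol \<Rightarrow> _" by (rule expand_in_hom)
  interpret \<tau>: comm_ring_hom "mpol_to_closure :: ('i, 'k) mpol \<Rightarrow> _" by (rule mpol_to_closure_hom)
  interpret \<tau>: inj_comm_ring_hom "mpol_to_closure :: ('i, 'k) mpol \<Rightarrow> _"
    by unfold_locales (metis \<tau>.hom_zero mpol_to_closure_eq_iff)
  interpret m: map_poly_inj_comm_ring_hom "mpol_to_closure :: ('i, 'k) mpol \<Rightarrow> _" ..
  show "comm_ring_hom (expand_closure i :: ('i, 'k) mpol \<Rightarrow> _)"
    unfolding expand_closure_def by (rule comp_hom) unfold_locales
  show "p = 0" if "expand_closure i p = 0" for p :: "('i, 'k) mpol"
    using that expand_in_inj[of i p 0] by (simp add: expand_closure_def)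
qed

text \<open>
  The maps used below: \<open>\<tau>\<close> embeds \<open>k[X]\<close> into the closure \<open>E\<close> of \<open>k(X)\<close>, \<open>\<Theta>\<close> embeds it into \<open>E[Z]\<close> with
  \<open>X\<^bsub>i\<^esub>\<close> going to \<open>Z\<close>, \<open>\<iota>\<close> embeds \<open>E[Z]\<close> into an algebraic closure of \<open>E(Z)\<close>, and \<open>\<eta>\<close> extends \<open>\<iota> \<circ> \<Theta>\<close> to \<open>k(X)\<close>.
  All fields that occur are compared inside the target of \<open>\<iota>\<close> and \<open>\<eta>\<close>.
\<close>

locale monic_irreducible =
  fixes i :: "'i::{finite,linorder}" and H :: "('i, 'k::field_char_0) mpol poly"
  assumes irreducible: "irreducible_ratfun H" and monic: "Polynomial.lead_coeff H = 1"
begin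

abbreviation \<tau> :: "('i, 'k) mpol \<Rightarrow> _" where "\<tau> \<equiv> mpol_to_closure"
abbreviation \<Theta> :: "('i, 'k) mpol \<Rightarrow> _" where "\<Theta> \<equiv> expand_closure i"
abbreviation \<iota> :: "('i, 'k) ratfun alg_closure poly \<Rightarrow> _" where "\<iota> \<equiv> poly_to_field"
abbreviation \<eta> :: "('i, 'k) ratfun \<Rightarrow> _" where "\<eta> \<equiv> ratfun_to_field i"

sublocale \<tau>: comm_ring_hom \<tau> by (rule mpol_to_closure_hom)
sublocale \<Theta>: inj_comm_ring_hom \<Theta> by (rule expand_closure_hom)
sublocale \<iota>: inj_comm_ring_hom \<iota> by (rule poly_to_field_hom)
sublocale m\<Theta>: map_poly_inj_comm_ring_hom \<Theta> ..
sublocale m\<tau>: map_poly_comm_ring_hom \<tau> ..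
sublocale m\<iota>: map_poly_inj_comm_ring_hom \<iota> ..

lemma \<iota>\<Theta>_hom: "inj_comm_ring_hom (\<lambda>p. \<iota> (\<Theta> p))"
  by (rule comm_ring_hom_inj[OF comp_hom]) (unfold_locales, simp)

sublocale field_embedding \<eta>
  unfolding ratfun_to_field_def by (rule field_embedding.intro[OF fract_extend_hom[OF \<iota>\<Theta>_hom]])

lemma \<eta>_to_fract: "\<eta> (to_fract p) = \<iota> (\<Theta> p)"
  unfolding ratfun_to_field_def by (rule fract_extend_to_fract[OF \<iota>\<Theta>_hom])

lemma ev_fract: "ev (\<iota> P) (map_poly to_fract G) = \<iota> (poly (map_poly \<Theta> G) P)"
proof -
  have "map_poly \<eta> (map_poly to_fract G) = map_poly \<iota> (map_poly \<Theta> G)"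
    by (rule poly_eqI) (simp add: \<eta>_to_fract)
  then show ?thesis by (simp add: ev_def)
qed

lemma has_polynomial_root_iff:
  "has_polynomial_root \<tau> (as_bivariate i G) \<longleftrightarrow> (\<exists>Q. poly (map_poly \<Theta> G) Q = 0)"
proof -
  interpret e: comm_ring_hom "expand_in i :: ('i, 'k) mpol \<Rightarrow> _" by (rule expand_in_hom)
  have "map_poly (map_poly \<tau>) (as_bivariate i G) = map_poly \<Theta> G"
    unfolding as_bivariate_def by (rule poly_eqI) (simp add: coeff_map_poly expand_closure_def)
  then show ?thesis by (simp add: has_polynomial_root_def)
qed

lemma \<Theta>_mvar: "\<Theta> (mvar i) = [:0, 1:]"
  by (simp add: expand_closure_def expand_in_mvar \<tau>.map_poly_pCons_hom)

lemma \<Theta>_const: "vars_in (- {i}) p \<Longrightarrow> \<Theta> p = [:\<tau> p:]"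
  by (simp add: expand_closure_def expand_in_const \<tau>.map_poly_pCons_hom)

text \<open>
  The derivation \<open>d/dZ\<close> of \<open>E[Z]\<close> preserves the image of \<open>k[X]\<close>, on which it is the partial derivative with
  respect to \<open>X\<^bsub>i\<^esub>\<close>.
\<close>

lemma pderiv_mem_range: "\<exists>q. \<Theta> q = pderiv (\<Theta> p)"
proof -
  have "\<exists>q. \<Theta> q = pderiv (\<Theta> (poly F (mvar i)))"
    if "\<And>n. vars_in (- {i}) (Polynomial.coeff F n)" for F
    using that
  proof (induction F)
    case 0
    show ?case by (intro exI[of _ 0]) simp
  next
    case (pCons c F)
    have c: "vars_in (- {i}) c" and F: "\<And>n. vars_in (- {i}) (Polynomial.coeff F n)"
      using pCons.prems[of 0] pCons.prems[of "Suc _"] by auto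
    obtain q where q: "\<Theta> q = pderiv (\<Theta> (poly F (mvar i)))" using pCons.IH[OF F] by blast
    have "\<Theta> (poly F (mvar i) + mvar i * q) = pderiv (\<Theta> (poly (pCons c F) (mvar i)))"
      unfolding poly_pCons \<Theta>.hom_add \<Theta>.hom_mult \<Theta>_mvar \<Theta>_const[OF c] q pderiv_add pderiv_mult
      by (simp add: pderiv_pCons)
    then show ?case by blast
  qed
  from this[of "expand_in i p"] show ?thesis by (simp add: vars_in_coeff_expand_in' poly_expand_in)
qed

definition deriv :: "('i, 'k) mpol \<Rightarrow> ('i, 'k) mpol" where "deriv p = (SOME q. \<Theta> q = pderiv (\<Theta> p))"

lemma \<Theta>_deriv: "\<Theta> (deriv p) = pderiv (\<Theta> p)"
  unfolding deriv_def using pderiv_mem_range by (rule someI_ex)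

lemma deriv_0: "deriv 0 = 0" using \<Theta>_deriv[of 0] by simp

lemma map_pderiv_\<Theta>: "map_poly pderiv (map_poly \<Theta> G) = map_poly \<Theta> (map_poly deriv G)"
  by (rule poly_eqI) (simp add: coeff_map_poly deriv_0 \<Theta>_deriv)

lemma pderiv_solution:
  "pderiv (poly (map_poly \<Theta> G) Q) =
     poly (map_poly \<Theta> (map_poly deriv G)) Q + poly (map_poly \<Theta> (pderiv G)) Q * pderiv Q"
proof -
  have "pderiv (map_poly \<Theta> G) = map_poly \<Theta> (pderiv G)"
    by (rule poly_eqI) (simp add: coeff_pderiv \<Theta>.hom_mult \<Theta>.hom_add \<Theta>.hom_of_nat)
  then show ?thesis by (simp add: pderiv_substitute map_pderiv_\<Theta>)
qed

abbreviation h where "h \<equiv> map_poly to_fract H"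

lemma degree_pos: "Polynomial.degree H > 0"
proof (rule ccontr)
  assume "\<not> Polynomial.degree H > 0"
  then obtain c where "H = [:c:]" using degree_eq_zeroE by auto
  then have "H = 1" using monic by simp
  then show False using irreducible by (simp add: irreducible_ratfun_def)
qed

end

text \<open>A solution \<open>Q\<close> gives the root \<open>y = \<iota> Q\<close> of \<open>H\<close>, so \<open>adj y\<close> is a copy of the extension defined by \<open>H\<close>.\<close>

locale bivariate_solution = monic_irreducible i H
  for i :: "'i::{finite,linorder}" and H :: "('i, 'k::field_char_0) mpol poly" +
  fixes Q :: "('i, 'k) ratfun alg_closure poly"
  assumes solution: "poly (map_poly (expand_closure i) H) Q = 0"
begin

abbreviation y where "y \<equiv> \<iota> Q"

sublocale irreducible_root \<eta> h y
  using irreducible by unfold_locales (simp_all add: irreducible_ratfun_def ev_fract solution)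

text \<open>
  Membership of a polynomial in \<open>adj y\<close> becomes an identity between polynomials over \<open>E\<close>, which may be
  differentiated and specialized.
\<close>

lemma \<iota>_mem_adjE:
  assumes "\<iota> P \<in> adj y"
  obtains b G where "b \<noteq> 0" "\<Theta> b * P = poly (map_poly \<Theta> G) Q"
proof -
  obtain p where p: "\<iota> P = ev y p" using assms by (auto simp: adj_def)
  obtain b G where bG: "b \<noteq> 0" "map_poly to_fract G = Polynomial.smult (to_fract b) p"
    using clear_denominators[of p] by blast
  have "\<iota> (poly (map_poly \<Theta> G) Q) = \<iota> (\<Theta> b * P)"
    by (simp add: ev_fract[symmetric] bG(2) \<eta>_to_fract \<iota>.hom_mult p)
  then have "\<Theta> b * P = poly (map_poly \<Theta> G) Q" by simp
  then show thesis using that bG(1) by blast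
qed

lemma \<iota>_poly_mem: "\<iota> (poly (map_poly \<Theta> G) Q) \<in> adj y"
  unfolding ev_fract[symmetric] adj_def by simp

lemma \<iota>_\<Theta>_mem: "\<iota> (\<Theta> b) \<in> adj y"
  unfolding \<eta>_to_fract[symmetric] by (rule adj_base)

text \<open>
  Implicit differentiation of \<open>H(Q(Z), Z) = 0\<close>. The factor of \<open>pderiv Q\<close> is nonzero, as \<open>H\<close> is irreducible
  and its derivative in \<open>Y\<close> is a nonzero polynomial of smaller degree in characteristic zero.
\<close>

lemma \<iota>_pderiv_Q_mem: "\<iota> (pderiv Q) \<in> adj y"
proof -
  define A where "A = poly (map_poly \<Theta> (pderiv H)) Q"
  define B where "B = poly (map_poly \<Theta> (map_poly deriv H)) Q"
  have "B + A * pderiv Q = 0" using pderiv_solution[of H Q] by (simp add: solution A_def B_def)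
  then have "\<iota> B + \<iota> A * \<iota> (pderiv Q) = 0" by (metis \<iota>.hom_add \<iota>.hom_mult \<iota>.hom_zero)
  moreover have "\<iota> A \<noteq> 0"
  proof
    assume "\<iota> A = 0"
    then have "h dvd map_poly to_fract (pderiv H)"
      unfolding ev_eq_0_iff[symmetric] ev_fract A_def .
    moreover have "pderiv H \<noteq> 0" using degree_pos by (simp add: pderiv_eq_0_iff)
    ultimately have "Polynomial.degree h \<le> Polynomial.degree (map_poly to_fract (pderiv H))"
      by (intro dvd_imp_degree_le) auto
    then show False using degree_pos by (simp add: degree_pderiv)
  qed
  ultimately have "\<iota> (pderiv Q) = - \<iota> B / \<iota> A" by (simp add: field_simps eq_neg_iff_add_eq_0)
  then show ?thesis
    unfolding A_def B_def by (metis adj_divide adj_uminus \<iota>_poly_mem)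
qed

lemma \<iota>_pderiv_mem:
  assumes "\<iota> P \<in> adj y" shows "\<iota> (pderiv P) \<in> adj y"
proof -
  obtain b G where bG: "b \<noteq> 0" "\<Theta> b * P = poly (map_poly \<Theta> G) Q" using assms by (rule \<iota>_mem_adjE)
  have "\<Theta> b * pderiv P + P * \<Theta> (deriv b) = pderiv (\<Theta> b * P)" by (simp add: pderiv_mult \<Theta>_deriv)
  also have "\<dots> = poly (map_poly \<Theta> (map_poly deriv G)) Q + poly (map_poly \<Theta> (pderiv G)) Q * pderiv Q"
    unfolding bG(2) by (rule pderiv_solution)
  finally have "\<Theta> b * pderiv P = poly (map_poly \<Theta> (map_poly deriv G)) Q +
      poly (map_poly \<Theta> (pderiv G)) Q * pderiv Q - P * \<Theta> (deriv b)" by (simp add: algebra_simps)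
  then have "\<iota> (\<Theta> b) * \<iota> (pderiv P) = \<iota> (poly (map_poly \<Theta> (map_poly deriv G)) Q) +
      \<iota> (poly (map_poly \<Theta> (pderiv G)) Q) * \<iota> (pderiv Q) - \<iota> P * \<iota> (\<Theta> (deriv b))"
    by (metis \<iota>.hom_add \<iota>.hom_mult \<iota>.hom_minus)
  also have "\<dots> \<in> adj y"
    by (intro adj_diff adj_add adj_mult \<iota>_poly_mem \<iota>_\<Theta>_mem \<iota>_pderiv_Q_mem assms)
  finally have "\<iota> (\<Theta> b) * \<iota> (pderiv P) / \<iota> (\<Theta> b) \<in> adj y"
    by (intro adj_divide \<iota>_\<Theta>_mem)
  then show ?thesis using bG(1) by simp
qed

lemma \<iota>_pCons: "\<iota> (pCons c P) = \<iota> [:c:] + \<iota> [:0, 1:] * \<iota> P"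
proof -
  have "pCons c P = [:c:] + [:0, 1:] * P" by simp
  then show ?thesis by (metis \<iota>.hom_add \<iota>.hom_mult)
qed

lemma var_mem: "\<iota> [:0, 1:] \<in> adj y"
  using \<iota>_\<Theta>_mem[of "mvar i"] by (simp add: \<Theta>_mvar)

lemma \<iota>_of_nat: "\<iota> [:of_nat n:] = of_nat n"
  using \<iota>.hom_of_nat[of n] by (simp add: of_nat_poly)

text \<open>
  Induction on the degree: differentiation lowers it and keeps all coefficients but the constant one up
  to nonzero integer factors, and the constant one is what remains of \<open>P\<close>.
\<close>

lemma coeffs_mem:
  assumes "\<iota> P \<in> adj y" shows "\<iota> [:Polynomial.coeff P j:] \<in> adj y"
  using assms
proof (induction "Polynomial.degree P" arbitrary: P j)
  case 0
  then obtain c where "P = [:c:]" by (metis degree_eq_zeroE)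
  then show ?case using 0 by (cases j) (auto simp: adj_0)
next
  case (Suc d)
  have high: "\<iota> [:Polynomial.coeff P (Suc l):] \<in> adj y" for l
  proof -
    have "\<iota> [:Polynomial.coeff (pderiv P) l:] \<in> adj y"
      using Suc.hyps Suc.prems by (intro Suc.hyps(1) \<iota>_pderiv_mem) (auto simp: degree_pderiv)
    moreover have "[:Polynomial.coeff (pderiv P) l:] = [:of_nat (Suc l):] * [:Polynomial.coeff P (Suc l):]"
      by (simp add: coeff_pderiv del: of_nat_Suc)
    ultimately have "of_nat (Suc l) * \<iota> [:Polynomial.coeff P (Suc l):] \<in> adj y"
      by (simp only: \<iota>.hom_mult \<iota>_of_nat)
    moreover have "of_nat (Suc l) \<in> adj y"
      using adj_base[of "of_nat (Suc l)"] by (simp only: hom_of_nat)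
    ultimately have "of_nat (Suc l) * \<iota> [:Polynomial.coeff P (Suc l):] / of_nat (Suc l) \<in> adj y"
      by (rule adj_divide)
    then show ?thesis by (simp del: of_nat_Suc)
  qed
  show ?case
  proof (cases j)
    case 0
    obtain c P' where P: "P = pCons c P'" by (metis pCons_cases)
    have "\<iota> [:Polynomial.coeff P' l:] \<in> adj y" for l using high[of l] by (simp add: P)
    then have "\<iota> P' \<in> adj y"
    proof (induction P')
      case (pCons a P'')
      have "\<iota> [:a:] \<in> adj y" "\<And>l. \<iota> [:Polynomial.coeff P'' l:] \<in> adj y"
        using pCons.prems[of 0] pCons.prems[of "Suc _"] by auto
      then show ?case unfolding \<iota>_pCons[of a P'']
        using pCons.IH by (intro adj_add adj_mult var_mem) auto
    qed (simp add: adj_0)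
    then have "\<iota> P - \<iota> [:0, 1:] * \<iota> P' \<in> adj y"
      using Suc.prems by (intro adj_diff adj_mult var_mem)
    then show ?thesis using 0 \<iota>_pCons[of c P'] by (simp add: P)
  next
    case (Suc l)
    then show ?thesis using high by simp
  qed
qed

definition subst_at :: "nat \<Rightarrow> ('i, 'k) mpol \<Rightarrow> ('i, 'k) mpol" where
  "subst_at t p = poly (expand_in i p) (of_nat t)"

lemma vars_in_subst_at: "vars_in (- {i}) (subst_at t p)"
proof -
  have "vars_in (- {i}) (of_nat t :: ('i, 'k) mpol)"
    by (simp flip: single_of_nat add: vars_in_const)
  then show ?thesis
    unfolding subst_at_def by (intro vars_in_poly vars_in_coeff_expand_in')
qed

lemma \<tau>_subst_at: "\<tau> (subst_at t p) = poly (\<Theta> p) (of_nat t)"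
  using \<tau>.poly_map_poly[of "expand_in i p" "of_nat t"]
  by (simp add: subst_at_def expand_closure_def \<tau>.hom_of_nat)

lemma subst_at_hom: "comm_ring_hom (subst_at t)"
proof -
  interpret e: comm_ring_hom "expand_in i :: ('i, 'k) mpol \<Rightarrow> _" by (rule expand_in_hom)
  show ?thesis by unfold_locales (simp_all add: subst_at_def e.hom_add e.hom_mult)
qed

lemma substitute_at:
  "poly (map_poly \<tau> (map_poly (subst_at t) G)) (poly Q (of_nat t)) = poly (poly (map_poly \<Theta> G) Q) (of_nat t)"
proof -
  interpret s: comm_ring_hom "subst_at t" by (rule subst_at_hom)
  have "map_poly \<tau> (map_poly (subst_at t) G) = map_poly (\<lambda>p. poly p (of_nat t)) (map_poly \<Theta> G)"
    by (rule poly_eqI) (simp add: coeff_map_poly \<tau>_subst_at)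
  then show ?thesis by (simp add: poly_hom.poly_map_poly)
qed

lemma ev_const:
  assumes "\<And>n. vars_in (- {i}) (Polynomial.coeff G n)"
  shows "ev (\<iota> [:c:]) (map_poly to_fract G) = \<iota> [:poly (map_poly \<tau> G) c:]"
proof -
  have "poly (map_poly \<Theta> G) [:c:] = [:poly (map_poly \<tau> G) c:]"
    using assms
  proof (induction G)
    case (pCons a G)
    have "vars_in (- {i}) a" "\<And>n. vars_in (- {i}) (Polynomial.coeff G n)"
      using pCons.prems[of 0] pCons.prems[of "Suc _"] by auto
    then show ?case using pCons.IH
      by (simp add: \<Theta>.map_poly_pCons_hom \<tau>.map_poly_pCons_hom \<Theta>_const)
  qed simp
  then show ?thesis by (simp add: ev_fract)
qed

text \<open>
  By \<open>coeffs_mem\<close> there are \<open>b\<^sub>j\<close> and \<open>G\<^sub>j\<close> over \<open>k[X]\<close> such that \<open>b\<^sub>j\<close> times the \<open>j\<close>-th coefficient of \<open>Q\<close> is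
  \<open>G\<^sub>j(Q(Z), Z)\<close>. For a natural number \<open>t\<close> at which no \<open>b\<^sub>j\<close> vanishes, putting \<open>Z = t\<close> expresses the
  coefficients of \<open>Q\<close>, and then \<open>y\<close>, through the constant \<open>Q(t)\<close>.
\<close>

proposition constant_generator:
  obtains c G where "Polynomial.lead_coeff G = 1" "Polynomial.degree G = Polynomial.degree H"
    "\<And>n. vars_in (- {i}) (Polynomial.coeff G n)"
    "ev c (map_poly to_fract G) = 0" "adj c = adj y"
proof -
  have "\<exists>b G. b \<noteq> 0 \<and> \<Theta> b * [:Polynomial.coeff Q j:] = poly (map_poly \<Theta> G) Q" for j
    using \<iota>_mem_adjE[OF coeffs_mem[OF adj_self, of j]] by metis
  then obtain b G where b: "\<And>j. b j \<noteq> 0"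
    and G: "\<And>j. \<Theta> (b j) * [:Polynomial.coeff Q j:] = poly (map_poly \<Theta> (G j)) Q" by metis
  define B where "B = (\<Prod>j\<le>Polynomial.degree Q. \<Theta> (b j))"
  have "B \<noteq> 0" using b by (auto simp: B_def)
  then have "finite {x. poly B x = 0}" by (rule poly_roots_finite)
  then have "finite (of_nat -` {x. poly B x = 0} :: nat set)"
    by (rule finite_vimageI) (simp add: inj_on_def)
  then obtain t where t: "poly B (of_nat t) \<noteq> 0"
    using infinite_UNIV_nat by (metis (mono_tags, lifting) UNIV_eq_I mem_Collect_eq vimageI2)
  have bt: "\<tau> (subst_at t (b j)) \<noteq> 0" if "j \<le> Polynomial.degree Q" for j
    using t that by (auto simp: B_def poly_prod \<tau>_subst_at)
  define \<gamma> where "\<gamma> = poly Q (of_nat t)"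
  define c where "c = \<iota> [:\<gamma>:]"
  interpret s: comm_ring_hom "subst_at t" by (rule subst_at_hom)
  have coeff_mem: "\<iota> [:Polynomial.coeff Q j:] \<in> adj c" for j
  proof (cases "j \<le> Polynomial.degree Q")
    case True
    define g where "g = map_poly (subst_at t) (G j)"
    have v: "vars_in (- {i}) (Polynomial.coeff g n)" for n by (simp add: g_def vars_in_subst_at)
    have "poly (map_poly \<tau> g) \<gamma> = \<tau> (subst_at t (b j)) * Polynomial.coeff Q j"
      unfolding g_def \<gamma>_def substitute_at G[symmetric] by (simp add: \<tau>_subst_at)
    then have "ev c (map_poly to_fract g) = \<iota> ([:\<tau> (subst_at t (b j)):] * [:Polynomial.coeff Q j:])"
      unfolding c_def ev_const[OF v] by simp
    also have "\<dots> = \<eta> (to_fract (subst_at t (b j))) * \<iota> [:Polynomial.coeff Q j:]"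
      by (simp only: \<iota>.hom_mult \<eta>_to_fract \<Theta>_const[OF vars_in_subst_at])
    finally have e: "ev c (map_poly to_fract g) = \<eta> (to_fract (subst_at t (b j))) * \<iota> [:Polynomial.coeff Q j:]" .
    have "subst_at t (b j) \<noteq> 0" using bt[OF True] by auto
    then have "\<iota> [:Polynomial.coeff Q j:] = \<eta> (inverse (to_fract (subst_at t (b j)))) * ev c (map_poly to_fract g)"
      unfolding e by (simp add: hom_inverse)
    also have "\<dots> \<in> adj c" by (intro adj_mult adj_base) (simp add: adj_def)
    finally show ?thesis .
  qed (simp add: coeff_eq_0 adj_0)
  have z: "\<iota> [:0, 1:] \<in> adj c"
    using adj_base[of "to_fract (mvar i)" c] by (simp add: \<eta>_to_fract \<Theta>_mvar)
  have "y \<in> adj c"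
    using coeff_mem
  proof (induction Q)
    case (pCons a P)
    have "\<iota> [:a:] \<in> adj c" "\<And>l. \<iota> [:Polynomial.coeff P l:] \<in> adj c"
      using pCons.prems[of 0] pCons.prems[of "Suc _"] by auto
    then show ?case unfolding \<iota>_pCons[of a P]
      using pCons.IH by (intro adj_add adj_mult z) auto
  qed (simp add: adj_0)
  then have 1: "adj y \<subseteq> adj c" by (intro adj_least adj_base adj_add adj_mult)
  have value_mem: "\<iota> [:poly P (of_nat t):] \<in> adj y" if "\<And>j. \<iota> [:Polynomial.coeff P j:] \<in> adj y" for P
    using that
  proof (induction P)
    case (pCons a P)
    have a: "\<iota> [:a:] \<in> adj y" "\<And>l. \<iota> [:Polynomial.coeff P l:] \<in> adj y"
      using pCons.prems[of 0] pCons.prems[of "Suc _"] by auto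
    have "[:poly (pCons a P) (of_nat t):] = [:a:] + [:of_nat t:] * [:poly P (of_nat t):]" by simp
    then have "\<iota> [:poly (pCons a P) (of_nat t):] = \<iota> [:a:] + of_nat t * \<iota> [:poly P (of_nat t):]"
      by (simp only: \<iota>.hom_add \<iota>.hom_mult \<iota>_of_nat)
    moreover have "of_nat t \<in> adj y" using adj_base[of "of_nat t"] by (simp add: hom_of_nat)
    ultimately show ?case using a pCons.IH by (auto intro: adj_add adj_mult)
  qed (simp add: adj_0)
  then have "c \<in> adj y" unfolding c_def \<gamma>_def by (intro value_mem coeffs_mem adj_self)
  then have 2: "adj c \<subseteq> adj y" by (intro adj_least adj_base adj_add adj_mult)
  define K where "K = map_poly (subst_at t) H"
  have K: "Polynomial.lead_coeff K = 1" "Polynomial.degree K = Polynomial.degree H"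
    unfolding K_def by (rule monic_map_poly; simp add: monic)+
  have vK: "vars_in (- {i}) (Polynomial.coeff K n)" for n by (simp add: K_def vars_in_subst_at)
  have "poly (map_poly \<tau> K) \<gamma> = 0"
    unfolding K_def \<gamma>_def substitute_at solution by simp
  then have "ev c (map_poly to_fract K) = 0" unfolding c_def ev_const[OF vK] by simp
  then show thesis using that K vK 1 2 by blast
qed

end

section \<open>The quotient ring as a subfield\<close>

lemma ring_of_type_algebra_simps:
  "carrier (ring_of_type_algebra :: 'a::comm_ring_1 ring) = UNIV"
  "x \<otimes>\<^bsub>(ring_of_type_algebra :: 'a ring)\<^esub> z = x * z"
  "x \<oplus>\<^bsub>(ring_of_type_algebra :: 'a ring)\<^esub> z = x + z"
  "\<zero>\<^bsub>(ring_of_type_algebra :: 'a ring)\<^esub> = 0"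
  "\<one>\<^bsub>(ring_of_type_algebra :: 'a ring)\<^esub> = 1"
  by (simp_all add: ring_of_type_algebra_def)

lemma ring_of_type_algebra_a_inv:
  "\<ominus>\<^bsub>(ring_of_type_algebra :: 'a::comm_ring_1 ring)\<^esub> x = - x"
proof -
  interpret ring "ring_of_type_algebra :: 'a ring" by (rule ring_from_type_algebra)
  show ?thesis by (rule minus_equality) (simp_all add: ring_of_type_algebra_simps)
qed

lemma ring_of_type_algebra_m_inv:
  assumes "x \<noteq> 0"
  shows "inv\<^bsub>(ring_of_type_algebra :: 'a::field ring)\<^esub> x = inverse x"
proof -
  interpret field "ring_of_type_algebra :: 'a ring" by (rule field_from_type_algebra)
  show ?thesis
    using assms by (intro comm_inv_char) (simp_all add: ring_of_type_algebra_simps)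
qed

lemma subfield_of_type_algebra:
  fixes K :: "'a::field set"
  assumes "1 \<in> K" "\<And>a b. a \<in> K \<Longrightarrow> b \<in> K \<Longrightarrow> a + b \<in> K" "\<And>a b. a \<in> K \<Longrightarrow> b \<in> K \<Longrightarrow> a * b \<in> K"
    "\<And>a. a \<in> K \<Longrightarrow> - a \<in> K" "\<And>a. a \<in> K \<Longrightarrow> inverse a \<in> K"
  shows "field (ring_of_type_algebra \<lparr> carrier := K \<rparr>)"
proof -
  interpret field "ring_of_type_algebra :: 'a ring" by (rule field_from_type_algebra)
  have "subfield K ring_of_type_algebra"
  proof (rule subfieldI')
    show "subring K ring_of_type_algebra"
      using assms by (intro subringI) (simp_all add: ring_of_type_algebra_simps ring_of_type_algebra_a_inv)
    fix k assume "k \<in> K - {\<zero>\<^bsub>ring_of_type_algebra\<^esub>}"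
    then show "inv\<^bsub>ring_of_type_algebra\<^esub> k \<in> K"
      using assms(5) by (auto simp: ring_of_type_algebra_simps ring_of_type_algebra_m_inv)
  qed
  then show ?thesis using subfield_iff(2) by blast
qed

context monic_irreducible
begin

text \<open>
  The value at \<open>c\<close> common to all representatives of a residue class; it is meaningful if the modulus
  vanishes at \<open>c\<close>.
\<close>

definition realize where "realize c A = the_elem (ev c ` A)"

lemma
  assumes "\<And>p. ev c p = 0 \<longleftrightarrow> map_poly to_fract G dvd p"
  shows realize_iso: "realize c \<in> ring_iso (quot_ring G) (ring_of_type_algebra \<lparr> carrier := adj c \<rparr>)"
    and realize_coset: "realize c (quot_ideal G +>\<^bsub>ratfun_poly_ring\<^esub> p) = ev c p"
proof -
  interpret ring_hom_ring "ratfun_poly_ring :: ('i, 'k) ratfun poly ring" ring_of_type_algebra "ev c"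
    unfolding ratfun_poly_ring_def
    by (intro ring_hom_ringI ring_from_type_algebra) (simp_all add: ring_of_type_algebra_simps)
  have ker: "a_kernel ratfun_poly_ring ring_of_type_algebra (ev c) = quot_ideal G"
    unfolding a_kernel_def' quot_ideal_def cgenideal_def ratfun_poly_ring_def ring_of_type_algebra_simps
    by (auto simp: assms dvd_def mult.commute)
  have img: "ev c ` carrier ratfun_poly_ring = adj c"
    by (simp add: adj_def ratfun_poly_ring_def ring_of_type_algebra_simps)
  show "realize c \<in> ring_iso (quot_ring G) (ring_of_type_algebra \<lparr> carrier := adj c \<rparr>)"
    using FactRing_iso_set_aux by (simp add: ker img quot_ring_def realize_def[abs_def])
  show "realize c (quot_ideal G +>\<^bsub>ratfun_poly_ring\<^esub> p) = ev c p"
  proof -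
    have "p \<in> carrier ratfun_poly_ring" by (simp add: ratfun_poly_ring_def ring_of_type_algebra_simps)
    from the_elem_simp[OF this] show ?thesis unfolding ker realize_def .
  qed
qed

lemma ratfun_poly_ring: "cring (ratfun_poly_ring :: ('i, 'k) ratfun poly ring)"
  unfolding ratfun_poly_ring_def by (rule cring_from_type_algebra)

lemma quot_ideal: "ideal (quot_ideal G) (ratfun_poly_ring :: ('i, 'k) ratfun poly ring)"
  unfolding quot_ideal_def
  by (rule cring.cgenideal_ideal[OF ratfun_poly_ring]) (simp add: ratfun_poly_ring_def ring_of_type_algebra_simps)

lemma quot_ring_ring: "ring (quot_ring (G :: ('i, 'k) mpol poly))"
  unfolding quot_ring_def by (rule ideal.quotient_is_ring[OF quot_ideal])

definition residue_class :: "('i, 'k) mpol poly \<Rightarrow> ('i, 'k) ratfun poly \<Rightarrow> ('i, 'k) ratfun poly set" where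
  "residue_class G p = quot_ideal G +>\<^bsub>ratfun_poly_ring\<^esub> p"

lemma residue_class_hom: "ring_hom_ring ratfun_poly_ring (quot_ring G) (residue_class G)"
  using ideal.rcos_ring_hom_ring[OF quot_ideal, of G] by (simp add: quot_ring_def residue_class_def[abs_def])

lemma residue_class_simps:
  "residue_class G p \<in> carrier (quot_ring G)"
  "residue_class G (p + q) = residue_class G p \<oplus>\<^bsub>quot_ring G\<^esub> residue_class G q"
  "residue_class G (p * q) = residue_class G p \<otimes>\<^bsub>quot_ring G\<^esub> residue_class G q"
  "residue_class G 1 = \<one>\<^bsub>quot_ring G\<^esub>"
  "residue_class G 0 = \<zero>\<^bsub>quot_ring G\<^esub>"
proof -
  interpret ring_hom_ring ratfun_poly_ring "quot_ring G" "residue_class G" by (rule residue_class_hom)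
  show "residue_class G p \<in> carrier (quot_ring G)"
    "residue_class G (p + q) = residue_class G p \<oplus>\<^bsub>quot_ring G\<^esub> residue_class G q"
    "residue_class G (p * q) = residue_class G p \<otimes>\<^bsub>quot_ring G\<^esub> residue_class G q"
    "residue_class G 1 = \<one>\<^bsub>quot_ring G\<^esub>" "residue_class G 0 = \<zero>\<^bsub>quot_ring G\<^esub>"
    using hom_closed[of p] hom_add[of p q] hom_mult[of p q] hom_one hom_zero
    by (simp_all add: ratfun_poly_ring_def ring_of_type_algebra_simps)
qed

lemma carrier_quot_ring: "carrier (quot_ring G) = range (residue_class G)"
  by (auto simp: quot_ring_def FactRing_def A_RCOSETS_def RCOSETS_def residue_class_def a_r_coset_def
      ratfun_poly_ring_def ring_of_type_algebra_simps)

lemma quot_const_eq: "quot_const (G :: ('i, 'k) mpol poly) c = residue_class G [:c:]"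
  by (simp add: quot_const_def residue_class_def)

lemma quot_const_mem: "quot_const (G :: ('i, 'k) mpol poly) c \<in> carrier (quot_ring G)"
  by (simp add: quot_const_eq residue_class_simps)

lemma residue_class_eq_zero_iff: "residue_class G p = \<zero>\<^bsub>quot_ring G\<^esub> \<longleftrightarrow> map_poly to_fract G dvd p"
proof -
  interpret ideal "quot_ideal G" ratfun_poly_ring by (rule quot_ideal)
  have p: "p \<in> carrier ratfun_poly_ring" by (simp add: ratfun_poly_ring_def ring_of_type_algebra_simps)
  have "residue_class G p = \<zero>\<^bsub>quot_ring G\<^esub> \<longleftrightarrow> quot_ideal G +>\<^bsub>ratfun_poly_ring\<^esub> p = quot_ideal G"
    by (simp add: residue_class_def quot_ring_def FactRing_def)
  also have "\<dots> \<longleftrightarrow> p \<in> quot_ideal G"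
    using a_rcos_const[of p] a_rcos_self[OF p] by metis
  also have "\<dots> \<longleftrightarrow> map_poly to_fract G dvd p"
    by (auto simp: quot_ideal_def cgenideal_def ratfun_poly_ring_def ring_of_type_algebra_simps dvd_def mult.commute)
  finally show ?thesis .
qed

end

locale irreducible_extension = monic_irreducible i H
  for i :: "'i::{finite,linorder}" and H :: "('i, 'k::field_char_0) mpol poly" +
  fixes y
  assumes y: "ev y h = 0"
begin

sublocale irreducible_root \<eta> h y
  using irreducible y by unfold_locales (simp_all add: irreducible_ratfun_def)

abbreviation "L \<equiv> quot_ring H"
abbreviation "M \<equiv> ring_of_type_algebra \<lparr> carrier := adj y \<rparr>"
abbreviation "\<phi> \<equiv> realize y"

lemma \<phi>_iso: "\<phi> \<in> ring_iso L M"
  by (rule realize_iso[OF ev_eq_0_iff])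

lemma \<phi>_residue_class: "\<phi> (residue_class H p) = ev y p"
  unfolding residue_class_def by (rule realize_coset[OF ev_eq_0_iff])

lemma \<phi>_const: "\<phi> (quot_const H c) = \<eta> c"
  by (simp add: quot_const_eq \<phi>_residue_class)

lemma \<phi>_simps:
  assumes "a \<in> carrier L" "b \<in> carrier L"
  shows "\<phi> a \<in> adj y" "\<phi> (a \<oplus>\<^bsub>L\<^esub> b) = \<phi> a + \<phi> b" "\<phi> (a \<otimes>\<^bsub>L\<^esub> b) = \<phi> a * \<phi> b"
  using ring_iso_memE[OF \<phi>_iso] assms by (auto simp: ring_of_type_algebra_simps)

lemma \<phi>_one: "\<phi> \<one>\<^bsub>L\<^esub> = 1" and \<phi>_zero: "\<phi> \<zero>\<^bsub>L\<^esub> = 0"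
  by (simp_all flip: residue_class_simps add: \<phi>_residue_class)

lemma \<phi>_inj: "a \<in> carrier L \<Longrightarrow> b \<in> carrier L \<Longrightarrow> \<phi> a = \<phi> b \<longleftrightarrow> a = b"
  using ring_iso_memE(5)[OF \<phi>_iso] by (auto simp: bij_betw_def inj_on_def)

lemma \<phi>_image: "\<phi> ` carrier L = adj y"
  using ring_iso_memE(5)[OF \<phi>_iso] by (simp add: bij_betw_def)

lemma field_L: "field L"
proof -
  have M: "field M"
    by (rule subfield_of_type_algebra) (auto intro: adj_1 adj_add adj_mult adj_uminus adj_inverse)
  define \<psi> where "\<psi> = inv_into (carrier L) \<phi>"
  have \<psi>: "\<psi> \<in> ring_iso M L"
    unfolding \<psi>_def by (rule ring_iso_set_sym[OF quot_ring_ring \<phi>_iso])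
  have "\<psi> \<zero>\<^bsub>M\<^esub> = \<zero>\<^bsub>L\<^esub>"
    using \<psi> ring_hom_zero[of \<psi> M L] field.is_ring[OF M] quot_ring_ring by (auto simp: ring_iso_def)
  then show ?thesis using field.ring_iso_imp_img_field[OF M \<psi>] by simp
qed

sublocale L: field L by (rule field_L)

lemma \<phi>_a_inv:
  assumes "a \<in> carrier L" shows "\<phi> (\<ominus>\<^bsub>L\<^esub> a) = - \<phi> a"
proof -
  have "\<phi> a + \<phi> (\<ominus>\<^bsub>L\<^esub> a) = \<phi> (a \<oplus>\<^bsub>L\<^esub> \<ominus>\<^bsub>L\<^esub> a)" using assms by (simp add: \<phi>_simps)
  also have "\<dots> = 0" using assms by (simp add: L.r_neg \<phi>_zero)
  finally show ?thesis by (simp add: eq_neg_iff_add_eq_0 add.commute)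
qed

lemma \<phi>_m_inv:
  assumes "a \<in> carrier L" "a \<noteq> \<zero>\<^bsub>L\<^esub>" shows "\<phi> (inv\<^bsub>L\<^esub> a) = inverse (\<phi> a)"
proof -
  have u: "a \<in> Units L" using assms L.field_Units by simp
  have "\<phi> a * \<phi> (inv\<^bsub>L\<^esub> a) = \<phi> (a \<otimes>\<^bsub>L\<^esub> inv\<^bsub>L\<^esub> a)"
    using assms u by (subst \<phi>_simps(3)) simp_all
  also have "\<dots> = 1" using u by (simp add: \<phi>_one)
  finally show ?thesis by (metis inverse_unique)
qed

lemma \<phi>_power: "a \<in> carrier L \<Longrightarrow> \<phi> (a [^]\<^bsub>L\<^esub> (n::nat)) = \<phi> a ^ n"
  by (induction n) (auto simp: \<phi>_one \<phi>_simps mult.commute)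

lemma \<phi>_eval:
  assumes "z \<in> carrier L"
  shows "L.eval (map (quot_const H) cs) z \<in> carrier L \<and>
    \<phi> (L.eval (map (quot_const H) cs) z) = ev (\<phi> z) (Poly (rev cs))"
proof (induction cs)
  case Nil
  show ?case by (simp add: \<phi>_zero)
next
  case (Cons c cs)
  have "ev (\<phi> z) (Polynomial.monom c n) = \<eta> c * \<phi> z ^ n" for n
    by (simp add: ev_def poly_monom)
  then show ?case
    using Cons assms by (simp add: quot_const_mem \<phi>_simps \<phi>_const \<phi>_power Poly_snoc add.commute)
qed

text \<open>
  Polynomials over a subset of a ring are lists of coefficients from the highest one
  down, whence the reversal.
\<close>

lemma algebraic_partI:
  assumes "z \<in> carrier L" "p \<noteq> 0" "\<And>n. n \<le> Polynomial.degree p \<Longrightarrow> Polynomial.coeff p n \<in> ratfun_without i"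
    and "ev (\<phi> z) p = 0"
  shows "z \<in> algebraic_part i H"
proof -
  define P where "P = map (quot_const H) (rev (coeffs p))"
  have ne: "coeffs p \<noteq> []" using assms(2) by simp
  have hd: "hd P = quot_const H (Polynomial.lead_coeff p)"
    using ne assms(2) by (simp add: P_def hd_map hd_rev last_coeffs_eq_coeff_degree)
  have "quot_const H (Polynomial.lead_coeff p) \<noteq> \<zero>\<^bsub>L\<^esub>"
  proof
    assume "quot_const H (Polynomial.lead_coeff p) = \<zero>\<^bsub>L\<^esub>"
    then have "\<eta> (Polynomial.lead_coeff p) = 0" using \<phi>_const \<phi>_zero by metis
    then show False using assms(2) by simp
  qed
  moreover have "set (coeffs p) \<subseteq> ratfun_without i"
    using assms(3) by (auto simp: coeffs_def simp del: upt_Suc)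
  ultimately have "polynomial\<^bsub>L\<^esub> (quot_const H ` ratfun_without i) P"
    unfolding polynomial_def hd by (auto simp: P_def)
  then have "P \<in> carrier ((quot_const H ` ratfun_without i)[X]\<^bsub>L\<^esub>)"
    by (simp add: univ_poly_def)
  moreover have "L.eval P z = \<zero>\<^bsub>L\<^esub>"
    using \<phi>_eval[OF assms(1), of "rev (coeffs p)"] assms(4)
    by (simp add: P_def flip: \<phi>_inj) (simp add: \<phi>_zero)
  moreover have "P \<noteq> []" using ne by (simp add: P_def)
  ultimately have "L.algebraic (quot_const H ` ratfun_without i) z"
    using L.algebraicI by (simp add: over_def)
  then show ?thesis using assms(1) by (simp add: algebraic_part_def)
qed

lemma \<eta>_ratfun_without: "r \<in> ratfun_without i \<Longrightarrow> \<exists>e. \<eta> r = \<iota> [:e:]"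
proof -
  assume "r \<in> ratfun_without i"
  then obtain p q where pq: "r = to_fract p / to_fract q" "vars_in (- {i}) p" "vars_in (- {i}) q" "q \<noteq> 0"
    by (auto simp: ratfun_without_def vars_in_iff)
  have "\<tau> q \<noteq> 0" using pq(4) mpol_to_closure_eq_iff[of q 0] by simp
  then have "[:\<tau> p:] = [:\<tau> p / \<tau> q:] * [:\<tau> q:]" by simp
  then have "\<iota> [:\<tau> p:] = \<iota> [:\<tau> p / \<tau> q:] * \<iota> [:\<tau> q:]" by (metis \<iota>.hom_mult)
  have "\<eta> r * \<iota> [:\<tau> q:] = \<eta> r * \<eta> (to_fract q)" by (simp only: \<eta>_to_fract \<Theta>_const[OF pq(3)])
  also have "\<dots> = \<eta> (to_fract p)" using pq(1,4) by (simp flip: hom_mult)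
  also have "\<dots> = \<iota> [:\<tau> p:]" by (simp only: \<eta>_to_fract \<Theta>_const[OF pq(2)])
  also have "\<dots> = \<iota> [:\<tau> p / \<tau> q:] * \<iota> [:\<tau> q:]" by fact
  finally have "\<eta> r * \<iota> [:\<tau> q:] = \<iota> [:\<tau> p / \<tau> q:] * \<iota> [:\<tau> q:]" .
  moreover have "\<iota> [:\<tau> q:] \<noteq> 0" using \<open>\<tau> q \<noteq> 0\<close> by simp
  ultimately have "\<eta> r = \<iota> [:\<tau> p / \<tau> q:]" by (metis mult_right_cancel)
  then show ?thesis by blast
qed

text \<open>
  The field of constants is algebraically closed, so a polynomial with constant coefficients already
  splits over it.
\<close>

lemma root_over_constants:
  assumes "p \<noteq> 0" "\<And>n. \<exists>e. \<eta> (Polynomial.coeff p n) = \<iota> [:e:]" "ev w p = 0"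
  shows "\<exists>e. w = \<iota> [:e:]"
proof -
  define \<kappa> where "\<kappa> e = \<iota> [:e:]" for e
  have \<kappa>: "inj_comm_ring_hom \<kappa>"
    unfolding \<kappa>_def
    by (rule comm_ring_hom_inj, rule comp_hom) (unfold_locales, auto)
  interpret \<kappa>: inj_comm_ring_hom \<kappa> by (rule \<kappa>)
  interpret m\<kappa>: map_poly_inj_comm_ring_hom \<kappa> ..
  obtain e where e: "\<And>n. \<eta> (Polynomial.coeff p n) = \<kappa> (e n)" using assms(2) unfolding \<kappa>_def by metis
  have "e n = 0" if "n > Polynomial.degree p" for n
    using e[of n] that by (simp add: coeff_eq_0)
  then have "\<exists>P. \<forall>n. Polynomial.coeff P n = e n"
    by (intro exI[of _ "Abs_poly e"] allI fun_cong[OF Abs_poly_inverse])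
       (auto simp: MOST_nat intro!: exI[of _ "Polynomial.degree p"])
  then obtain P where P: "\<And>n. Polynomial.coeff P n = e n" by blast
  have map: "map_poly \<eta> p = map_poly \<kappa> P" by (rule poly_eqI) (simp add: e P)
  then have "P \<noteq> 0" using assms(1) by auto
  obtain A where A: "P = Polynomial.smult (Polynomial.lead_coeff P) (\<Prod>x\<in>#A. [:- x, 1:])"
    using alg_closed_imp_factorization[OF \<open>P \<noteq> 0\<close>] by blast
  have prod: "poly (map_poly \<kappa> (\<Prod>x\<in>#A. [:- x, 1:])) w = (\<Prod>x\<in>#A. w - \<kappa> x)"
    by (induction A) (simp_all add: m\<kappa>.hom_mult \<kappa>.map_poly_pCons_hom \<kappa>.hom_uminus del: mult_pCons_left mult_pCons_right)
  have "0 = poly (map_poly \<kappa> P) w" using assms(3) by (simp add: ev_def map)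
  also have "\<dots> = \<kappa> (Polynomial.lead_coeff P) * (\<Prod>x\<in>#A. w - \<kappa> x)"
    by (subst A) (simp only: \<kappa>.map_poly_hom_smult poly_smult prod)
  finally have "(\<Prod>x\<in>#A. w - \<kappa> x) = 0" using \<open>P \<noteq> 0\<close> by simp
  then show ?thesis by (auto simp: prod_mset_zero_iff \<kappa>_def)
qed

text \<open>
  Being algebraic means that two different polynomials over the subfield agree at \<open>z\<close>. Their
  difference is a nonzero polynomial whose coefficients are constants of \<open>E(Z)\<close>.
\<close>

lemma algebraic_partD:
  assumes "z \<in> algebraic_part i H"
  shows "\<exists>e. \<phi> z = \<iota> [:e:]"
proof -
  define K where "K = quot_const H ` ratfun_without i"
  have z: "z \<in> carrier L" "\<not> inj_on (\<lambda>p. L.eval p z) (carrier (K[X]\<^bsub>L\<^esub>))"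
    using assms by (auto simp: algebraic_part_def L.transcendental_def K_def)
  then obtain P1 P2 where P: "P1 \<in> carrier (K[X]\<^bsub>L\<^esub>)" "P2 \<in> carrier (K[X]\<^bsub>L\<^esub>)" "P1 \<noteq> P2"
    "L.eval P1 z = L.eval P2 z" by (auto simp: inj_on_def)
  have lift: "\<exists>cs. P = map (quot_const H) cs \<and> set cs \<subseteq> ratfun_without i \<and> (cs \<noteq> [] \<longrightarrow> hd cs \<noteq> 0)"
    if "P \<in> carrier (K[X]\<^bsub>L\<^esub>)" for P
  proof -
    have p: "polynomial\<^bsub>L\<^esub> K P" using that by (simp add: univ_poly_def)
    then have "P \<in> lists K" by (auto simp: polynomial_def)
    then obtain cs where cs: "P = map (quot_const H) cs" "set cs \<subseteq> ratfun_without i"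
      unfolding K_def lists_image by auto
    have "hd cs \<noteq> 0" if "cs \<noteq> []"
      using that p cs(1) by (auto simp: polynomial_def hd_map quot_const_eq residue_class_simps)
    then show ?thesis using cs by blast
  qed
  obtain cs1 cs2 where cs: "P1 = map (quot_const H) cs1" "set cs1 \<subseteq> ratfun_without i" "cs1 \<noteq> [] \<longrightarrow> hd cs1 \<noteq> 0"
    "P2 = map (quot_const H) cs2" "set cs2 \<subseteq> ratfun_without i" "cs2 \<noteq> [] \<longrightarrow> hd cs2 \<noteq> 0"
    using lift[OF P(1)] lift[OF P(2)] by blast
  have co: "coeffs (Poly (rev cs)) = rev cs" if "cs \<noteq> [] \<longrightarrow> hd cs \<noteq> (0 :: ('i, 'k) ratfun)" for cs
    using that by (cases cs) simp_all
  define p where "p = Poly (rev cs1) - Poly (rev cs2)"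
  have "p \<noteq> 0"
  proof
    assume "p = 0"
    then have "coeffs (Poly (rev cs1)) = coeffs (Poly (rev cs2))" by (simp add: p_def)
    then have "cs1 = cs2" using co[OF cs(3)] co[OF cs(6)] by (metis rev_rev_ident)
    then show False using P(3) cs by simp
  qed
  moreover have "\<exists>e. \<eta> (Polynomial.coeff p n) = \<iota> [:e:]" for n
  proof -
    have "\<exists>e. \<eta> (Polynomial.coeff (Poly (rev cs)) n) = \<iota> [:e:]" if "set cs \<subseteq> ratfun_without i" for cs
    proof (cases "n < length cs")
      case True
      then have "rev cs ! n \<in> ratfun_without i" using that nth_mem[of n "rev cs"] by auto
      then show ?thesis using True \<eta>_ratfun_without by (simp add: nth_default_def)
    qed (auto simp: nth_default_def intro!: exI[of _ 0])
    then obtain e1 e2 where "\<eta> (Polynomial.coeff (Poly (rev cs1)) n) = \<iota> [:e1:]"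
      "\<eta> (Polynomial.coeff (Poly (rev cs2)) n) = \<iota> [:e2:]" using cs(2,5) by meson
    then have "\<eta> (Polynomial.coeff p n) = \<iota> ([:e1:] - [:e2:])"
      by (simp only: p_def coeff_diff hom_minus \<iota>.hom_minus)
    then show ?thesis by (intro exI[of _ "e1 - e2"]) simp
  qed
  moreover have "ev (\<phi> z) p = 0"
    using \<phi>_eval[OF z(1), of cs1] \<phi>_eval[OF z(1), of cs2] P(4) cs by (simp add: p_def)
  ultimately show ?thesis by (rule root_over_constants)
qed

end

section \<open>The field generated by the algebraic part and one variable\<close>

text \<open>
  Factorial rings are integrally closed: in lowest terms the denominator of \<open>u\<close> divides a power of the
  numerator.
\<close>

lemma monic_root_in_ring:
  fixes G :: "'a::{factorial_ring_gcd,semiring_gcd_mult_normalize} poly"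
  assumes monic: "Polynomial.lead_coeff G = 1" and root: "poly (map_poly to_fract G) u = 0"
  shows "\<exists>a. u = to_fract a"
proof -
  define a b where "a = fst (quot_of_fract u)" and "b = snd (quot_of_fract u)"
  have u: "u = to_fract a / to_fract b" and b: "b \<noteq> 0" and cop: "coprime a b"
    by (simp_all add: a_def b_def coprime_quot_of_fract flip: Fract_conv_to_fract)
  define d where "d = Polynomial.degree G"
  have "to_fract (\<Sum>j\<le>d. Polynomial.coeff G j * a ^ j * b ^ (d - j)) =
      to_fract b ^ d * (\<Sum>j\<le>d. to_fract (Polynomial.coeff G j) * u ^ j)"
    unfolding sum_distrib_left to_fract_hom.hom_sum
  proof (rule sum.cong[OF refl])
    fix j assume "j \<in> {..d}"
    then have "to_fract b ^ d = to_fract b ^ (d - j) * to_fract b ^ j"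
      by (simp flip: power_add)
    then show "to_fract (Polynomial.coeff G j * a ^ j * b ^ (d - j)) =
        to_fract b ^ d * (to_fract (Polynomial.coeff G j) * u ^ j)"
      using b by (simp add: u power_divide to_fract_hom.hom_power)
  qed
  also have "(\<Sum>j\<le>d. to_fract (Polynomial.coeff G j) * u ^ j) = poly (map_poly to_fract G) u"
    by (simp add: poly_altdef d_def)
  finally have "to_fract (\<Sum>j\<le>d. Polynomial.coeff G j * a ^ j * b ^ (d - j)) = 0"
    unfolding root by (simp only: mult_zero_right)
  then have "(\<Sum>j\<le>d. Polynomial.coeff G j * a ^ j * b ^ (d - j)) = 0"
    by (rule to_fract_hom.hom_0)
  moreover have "(\<Sum>j\<le>d. Polynomial.coeff G j * a ^ j * b ^ (d - j)) =
      a ^ d + (\<Sum>j<d. Polynomial.coeff G j * a ^ j * b ^ (d - j))"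
    using monic by (simp add: d_def flip: lessThan_Suc_atMost)
  ultimately have "a ^ d = - (\<Sum>j<d. Polynomial.coeff G j * a ^ j * b ^ (d - j))"
    by (simp add: eq_neg_iff_add_eq_0)
  moreover have "b dvd (\<Sum>j<d. Polynomial.coeff G j * a ^ j * b ^ (d - j))"
    by (intro dvd_sum dvd_mult dvd_power) auto
  ultimately have "b dvd a ^ d" by simp
  moreover have "coprime (a ^ d) b" using cop by simp
  ultimately have "is_unit b" by (metis coprime_common_divisor dvd_refl)
  then obtain w where w: "1 = b * w" by (rule dvdE)
  then have "to_fract b * to_fract w = 1" by (metis to_fract_hom.hom_mult to_fract_hom.hom_one)
  then have "u = to_fract (a * w)"
    using b by (simp add: u to_fract_hom.hom_mult field_simps)
  then show ?thesis by blast
qed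

lemma deg_in_eq_0_iff: "deg_in i G = 0 \<longleftrightarrow> (\<forall>l. vars_in (- {i}) (Polynomial.coeff G l))"
proof -
  define S where "S = {Poly_Mapping.lookup e i | l e. e \<in> Poly_Mapping.keys (Polynomial.coeff G l)}"
  have "S \<subseteq> (\<Union>l\<le>Polynomial.degree G. (\<lambda>e. Poly_Mapping.lookup e i) ` Poly_Mapping.keys (Polynomial.coeff G l))"
  proof
    fix n assume "n \<in> S"
    then obtain l e where le: "n = Poly_Mapping.lookup e i" "e \<in> Poly_Mapping.keys (Polynomial.coeff G l)"
      by (auto simp: S_def)
    then have "l \<le> Polynomial.degree G" by (intro le_degree) auto
    then show "n \<in> (\<Union>l\<le>Polynomial.degree G. (\<lambda>e. Poly_Mapping.lookup e i) ` Poly_Mapping.keys (Polynomial.coeff G l))"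
      using le by blast
  qed
  then have fin: "finite S" by (rule finite_subset) auto
  have "deg_in i G = 0 \<longleftrightarrow> (\<forall>n\<in>S. n = 0)"
    unfolding deg_in_def S_def[symmetric] using fin by (auto simp: Max_eq_iff)
  then show ?thesis by (auto simp: S_def vars_in_iff)
qed

lemma ratfun_without_to_fract: "vars_in (- {i}) p \<Longrightarrow> to_fract p \<in> ratfun_without i"
  unfolding ratfun_without_def vars_in_iff[symmetric]
  by (rule CollectI, rule exI[of _ p], rule exI[of _ 1]) (simp add: vars_in_1)

context irreducible_extension
begin

definition "gen_field = generate_field L (algebraic_part i H \<union> {quot_const H (to_fract (mvar i))})"

lemma generators_subset: "algebraic_part i H \<union> {quot_const H (to_fract (mvar i))} \<subseteq> carrier L"
  by (auto simp: algebraic_part_def quot_const_mem)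

lemma gen_field_subset: "gen_field \<subseteq> carrier L"
  unfolding gen_field_def by (rule L.generate_field_incl[OF generators_subset])

lemma cond_II_at_iff: "cond_II_at H i \<longleftrightarrow> gen_field \<noteq> carrier L"
  using gen_field_subset by (auto simp: cond_II_at_def gen_field_def)

text \<open>
  The target of \<open>to_ac\<close> is the algebraic closure of \<open>E(Z)\<close>, so its range is \<open>E(Z)\<close>. It contains the constants
  and \<open>Z\<close>, hence all that is generated from the algebraic part and the variable.
\<close>

lemma \<phi>_gen_field: "x \<in> gen_field \<Longrightarrow> \<phi> x \<in> range to_ac"
  unfolding gen_field_def
proof (induction rule: generate_field.induct)
  case one
  show ?case using range_eqI[of 1 to_ac 1] by (simp add: \<phi>_one)
next
  case (incl x)
  then show ?case
    using algebraic_partD by (auto simp: \<phi>_const \<eta>_to_fract poly_to_field_def dest!: algebraic_partD)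
next
  case (a_inv x)
  then have x: "x \<in> carrier L" using gen_field_subset by (auto simp: gen_field_def)
  obtain u where "\<phi> x = to_ac u" using a_inv.IH by blast
  then show ?case using x by (auto simp: \<phi>_a_inv intro!: range_eqI[of _ _ "- u"])
next
  case (m_inv x)
  then have x: "x \<in> carrier L" using gen_field_subset by (auto simp: gen_field_def)
  obtain u where "\<phi> x = to_ac u" using m_inv.IH by blast
  then show ?case using x m_inv.hyps by (auto simp: \<phi>_m_inv intro!: range_eqI[of _ _ "inverse u"])
next
  case (eng_add x z)
  then have x: "x \<in> carrier L" "z \<in> carrier L" using gen_field_subset by (auto simp: gen_field_def)
  obtain u v where "\<phi> x = to_ac u" "\<phi> z = to_ac v" using eng_add.IH by blast
  then show ?case using x by (auto simp: \<phi>_simps intro!: range_eqI[of _ _ "u + v"])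
next
  case (eng_mult x z)
  then have x: "x \<in> carrier L" "z \<in> carrier L" using gen_field_subset by (auto simp: gen_field_def)
  obtain u v where "\<phi> x = to_ac u" "\<phi> z = to_ac v" using eng_mult.IH by blast
  then show ?case using x by (auto simp: \<phi>_simps intro!: range_eqI[of _ _ "u * v"])
qed

lemma solution_if_not_cond_II_at:
  assumes "\<not> cond_II_at H i"
  shows "\<exists>Q. poly (map_poly \<Theta> H) Q = 0"
proof -
  have "residue_class H [:0, 1:] \<in> gen_field" using assms by (simp add: cond_II_at_iff residue_class_simps)
  then have "y \<in> range to_ac" using \<phi>_gen_field[of "residue_class H [:0, 1:]"] by (simp add: \<phi>_residue_class)
  then obtain u where u: "y = to_ac u" by blast
  have "map_poly \<eta> h = map_poly to_ac (map_poly to_fract (map_poly \<Theta> H))"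
    by (rule poly_eqI) (simp add: coeff_map_poly \<eta>_to_fract poly_to_field_def)
  then have ac_root: "poly (map_poly to_ac (map_poly to_fract (map_poly \<Theta> H))) (to_ac u) = 0"
    using y by (simp add: ev_def u)
  interpret ac: comm_ring_hom "to_ac :: ('i, 'k) ratfun alg_closure poly fract \<Rightarrow> _"
    by (rule to_ac_hom)
  have root: "poly (map_poly to_fract (map_poly \<Theta> H)) u = 0"
    using ac_root unfolding ac.poly_map_poly by simp
  have "Polynomial.lead_coeff (map_poly \<Theta> H) = 1"
    by (rule monic_map_poly) (simp_all add: monic)
  then obtain Q where Q: "u = to_fract Q" using monic_root_in_ring[OF _ root] by blast
  have "to_fract (poly (map_poly \<Theta> H) Q) = 0"
    using root by (simp add: Q)
  then show ?thesis by auto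
qed

text \<open>
  The image \<open>W\<close> of the generated field is closed under the field operations and contains \<open>\<eta> k(X')\<close>, the
  variable, and the generator \<open>c\<close>, which is algebraic because \<open>G\<close> is free of \<open>X\<^bsub>i\<^esub>\<close>.
\<close>

lemma not_cond_II_at_if_generator:
  assumes c: "adj c = adj y" "ev c (map_poly to_fract G) = 0" "G \<noteq> 0"
    and G: "\<And>l. vars_in (- {i}) (Polynomial.coeff G l)"
  shows "\<not> cond_II_at H i"
proof -
  define W where "W = \<phi> ` gen_field"
  have gen_mem: "x \<in> carrier L" if "x \<in> gen_field" for x using that gen_field_subset by blast
  have W_alg: "w \<in> W" if w: "w \<in> adj y" "p \<noteq> 0" "\<And>n. n \<le> Polynomial.degree p \<Longrightarrow> Polynomial.coeff p n \<in> ratfun_without i"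
    "ev w p = 0" for w p
  proof -
    obtain x where x: "x \<in> carrier L" "w = \<phi> x" using w(1) \<phi>_image by blast
    then have "x \<in> algebraic_part i H" using w by (intro algebraic_partI[of x p]) auto
    then have "x \<in> gen_field" unfolding gen_field_def by (intro generate_field.incl) simp
    then show ?thesis using x by (simp add: W_def)
  qed
  have W_add: "a + b \<in> W" and W_mult: "a * b \<in> W" if "a \<in> W" "b \<in> W" for a b
  proof -
    obtain x z where x: "x \<in> gen_field" "z \<in> gen_field" "a = \<phi> x" "b = \<phi> z" using \<open>a \<in> W\<close> \<open>b \<in> W\<close> by (auto simp: W_def)
    have "a + b = \<phi> (x \<oplus>\<^bsub>L\<^esub> z)" "a * b = \<phi> (x \<otimes>\<^bsub>L\<^esub> z)" using x gen_mem by (simp_all add: \<phi>_simps)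
    moreover have "x \<oplus>\<^bsub>L\<^esub> z \<in> gen_field" "x \<otimes>\<^bsub>L\<^esub> z \<in> gen_field"
      using x unfolding gen_field_def by (auto intro: generate_field.intros)
    ultimately show "a + b \<in> W" "a * b \<in> W" by (auto simp: W_def)
  qed
  have W_inverse: "inverse a \<in> W" if aW: "a \<in> W" for a
  proof (cases "a = 0")
    case False
    obtain x where x: "x \<in> gen_field" "a = \<phi> x" using aW by (auto simp: W_def)
    then have "x \<noteq> \<zero>\<^bsub>L\<^esub>" using False \<phi>_zero by auto
    then have "inverse a = \<phi> (inv\<^bsub>L\<^esub> x)" "inv\<^bsub>L\<^esub> x \<in> gen_field"
      using x gen_mem unfolding gen_field_def by (auto simp: \<phi>_m_inv gen_field_def[symmetric] intro: generate_field.intros)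
    then show ?thesis by (simp add: W_def)
  qed (use aW in simp)
  have W_const: "\<eta> (to_fract p) \<in> W" if p: "vars_in (- {i}) p" for p
  proof (rule W_alg[of _ "[:- to_fract p, 1:]"])
    have "vars_in (- {i}) (- p)" using p by (simp add: vars_in_def)
    then have "- to_fract p \<in> ratfun_without i"
      using ratfun_without_to_fract[of i "- p"] by simp
    moreover have "1 \<in> ratfun_without i" using ratfun_without_to_fract[OF vars_in_1, of i] by simp
    ultimately show "Polynomial.coeff [:- to_fract p, 1:] n \<in> ratfun_without i"
      if "n \<le> Polynomial.degree [:- to_fract p, 1:]" for n
      using that by (auto simp: coeff_pCons le_Suc_eq split: nat.splits)
  qed (auto simp: adj_base hom_uminus)
  have W_var: "\<eta> (to_fract (mvar i)) \<in> W"
    unfolding W_def gen_field_def \<phi>_const[symmetric] by (intro imageI generate_field.incl) simp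
  have W_poly: "\<eta> (to_fract (poly F (mvar i))) \<in> W" if "\<And>n. vars_in (- {i}) (Polynomial.coeff F n)" for F
    using that
  proof (induction F)
    case 0
    show ?case using W_const[OF vars_in_0] by simp
  next
    case (pCons a F)
    have "vars_in (- {i}) a" "\<And>n. vars_in (- {i}) (Polynomial.coeff F n)"
      using pCons.prems[of 0] pCons.prems[of "Suc _"] by auto
    then show ?case
      using pCons.IH W_const W_var by (simp add: hom_add hom_mult W_add W_mult)
  qed
  have W_base: "\<eta> r \<in> W" for r
  proof -
    obtain p q where r: "r = to_fract p / to_fract q" by (cases r) (auto simp: Fract_conv_to_fract)
    have "\<eta> (to_fract p) \<in> W" for p
      using W_poly[of "expand_in i p"] by (simp add: vars_in_coeff_expand_in' poly_expand_in)
    then show ?thesis by (simp add: r divide_inverse hom_mult hom_inverse W_mult W_inverse)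
  qed
  have "c \<in> W"
  proof (rule W_alg[of _ "map_poly to_fract G"])
    show "c \<in> adj y" using adj_self[of c] c(1) by simp
    show "Polynomial.coeff (map_poly to_fract G) n \<in> ratfun_without i" for n
      using G by (simp add: ratfun_without_to_fract)
  qed (use c in auto)
  then have "adj y \<subseteq> W"
    unfolding c(1)[symmetric] by (intro adj_least W_base W_add W_mult)
  have "carrier L \<subseteq> gen_field"
  proof
    fix x assume x: "x \<in> carrier L"
    then have "\<phi> x \<in> W" using \<open>adj y \<subseteq> W\<close> \<phi>_simps(1) by blast
    then obtain z where "z \<in> gen_field" "\<phi> x = \<phi> z" by (auto simp: W_def)
    then show "x \<in> gen_field" using \<phi>_inj[OF x] gen_mem by metis
  qed
  then show ?thesis using gen_field_subset by (simp add: cond_II_at_iff)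
qed

lemma quot_const_hom: "quot_const H \<in> Ring.ring_hom ratfun_ring L"
proof (rule ring_hom_memI)
  fix a b :: "('i, 'k) ratfun"
  have "[:a:] * [:b:] = [:a * b:]" "[:a:] + [:b:] = [:a + b:]" by simp_all
  then show "quot_const H (a \<otimes>\<^bsub>ratfun_ring\<^esub> b) = quot_const H a \<otimes>\<^bsub>L\<^esub> quot_const H b"
    "quot_const H (a \<oplus>\<^bsub>ratfun_ring\<^esub> b) = quot_const H a \<oplus>\<^bsub>L\<^esub> quot_const H b"
    by (simp_all only: quot_const_eq ratfun_ring_def ring_of_type_algebra_simps flip: residue_class_simps)
qed (simp_all add: quot_const_mem quot_const_eq ratfun_ring_def ring_of_type_algebra_simps residue_class_simps)

lemma finite_dimension_L: "L.finite_dimension (range (quot_const H)) (carrier L)"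
proof -
  have ratfun: "field (ratfun_ring :: ('i, 'k) ratfun ring)"
    unfolding ratfun_ring_def by (rule field_from_type_algebra)
  interpret q: ring_hom_ring ratfun_ring L "quot_const H"
    using quot_const_hom field.is_ring[OF ratfun] by (intro ring_hom_ringI2 quot_ring_ring)
  have "subfield (quot_const H ` carrier ratfun_ring) L"
    using field.carrier_is_subfield[OF ratfun] by (intro q.img_is_subfield(2)) simp_all
  then have K: "subfield (range (quot_const H)) L"
    by (simp add: ratfun_ring_def ring_of_type_algebra_simps)
  define x where "x = residue_class H [:0, 1:]"
  have x: "x \<in> carrier L" by (simp add: x_def residue_class_simps)
  have "residue_class H p \<in> L.simple_extension (range (quot_const H)) x" for p
  proof (induction p)
    case 0
    show ?case unfolding residue_class_simps by (rule L.simple_extension.zero)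
  next
    case (pCons a p)
    have "pCons a p = p * [:0, 1:] + [:a:]" by simp
    then have "residue_class H (pCons a p) = residue_class H p \<otimes>\<^bsub>L\<^esub> x \<oplus>\<^bsub>L\<^esub> quot_const H a"
      by (simp only: residue_class_simps x_def quot_const_eq)
    then show ?case using L.simple_extension.lin[OF pCons.IH] by simp
  qed
  then have "carrier L \<subseteq> L.simple_extension (range (quot_const H)) x"
    unfolding carrier_quot_ring by blast
  moreover have "L.simple_extension (range (quot_const H)) x \<subseteq> carrier L"
    using x by (intro L.simple_extension_in_carrier) (auto simp: quot_const_mem)
  ultimately have ext: "L.simple_extension (range (quot_const H)) x = carrier L" by blast
  have "(L.algebraic over (range (quot_const H))) x"
    using K x by (intro L.simple_extension_subfield_imp_algebraic subfieldE(1)) (simp_all add: ext L.carrier_is_subfield)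
  then show ?thesis using L.finite_dimension_simple_extension[OF K x] ext by simp
qed

lemma genuine_polynomial_iff:
  "genuine_polynomial H \<longleftrightarrow> range (quot_const H) \<noteq> carrier L \<and>
     (\<forall>G. ext_isomorphic L (quot_const H) G \<longrightarrow> (\<forall>j. deg_in j G \<noteq> 0))"
  using field_L quot_const_hom finite_dimension_L monic irreducible
  by (auto simp: genuine_polynomial_def genuine_extension_def)

text \<open>The trivial extension is generated over \<open>k(X)\<close> by \<open>0\<close>, a root of \<open>Y\<close>.\<close>

lemma not_cond_II_at_if_trivial:
  assumes "range (quot_const H) = carrier L"
  shows "\<not> cond_II_at H i"
proof (rule not_cond_II_at_if_generator[of 0 "[:0, 1:]"])
  have "adj y = \<phi> ` range (quot_const H)" using \<phi>_image assms by simp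
  also have "\<dots> = range \<eta>" by (simp add: image_image \<phi>_const)
  finally have "adj y = range \<eta>" .
  moreover have "adj 0 \<subseteq> range \<eta>"
  proof
    fix w assume "w \<in> adj 0"
    then obtain p where "w = ev 0 p" by (auto simp: adj_def)
    then show "w \<in> range \<eta>" by (cases p) simp
  qed
  moreover have "range \<eta> \<subseteq> adj 0" by (rule image_subsetI) (rule adj_base)
  ultimately show "adj 0 = adj y" by simp
  show "ev 0 (map_poly to_fract [:0, 1:]) = 0" by (simp add: to_fract_hom.map_poly_pCons_hom)
  show "vars_in (- {i}) (Polynomial.coeff [:0, 1:] l)" for l
    unfolding x_as_monom by (simp add: vars_in_0 vars_in_1)
qed simp

text \<open>
  The element \<open>c\<close> is the image of the class of \<open>Y\<close> under the isomorphism, followed by the embedding \<open>\<phi>\<close>.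
\<close>

lemma ext_isomorphic_generator:
  assumes "ext_isomorphic L (quot_const H) G"
  obtains c where "adj c = adj y" "\<And>p. ev c p = 0 \<longleftrightarrow> map_poly to_fract G dvd p"
proof -
  obtain \<theta> where \<theta>: "\<theta> \<in> ring_iso (quot_ring G) L" "\<And>a. \<theta> (quot_const G a) = quot_const H a"
    using assms by (auto simp: ext_isomorphic_def)
  note \<theta>_simps = ring_iso_memE[OF \<theta>(1)]
  define c where "c = \<phi> (\<theta> (residue_class G [:0, 1:]))"
  have val: "\<phi> (\<theta> (residue_class G p)) = ev c p" for p
  proof (induction p)
    case 0
    have "0 = [:0:]" by simp
    then have "residue_class G 0 = quot_const G 0" by (simp add: quot_const_eq)
    then show ?case by (simp add: \<theta>(2) \<phi>_const)
  next
    case (pCons a p)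
    have "pCons a p = [:a:] + [:0, 1:] * p" by simp
    then have "residue_class G (pCons a p) = quot_const G a \<oplus>\<^bsub>quot_ring G\<^esub> residue_class G [:0, 1:] \<otimes>\<^bsub>quot_ring G\<^esub> residue_class G p"
      by (simp only: residue_class_simps quot_const_eq)
    then have "\<theta> (residue_class G (pCons a p)) = quot_const H a \<oplus>\<^bsub>L\<^esub> \<theta> (residue_class G [:0, 1:]) \<otimes>\<^bsub>L\<^esub> \<theta> (residue_class G p)"
      using residue_class_simps(1) \<theta>_simps(2,3) \<theta>(2) quot_const_mem ring.ring_simprules(5)[OF quot_ring_ring] by simp
    then show ?case
      using pCons.IH residue_class_simps(1) \<theta>_simps(1) quot_const_mem by (simp add: \<phi>_simps \<phi>_const c_def)
  qed
  have "adj c = \<phi> ` \<theta> ` carrier (quot_ring G)"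
    by (simp add: carrier_quot_ring adj_def image_image val)
  also have "\<dots> = adj y" using \<theta>_simps(5) \<phi>_image by (simp add: bij_betw_def)
  finally have 1: "adj c = adj y" .
  have "ev c p = 0 \<longleftrightarrow> map_poly to_fract G dvd p" for p
  proof -
    have "ev c p = 0 \<longleftrightarrow> \<phi> (\<theta> (residue_class G p)) = \<phi> (\<theta> (residue_class G 0))" by (simp add: val)
    also have "\<dots> \<longleftrightarrow> \<theta> (residue_class G p) = \<theta> (residue_class G 0)" by (intro \<phi>_inj \<theta>_simps(1) residue_class_simps(1))
    also have "\<dots> \<longleftrightarrow> residue_class G p = residue_class G 0"
    proof -
      have "inj_on \<theta> (carrier (quot_ring G))" using \<theta>_simps(5) by (simp add: bij_betw_def)
      from inj_on_eq_iff[OF this residue_class_simps(1) residue_class_simps(1)] show ?thesis .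
    qed
    also have "\<dots> \<longleftrightarrow> map_poly to_fract G dvd p" by (simp add: residue_class_eq_zero_iff residue_class_simps(5))
    finally show ?thesis .
  qed
  then show thesis using that 1 by blast
qed

lemma not_cond_II_at_if_ext_isomorphic:
  assumes "ext_isomorphic L (quot_const H) G" "deg_in i G = 0"
  shows "\<not> cond_II_at H i"
proof -
  obtain c where c: "adj c = adj y" "\<And>p. ev c p = 0 \<longleftrightarrow> map_poly to_fract G dvd p"
    using ext_isomorphic_generator[OF assms(1)] by metis
  \<comment> \<open>For \<open>G = 0\<close> the quotient is a polynomial ring, in which \<open>Y\<close> has no inverse.\<close>
  have "G \<noteq> 0"
  proof
    assume G: "G = 0"
    then have "c \<noteq> 0" using c(2)[of "[:0, 1:]"] by auto
    have "inverse c \<in> adj c" using adj_inverse[of c] adj_self[of c] c(1) by simp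
    then obtain u where "inverse c = ev c u" by (auto simp: adj_def)
    then have "c * ev c u = 1" using \<open>c \<noteq> 0\<close> by (metis right_inverse)
    then have "ev c ([:0, 1:] * u - 1) = 0" by simp
    then have "map_poly to_fract G dvd [:0, 1:] * u - 1" unfolding c(2) .
    then have "[:0, 1:] * u - 1 = 0" by (simp only: G fract_poly_0 dvd_0_left_iff)
    then have "poly ([:0, 1:] * u - 1) 0 = 0" by (simp only: poly_0)
    then show False by simp
  qed
  moreover have "ev c (map_poly to_fract G) = 0" by (simp add: c(2))
  ultimately show ?thesis
    using assms(2) c(1) by (intro not_cond_II_at_if_generator) (auto simp: deg_in_eq_0_iff)
qed

end

context bivariate_solution
begin

sublocale ext: irreducible_extension i H y
  by unfold_locales (rule root)

lemma solution_generator: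
  obtains c G where "\<And>l. vars_in (- {i}) (Polynomial.coeff G l)" "G \<noteq> 0"
    "adj c = adj y" "\<And>p. ev c p = 0 \<longleftrightarrow> map_poly to_fract G dvd p"
proof -
  obtain c G where G: "Polynomial.lead_coeff G = 1" "Polynomial.degree G = Polynomial.degree H"
    "\<And>n. vars_in (- {i}) (Polynomial.coeff G n)"
    "ev c (map_poly to_fract G) = 0" "adj c = adj y" using constant_generator by metis
  have "G \<noteq> 0" using G(1) by auto
  have "ev c p = 0 \<longleftrightarrow> map_poly to_fract G dvd p" for p
    using \<open>G \<noteq> 0\<close> by (intro generator_kernel[OF G(5,4)]) (auto simp: G(2))
  then show thesis using that G \<open>G \<noteq> 0\<close> by blast
qed

lemma not_cond_II_at: "\<not> cond_II_at H i"
proof -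
  obtain c G where "\<And>l. vars_in (- {i}) (Polynomial.coeff G l)" "G \<noteq> 0"
    "adj c = adj y" "\<And>p. ev c p = 0 \<longleftrightarrow> map_poly to_fract G dvd p" using solution_generator by metis
  then show ?thesis by (intro ext.not_cond_II_at_if_generator[of c G]) auto
qed

lemma ext_isomorphic_without: "\<exists>G. ext_isomorphic (quot_ring H) (quot_const H) G \<and> deg_in i G = 0"
proof -
  obtain c G where G: "\<And>l. vars_in (- {i}) (Polynomial.coeff G l)" "G \<noteq> 0"
    and c: "adj c = adj y" "\<And>p. ev c p = 0 \<longleftrightarrow> map_poly to_fract G dvd p" using solution_generator by metis
  define \<psi> where "\<psi> = inv_into (carrier (quot_ring H)) (realize y)"
  have iso: "\<psi> \<circ> realize c \<in> ring_iso (quot_ring G) (quot_ring H)"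
    unfolding \<psi>_def
    by (rule ring_iso_set_trans[OF realize_iso[OF c(2), unfolded c(1)]
          ring_iso_set_sym[OF quot_ring_ring ext.\<phi>_iso]])
  have "(\<psi> \<circ> realize c) (quot_const G a) = quot_const H a" for a
  proof -
    have "realize c (quot_const G a) = realize y (quot_const H a)"
      unfolding quot_const_def using realize_coset[OF c(2)] realize_coset[OF ev_eq_0_iff] by simp
    moreover have "inj_on (realize y) (carrier (quot_ring H))"
      using ring_iso_memE(5)[OF ext.\<phi>_iso] by (simp add: bij_betw_def)
    ultimately show ?thesis by (simp add: \<psi>_def inv_into_f_f quot_const_mem)
  qed
  then have "ext_isomorphic (quot_ring H) (quot_const H) G"
    unfolding ext_isomorphic_def using iso by blast
  then show ?thesis using G(1) by (auto simp: deg_in_eq_0_iff)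
qed

end

context monic_irreducible
begin

lemma exists_root: "\<exists>y. ev y h = 0"
proof -
  have "Polynomial.degree (map_poly \<eta> h) > 0" using degree_pos by simp
  then show ?thesis unfolding ev_def by (rule alg_closed_imp_poly_has_root)
qed

proposition cond_II_at_iff_no_polynomial_root:
  "cond_II_at H i \<longleftrightarrow> \<not> has_polynomial_root mpol_to_closure (as_bivariate i H)"
proof -
  obtain y where "ev y h = 0" using exists_root by blast
  then interpret irreducible_extension i H y by unfold_locales
  have "\<not> cond_II_at H i" if "poly (map_poly \<Theta> H) Q = 0" for Q
  proof -
    interpret bivariate_solution i H Q by unfold_locales (rule that)
    show ?thesis by (rule not_cond_II_at)
  qed
  then show ?thesis unfolding has_polynomial_root_iff using solution_if_not_cond_II_at by blast
qed

end

text \<open>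
  The embedding of the extension depends on the index: a different one is used for each index at which
  \<open>cond_II_at\<close> is considered.
\<close>

proposition cond_I_iff_cond_II:
  fixes H :: "('i::{finite,linorder}, 'k::field_char_0) mpol poly"
  assumes "irreducible_ratfun H" "Polynomial.lead_coeff H = 1"
  shows "cond_I H \<longleftrightarrow> cond_II H"
proof -
  have m: "monic_irreducible H" using assms by unfold_locales
  have e: "\<exists>y. irreducible_extension i H y" for i
  proof -
    interpret monic_irreducible i H by (rule m)
    obtain y where "ev y h = 0" using exists_root by blast
    then show ?thesis using irreducible_extension.intro[OF m] by (auto simp: irreducible_extension_axioms_def)
  qed
  show ?thesis
  proof
    assume I: "cond_I H"
    show "cond_II H" unfolding cond_II_def
    proof
      fix i show "cond_II_at H i"
      proof (rule ccontr)
        assume not: "\<not> cond_II_at H i"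
        interpret monic_irreducible i H by (rule m)
        obtain Q where Q: "poly (map_poly \<Theta> H) Q = 0"
          using not cond_II_at_iff_no_polynomial_root has_polynomial_root_iff by blast
        interpret bivariate_solution i H Q by unfold_locales (rule Q)
        show False using ext_isomorphic_without I ext.genuine_polynomial_iff unfolding cond_I_def by blast
      qed
    qed
  next
    assume II: "cond_II H"
    obtain y where "irreducible_extension undefined H y" using e by blast
    then interpret u: irreducible_extension undefined H y .
    show "cond_I H" unfolding cond_I_def u.genuine_polynomial_iff
    proof (intro conjI allI impI)
      show "range (quot_const H) \<noteq> carrier (quot_ring H)"
        using u.not_cond_II_at_if_trivial II by (auto simp: cond_II_def)
      fix G j assume G: "ext_isomorphic (quot_ring H) (quot_const H) G"
      obtain z where "irreducible_extension j H z" using e by blast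
      then show "deg_in j G \<noteq> 0"
        using irreducible_extension.not_cond_II_at_if_ext_isomorphic[of j H z G] G II
        by (auto simp: cond_II_def)
    qed
  qed
qed

theorem theorem6p7:
  fixes H :: "('i::{finite,linorder}, 'k::field_char_0) mpol poly"
    and n D :: nat
  assumes "number_field TYPE('k)"
    and "card (UNIV :: 'i set) = n" and "n \<ge> 1"
    and "integral_coeffs H"
    and "irreducible_ratfun H"
    and "Polynomial.lead_coeff H = 1"
    and "total_deg H = D"
  shows "(cond_I H \<longleftrightarrow> cond_II H) \<and> (cond_II H \<longleftrightarrow> cond_III H) \<and>
         (\<forall>B_lin. is_B_lin TYPE('k) B_lin \<longrightarrow> (cond_III H \<longleftrightarrow> cond_IV B_lin H)) \<and>
         (\<forall>i0. (cond_II_at H i0 \<longleftrightarrow> cond_III_at H i0) \<and>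
            (\<forall>B_lin. is_B_lin TYPE('k) B_lin \<longrightarrow> (cond_III_at H i0 \<longleftrightarrow> cond_IV_at B_lin H i0)))"
proof -
  have "monic_irreducible H" using assms(5,6) by unfold_locales
  then have II_III: "cond_II_at H i \<longleftrightarrow> cond_III_at H i" for i
    using monic_irreducible.cond_II_at_iff_no_polynomial_root
      cond_III_at_iff_no_polynomial_root[OF assms(6)] by blast
  have III_IV: "cond_III_at H i \<longleftrightarrow> cond_IV_at B H i" if "is_B_lin TYPE('k) B" for i B
    using cond_III_at_iff_cond_IV_at[OF assms(6) that] .
  show ?thesis
    using cond_I_iff_cond_II[OF assms(5,6)] II_III III_IV
    by (simp add: cond_II_def cond_III_def cond_IV_def)
qed

end
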